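(* Let $\nu$ be a $\tau$-invariant Borel probability measure on $[0,1]$ (not necessarily a Gibbs measure) and $\mu=(\mathrm{Id},W)^\ast\nu$. Suppose that for $\nu^-\otimes\nu$-a.a. $(\xi,x)$ the measures $\nu_{(\xi,q_\xi(x))}$ and $\nu\circ q_\xi^{-1}$ are exact dimensional with constant dimensions $$\gamma_1:=\dim_H(\nu_{(\xi,q_\xi(x))}),\qquad\gamma_2:=\dim_H(\nu\circ q_\xi^{-1}),$$ and that $\mu$ is exact dimensional with $\dim_H(\mu)=\gamma_1+\gamma_2$. If the distribution of $\Theta(\cdot,x)$ under $\nu^-$ has Hausdorff dimension $1$ for $\nu$-a.e. $x\in[0,1]$, then $$\gamma_2=1\ \text{ if }\dim_H(\mu)\ge1,\qquad \gamma_1=0\ \text{ if }\dim_H(\mu)<1 .$$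
   Context: **Setting.** $(I_i)_{i=0}^{\ell-1}$ is a partition of $[0,1]$ into intervals with interiors $I_i^\circ$. $C^{1+}$ means differentiable with Hölder continuous derivative. $\tau:[0,1]\to[0,1]$ is such that each $\tau|_{I_i^\circ}:I_i^\circ\to(0,1)$ is a $C^{1+}$-diffeomorphism with $\inf(\tau|_{I_i^\circ})'>1$. The functions $\lambda:[0,1]\to(0,1)$ and $g:[0,1]\to\mathbb R$ are $C^{1+}$ on each $I_i^\circ$, with $\lambda\tau'>1$; the bounds are uniform, i.e. $\sup\lambda<1$ and $\inf\lambda\tau'>1$. Endpoint convention: on each $I_i$ the functions $\tau,\lambda,g$ are the continuous extensions from $I_i^\circ$; $\tau',\lambda',g'$ at endpoints, and expressions like $\lambda(\rho_i(x))$ for $x\in\{0,1\}$, are understood as limits from the interior. **Notation.** $\phi^n:=\prod_{j=0}^{n-1}\phi\circ\tau^j$ for functions $\phi$ on $[0,1]$. $W(x):=\sum_{n\ge0}\lambda^n(x)\,g(\tau^n(x))$. $\rho_i:[0,1]\to\overline{I_i}$ is the continuous extension of $(\tau|_{I_i^\circ})^{-1}$; $\rho_{(\omega_1,\dots,\omega_n)}:=\rho_{\omega_n}\circ\cdots\circ\rho_{\omega_1}$; $k(x):=i$ for $x\in I_i$; $[x]_n:=(k(x),k(\tau x),\dots,k(\tau^{n-1}x))$; $I_{(\omega_1,\dots,\omega_N)}:=\{v\in[0,1]:[v]_N=(\omega_1,\dots,\omega_N)\}$; $I_N(x):=I_{[x]_N}$; $R_{(\omega_1,\dots,\omega_N)}:=I_{(\omega_1,\dots,\omega_N)}\times\mathbb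 R$. **Strong stable fibres.** Let $\gamma:=1/(\tau'\lambda)$, $W_n(x):=\sum_{j=0}^{n-1}\lambda^j(x)g(\tau^jx)$, $F^n_{(\xi,x)}(y):=\lambda^n(\rho_{[\xi]_n}(x))\,y+W_n(\rho_{[\xi]_n}(x))$ (so $F^0_{(\xi,x)}(y)=y$), and $$X_3(\xi,x,y):=-\sum_{n=1}^\infty\gamma^n(\rho_{[\xi]_n}(x))\Big(F^{n-1}_{(\xi,x)}(y)\,\lambda'(\rho_{[\xi]_n}(x))+g'(\rho_{[\xi]_n}(x))\Big),\qquad\Theta(\xi,x):=X_3(\xi,x,W(x)).$$ $\ell^{ss}_{(\xi,x,y)}:[0,1]\to\mathbb R$ is the solution of $(\ell^{ss}_{(\xi,x,y)})'(v)=X_3(\xi,v,\ell^{ss}_{(\xi,x,y)}(v))$, $\ell^{ss}_{(\xi,x,y)}(x)=y$. Put $\pi^{ss}_\xi(x,y):=\ell^{ss}_{(\xi,x,y)}(0)$, $q_\xi(x):=\pi^{ss}_\xi(x,W(x))$ and $B^T_{\xi,r}(z):=(\pi^{ss}_\xi)^{-1}([z-r,z+r])\subseteq[0,1]\times\mathbb R$. **Measures.** $(\mathrm{Id},W)^\ast\nu$ is the push-forward of $\nu$ under $x\mapsto(x,W(x))$. $\nu^{\mathrm{ext}}$ is the unique Borel probability measure on $[0,1]^2$ with $\nu^{\mathrm{ext}}(I_M(\xi)\times I_N(x))=\nu(I_{M+N}(\rho_{[\xi]_M}(x)))$ for all $M,N\in\mathbb N$, $(\xi,x)\in[0,1]^2$,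 and $\nu^-:=\nu^{\mathrm{ext}}(\,\cdot\,\times[0,1])$. **Conditional measures.** Fix $\xi$. Let $\mathcal G_\xi$ be the set of $z\in\mathbb R$ such that $\varrho_{\xi,\omega}(z):=\lim_{r\to0}\mu(B^T_{\xi,r}(z)\cap R_\omega)/\mu(B^T_{\xi,r}(z))$ exists for every finite word $\omega$ over $\{0,\dots,\ell-1\}$. For $z\in\mathcal G_\xi$ let $\tilde\nu_{(\xi,z)}$ be the Borel probability measure on $\{0,\dots,\ell-1\}^{\mathbb N}$ giving mass $\varrho_{\xi,\omega}(z)$ to the cylinder of sequences starting with $\omega$, for each $\omega$, and let $\nu_{(\xi,z)}:=\tilde\nu_{(\xi,z)}\circ\chi^{-1}$, where $\chi(\omega)$ is the unique point of $\bigcap_N\overline{I_{(\omega_1,\dots,\omega_N)}}$; for $z\notin\mathcal G_\xi$ put $\nu_{(\xi,z)}:=\nu$. **Dimension.** A Borel probability measure $\kappa$ on a metric space is exact dimensional if $\lim_{r\to0}\log\kappa(B_r(x))/\log r$ ($B_r(x)$ the closed ball) exists and is constant for $\kappa$-a.a. $x$; then this constant is its Hausdorff dimension $\dim_H(\kappa)$. *)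

theory Defs
  imports "HOL-Probability.Probability"
begin

abbreviation borel01 :: "real measure" where
  "borel01 \<equiv> restrict_space borel {0..1}"

definition C1plus_on :: "real set \<Rightarrow> (real \<Rightarrow> real) \<Rightarrow> bool" where
  "C1plus_on U f \<longleftrightarrow>
     (\<forall>x\<in>U. f differentiable at x) \<and>
     (\<exists>\<alpha> C. 0 < \<alpha> \<and> \<alpha> \<le> 1 \<and>
        (\<forall>x\<in>U. \<forall>y\<in>U. \<bar>deriv f x - deriv f y\<bar> \<le> C * \<bar>x - y\<bar> powr \<alpha>))"

definition C1plus_diffeo :: "real set \<Rightarrow> real set \<Rightarrow> (real \<Rightarrow> real) \<Rightarrow> bool" where
  "C1plus_diffeo U V f \<longleftrightarrow>
     bij_betw f U V \<and> C1plus_on U f \<and> C1plus_on V (the_inv_into U f)"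

record wsystem =
  branches :: nat
  piece :: "nat \<Rightarrow> real set"
  tau :: "real \<Rightarrow> real"
  lam :: "real \<Rightarrow> real"
  gen :: "real \<Rightarrow> real"

text \<open>The functions are only relevant on the unit interval; values elsewhere are never used.\<close>

definition weierstrass_system :: "wsystem \<Rightarrow> bool" where
  "weierstrass_system S \<longleftrightarrow>
     (\<forall>i<branches S. is_interval (piece S i)) \<and>
     disjoint_family_on (piece S) {..<branches S} \<and>
     (\<Union>i<branches S. piece S i) = {0..1} \<and>
     tau S \<in> {0..1} \<rightarrow> {0..1} \<and>
     lam S \<in> {0..1} \<rightarrow> {0<..<1} \<and>
     (\<forall>i<branches S.
        C1plus_diffeo (interior (piece S i)) {0<..<1} (tau S) \<and>
        C1plus_on (interior (piece S i)) (lam S) \<and>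
        C1plus_on (interior (piece S i)) (gen S) \<and>
        continuous_on (piece S i) (tau S) \<and>
        continuous_on (piece S i) (lam S) \<and>
        continuous_on (piece S i) (gen S)) \<and>
     (\<exists>c>1. \<forall>i<branches S. \<forall>x\<in>interior (piece S i). c \<le> deriv (tau S) x) \<and>
     (\<exists>c<1. \<forall>x\<in>{0..1}. lam S x \<le> c) \<and>
     (\<exists>c>1. \<forall>i<branches S. \<forall>x\<in>interior (piece S i). c \<le> lam S x * deriv (tau S) x)"

text \<open>Value at an end point of the unit interval understood as limit from the interior.\<close>

definition int_lim :: "(real \<Rightarrow> real) \<Rightarrow> real \<Rightarrow> real" where
  "int_lim f x = (if x \<in> {0<..<1} then f x else Lim (at x within {0<..<1}) f)"

definition rho :: "wsystem \<Rightarrow> nat \<Rightarrow> real \<Rightarrow> real" where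
  "rho S i = int_lim (the_inv_into (interior (piece S i)) (tau S))"

text \<open>\<^term>\<open>fold\<close> applies the first letter first: the word \<open>[a, b]\<close> gives
  \<open>rho S b \<circ> rho S a\<close>.\<close>

definition rho_word :: "wsystem \<Rightarrow> nat list \<Rightarrow> real \<Rightarrow> real" where
  "rho_word S w = fold (rho S) w"

definition letter :: "wsystem \<Rightarrow> real \<Rightarrow> nat" where
  "letter S x = (THE i. i < branches S \<and> x \<in> piece S i)"

definition itin :: "wsystem \<Rightarrow> nat \<Rightarrow> real \<Rightarrow> nat list" where
  "itin S n x = map (\<lambda>j. letter S ((tau S ^^ j) x)) [0..<n]"

definition cyl :: "wsystem \<Rightarrow> nat list \<Rightarrow> real set" where
  "cyl S w = {v \<in> {0..1}. itin S (length w) v = w}"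

abbreviation cyl_at :: "wsystem \<Rightarrow> nat \<Rightarrow> real \<Rightarrow> real set" where
  "cyl_at S n x \<equiv> cyl S (itin S n x)"

text \<open>The expression \<open>\<phi> (rho_word S (itin S n \<xi>) x)\<close> as a function of \<open>x\<close> in the unit
  interval. For interior \<open>x\<close> the point and its first \<open>n\<close> iterates lie in the interior of their
  pieces, apart possibly from the last iterate \<open>x\<close> itself. For \<open>x\<close> equal to 0 or 1 the inverse
  image may be an end point belonging to a neighbouring piece, so the whole expression has to be
  taken as a limit from the interior.\<close>

definition pull :: "wsystem \<Rightarrow> real \<Rightarrow> nat \<Rightarrow> (real \<Rightarrow> real) \<Rightarrow> real \<Rightarrow> real" where
  "pull S \<xi> n \<phi> = int_lim (\<lambda>x. \<phi> (rho_word S (itin S n \<xi>) x))"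

definition cocycle :: "wsystem \<Rightarrow> (real \<Rightarrow> real) \<Rightarrow> nat \<Rightarrow> real \<Rightarrow> real" where
  "cocycle S \<phi> n x = (\<Prod>j<n. \<phi> ((tau S ^^ j) x))"

definition W :: "wsystem \<Rightarrow> real \<Rightarrow> real" where
  "W S x = (\<Sum>n. cocycle S (lam S) n x * gen S ((tau S ^^ n) x))"

definition W_part :: "wsystem \<Rightarrow> nat \<Rightarrow> real \<Rightarrow> real" where
  "W_part S n x = (\<Sum>j<n. cocycle S (lam S) j x * gen S ((tau S ^^ j) x))"

definition gam :: "wsystem \<Rightarrow> real \<Rightarrow> real" where
  "gam S x = 1 / (deriv (tau S) x * lam S x)"

definition fibre_map :: "wsystem \<Rightarrow> nat \<Rightarrow> real \<Rightarrow> real \<Rightarrow> real \<Rightarrow> real" where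
  "fibre_map S n \<xi> x y = pull S \<xi> n (cocycle S (lam S) n) x * y + pull S \<xi> n (W_part S n) x"

definition X3 :: "wsystem \<Rightarrow> real \<Rightarrow> real \<Rightarrow> real \<Rightarrow> real" where
  "X3 S \<xi> x y =
     - (\<Sum>m. let n = Suc m in
          pull S \<xi> n (cocycle S (gam S) n) x *
          (fibre_map S (n - 1) \<xi> x y * pull S \<xi> n (deriv (lam S)) x
            + pull S \<xi> n (deriv (gen S)) x))"

definition Theta :: "wsystem \<Rightarrow> real \<Rightarrow> real \<Rightarrow> real" where
  "Theta S \<xi> x = X3 S \<xi> x (W S x)"

text \<open>Extensionality makes the solution on the unit interval unique as a HOL function.\<close>

definition ell_ss :: "wsystem \<Rightarrow> real \<Rightarrow> real \<Rightarrow> real \<Rightarrow> real \<Rightarrow> real" where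
  "ell_ss S \<xi> x y =
     (THE f. f \<in> extensional {0..1} \<and>
        (\<forall>v\<in>{0..1}. (f has_real_derivative X3 S \<xi> v (f v)) (at v within {0..1})) \<and>
        f x = y)"

definition pi_ss :: "wsystem \<Rightarrow> real \<Rightarrow> real \<Rightarrow> real \<Rightarrow> real" where
  "pi_ss S \<xi> x y = ell_ss S \<xi> x y 0"

definition q :: "wsystem \<Rightarrow> real \<Rightarrow> real \<Rightarrow> real" where
  "q S \<xi> x = pi_ss S \<xi> x (W S x)"

definition BT :: "wsystem \<Rightarrow> real \<Rightarrow> real \<Rightarrow> real \<Rightarrow> (real \<times> real) set" where
  "BT S \<xi> r z = {(x, y). x \<in> {0..1} \<and> pi_ss S \<xi> x y \<in> {z - r..z + r}}"

definition graph_measure :: "wsystem \<Rightarrow> real measure \<Rightarrow> (real \<times> real) measure" where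
  "graph_measure S \<nu> = distr \<nu> borel (\<lambda>x. (x, W S x))"

text \<open>The right-hand side is \<open>\<nu>\<close> of the cylinder of rank \<open>M + N\<close> around
  \<open>rho_word S (itin S M \<xi>) x\<close>, again read as a limit from the interior if \<open>x\<close> is 0 or 1;
  otherwise the condition could be inconsistent within one cylinder around 0 or 1.\<close>

definition nu_ext :: "wsystem \<Rightarrow> real measure \<Rightarrow> (real \<times> real) measure" where
  "nu_ext S \<nu> =
     (THE E. prob_space E \<and> sets E = sets (restrict_space borel ({0..1} \<times> {0..1})) \<and>
        (\<forall>M N. \<forall>\<xi>\<in>{0..1}. \<forall>x\<in>{0..1}.
           measure E (cyl_at S M \<xi> \<times> cyl_at S N x) =
           pull S \<xi> M (\<lambda>v. measure \<nu> (cyl_at S (M + N) v)) x))"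

definition nu_minus :: "wsystem \<Rightarrow> real measure \<Rightarrow> real measure" where
  "nu_minus S \<nu> = distr (nu_ext S \<nu>) borel01 fst"

definition cond_ratio :: "wsystem \<Rightarrow> real measure \<Rightarrow> real \<Rightarrow> nat list \<Rightarrow> real \<Rightarrow> real \<Rightarrow> real" where
  "cond_ratio S \<nu> \<xi> w z r =
     measure (graph_measure S \<nu>) (BT S \<xi> r z \<inter> (cyl S w \<times> UNIV)) /
     measure (graph_measure S \<nu>) (BT S \<xi> r z)"

text \<open>Positivity of the denominators is required explicitly because division by zero yields zero
  in HOL, so that the limit would exist spuriously.\<close>

definition good_set :: "wsystem \<Rightarrow> real measure \<Rightarrow> real \<Rightarrow> real set" where
  "good_set S \<nu> \<xi> =
     {z. (\<forall>r>0. measure (graph_measure S \<nu>) (BT S \<xi> r z) > 0) \<and>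
         (\<forall>w. set w \<subseteq> {..<branches S} \<longrightarrow>
            (\<exists>L. (cond_ratio S \<nu> \<xi> w z \<longlongrightarrow> L) (at_right 0)))}"

definition cond_mass :: "wsystem \<Rightarrow> real measure \<Rightarrow> real \<Rightarrow> nat list \<Rightarrow> real \<Rightarrow> real" where
  "cond_mass S \<nu> \<xi> w z = Lim (at_right 0) (cond_ratio S \<nu> \<xi> w z)"

abbreviation seq_space :: "wsystem \<Rightarrow> (nat \<Rightarrow> nat) measure" where
  "seq_space S \<equiv> PiM UNIV (\<lambda>_. count_space {..<branches S})"

definition cond_seq_measure :: "wsystem \<Rightarrow> real measure \<Rightarrow> real \<Rightarrow> real \<Rightarrow> (nat \<Rightarrow> nat) measure"
  where
  "cond_seq_measure S \<nu> \<xi> z =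
     (THE P. prob_space P \<and> sets P = sets (seq_space S) \<and>
        (\<forall>w. set w \<subseteq> {..<branches S} \<longrightarrow>
           measure P {s \<in> space (seq_space S). \<forall>j<length w. s j = w ! j} = cond_mass S \<nu> \<xi> w z))"

definition chi :: "wsystem \<Rightarrow> (nat \<Rightarrow> nat) \<Rightarrow> real" where
  "chi S s = (THE v. v \<in> (\<Inter>N. closure (cyl S (map s [0..<N]))))"

definition nu_cond :: "wsystem \<Rightarrow> real measure \<Rightarrow> real \<Rightarrow> real \<Rightarrow> real measure" where
  "nu_cond S \<nu> \<xi> z =
     (if z \<in> good_set S \<nu> \<xi> then distr (cond_seq_measure S \<nu> \<xi> z) borel01 (chi S) else \<nu>)"

text \<open>The ambient metric space is \<open>space \<kappa>\<close>, hence the intersection.\<close>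

definition has_exact_dim :: "'a::metric_space measure \<Rightarrow> real \<Rightarrow> bool" where
  "has_exact_dim \<kappa> d \<longleftrightarrow>
     (AE x in \<kappa>. ((\<lambda>r. ln (measure \<kappa> (cball x r \<inter> space \<kappa>)) / ln r) \<longlongrightarrow> d) (at_right 0))"

definition exact_dimensional :: "'a::metric_space measure \<Rightarrow> bool" where
  "exact_dimensional \<kappa> \<longleftrightarrow> (\<exists>d. has_exact_dim \<kappa> d)"

text \<open>Only meaningful for exact dimensional \<open>\<kappa>\<close>, where the constant is the Hausdorff dimension.\<close>

definition dim_H :: "'a::metric_space measure \<Rightarrow> real" where
  "dim_H \<kappa> = (THE d. has_exact_dim \<kappa> d)"

end

theory Submission
  imports Defs
begin

text \<open>Only the graph dimension \<open>\<gamma> = dim_H \<mu>\<close> and \<open>\<gamma>\<^sub>2\<close> matter; the conditional measures enter through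
  \<open>\<gamma>\<^sub>1 = \<gamma> - \<gamma>\<^sub>2\<close> alone. The projections \<open>q S \<xi>\<close> are Lipschitz on the graph, so \<open>\<gamma>\<^sub>2 \<le> min 1 \<gamma>\<close>, and it
  remains to derive a contradiction from \<open>\<gamma>\<^sub>2 < min 1 \<gamma>\<close>. Let \<open>r = \<delta> powr (1 + \<alpha>)\<close> and call a cell the set
  of points of the graph at distance at most \<open>2 * \<delta>\<close> from a given point whose projections differ from the
  given one by at most \<open>r\<close>. Counting cells shows that typical cells have measure at least about
  \<open>\<delta> powr (\<gamma> - \<gamma>\<^sub>2) * r powr \<gamma>\<^sub>2\<close>. Conversely, the fibres are \<open>C^(1 + \<alpha>)\<close> with slopes \<open>Theta S \<xi> x\<close>, so
  two points of the graph at distance \<open>d\<close> share a cell only if \<open>Theta S \<xi> x\<close> lies in an interval of length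
  \<open>O(r / d)\<close>. As these slopes have dimension 1, the \<open>\<xi>\<close>-average of the measure of a cell is at most about
  \<open>r powr t * \<delta> powr (\<gamma> - t)\<close> for every \<open>t < min 1 \<gamma>\<close>, which is smaller if \<open>t > \<gamma>\<^sub>2\<close>.

  The fibre equation is affine in its unknown, so its solutions are explicit. The measure \<open>nu_ext S \<nu>\<close> is
  the joint law of the past and the present in the natural extension, given by Kolmogorov's theorem.\<close>

section \<open>Local dimension\<close>

text \<open>The exponent in \<open>r = \<delta> powr (1 + \<alpha>)\<close> comes from the fibres:
  it is the order of their Taylor error over a distance \<open>\<delta>\<close>, so that a fibre is
  straight up to the width of a cell. In powers of \<open>\<delta>\<close> the two cell estimates
  have the exponents \<open>\<gamma> + \<alpha> * \<gamma>\<^sub>2\<close> and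
  \<open>\<gamma> + \<alpha> * t\<close>; the gain is
  \<open>\<alpha> * (t - \<gamma>\<^sub>2)\<close>, and all losses have to fit into it. Local
  dimensions come with constants that depend on the point and on \<open>\<xi>\<close>. The estimates
  are therefore run on a set of pairs of measure at least 1/2 with one common constant, which is why
  joint measurability in \<open>(\<xi>, x)\<close> has to be established. It holds because the
  coefficients of the fibre equation depend on \<open>\<xi>\<close> through its itinerary, with
  geometrically small tails. Of \<open>W\<close> itself only boundedness and measurability enter.
  The other obstacle is coding: a sequence of past letters need not be the itinerary of a point,
  since its limit point may lie on the wrong side of a boundary between pieces. Such sequences have
  a constant tail without being constant, and stationarity makes them a null set.\<close>

lemma has_exact_dim_unique:
  assumes "prob_space \<kappa>" "has_exact_dim \<kappa> d" "has_exact_dim \<kappa> d'"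
  shows "d = d'"
proof -
  interpret prob_space \<kappa> by fact
  have "AE x in \<kappa>. d = d'"
    using assms(2,3) unfolding has_exact_dim_def
    by eventually_elim (rule tendsto_unique[OF trivial_limit_at_right_real])
  then show ?thesis by simp
qed

lemma has_exact_dim_dim_H:
  assumes "prob_space \<kappa>" "exact_dimensional \<kappa>"
  shows "has_exact_dim \<kappa> (dim_H \<kappa>)"
  using assms has_exact_dim_unique[OF assms(1)] unfolding exact_dimensional_def dim_H_def
  by (metis theI)

text \<open>A point with a null ball around it lies in a null member of a countable basis, and these
  members together form a null set. Positivity is needed for lower bounds on masses: since
  \<open>ln 0 = 0\<close> in HOL, the logarithmic ratio says nothing about a ball of mass 0.\<close>

lemma AE_cball_pos:
  fixes M :: "'a :: {metric_space, second_countable_topology} measure"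
  assumes "prob_space M" and sets: "sets M = sets borel"
  shows "AE x in M. \<forall>r>0. 0 < measure M (cball x r)"
proof -
  interpret prob_space M by fact
  obtain B :: "'a set set" where B: "countable B" "topological_basis B"
    using ex_countable_basis by blast
  define Z where "Z = {b \<in> B. emeasure M b = 0}"
  have meas: "b \<in> sets M" if "b \<in> B" for b
    using that B(2) sets by (auto dest: topological_basis_open)
  have "AE x in M. \<forall>b\<in>Z. x \<notin> b"
    by (subst AE_ball_countable)
      (auto simp: Z_def intro!: countable_subset[OF _ B(1)] AE_not_in null_setsI meas)
  then show ?thesis
  proof eventually_elim
    case (elim x)
    show ?case
    proof (intro allI impI)
      fix r :: real assume "r > 0"
      obtain b where b: "b \<in> B" "x \<in> b" "b \<subseteq> ball x r"
        using B(2) \<open>r > 0\<close> by (metis open_ball centre_in_ball topological_basisE)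
      have "cball x r \<in> sets M" using sets by simp
      then have "emeasure M b \<le> emeasure M (cball x r)"
        using b(3) by (intro emeasure_mono) auto
      moreover have "emeasure M b \<noteq> 0" using elim b by (auto simp: Z_def)
      ultimately show "0 < measure M (cball x r)"
        by (simp add: emeasure_eq_measure)
          (metis less_le_trans measure_nonneg order_neq_le_trans)
    qed
  qed
qed

text \<open>Multiplying by \<open>ln r < 0\<close> reverses the inequalities before exponentiation.
  Only the lower bound needs \<open>m r > 0\<close>; a vanishing mass satisfies the upper one
  trivially.\<close>

lemma ln_ratio_bounds:
  fixes m :: "real \<Rightarrow> real"
  assumes lim: "((\<lambda>r. ln (m r) / ln r) \<longlongrightarrow> d) (at_right 0)"
    and "\<epsilon> > 0" "\<And>r. 0 \<le> m r"
  shows "\<forall>\<^sub>F r in at_right 0. m r \<le> r powr (d - \<epsilon>) \<and> (m r > 0 \<longrightarrow> r powr (d + \<epsilon>) \<le> m r)"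
proof -
  have 1: "\<forall>\<^sub>F r in at_right 0. d - \<epsilon> < ln (m r) / ln r"
    "\<forall>\<^sub>F r in at_right 0. ln (m r) / ln r < d + \<epsilon>"
    using lim \<open>\<epsilon> > 0\<close> by (auto intro: order_tendstoD)
  have 2: "\<forall>\<^sub>F r in at_right (0::real). 0 < r \<and> r < 1"
    by (auto simp: eventually_at_right_field intro!: exI[of _ 1])
  from 1 2 show ?thesis
  proof eventually_elim
    case (elim r)
    then have r: "ln r < 0" "0 < r" by auto
    have a: "ln (m r) < (d - \<epsilon>) * ln r" "(d + \<epsilon>) * ln r < ln (m r)"
      using elim r by (auto simp: field_simps)
    show ?case
    proof (cases "m r = 0")
      case False
      then have pos: "0 < m r" using assms(3)[of r] by simp
      then have "exp (ln (m r)) = m r" by simp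
      then show ?thesis
        using a r exp_less_cancel_iff[of "ln (m r)"] exp_less_cancel_iff[of _ "ln (m r)"]
        by (simp add: powr_def less_imp_le)
    qed simp
  qed
qed

text \<open>The finitely many exceptional indices are absorbed into the constant, which is a natural
  number so that the later exhaustion over constants is a countable union.\<close>

lemma eventually_bounded_ratio:
  fixes a b :: "nat \<Rightarrow> real"
  assumes "\<forall>\<^sub>F n in sequentially. a n \<le> b n" and b: "\<And>n. 0 < b n"
  shows "\<exists>K::nat. \<forall>n. a n \<le> real K * b n"
proof -
  obtain n0 where n0: "\<And>n. n \<ge> n0 \<Longrightarrow> a n \<le> b n"
    using assms(1) by (auto simp: eventually_sequentially)
  \<comment> \<open>The sum serves the indices below \<open>n0\<close>, the summand 1 those from
    \<open>n0\<close> on.\<close>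
  obtain K :: nat where K: "(\<Sum>n<n0. \<bar>a n\<bar> / b n) + 1 \<le> real K"
    using real_arch_simple by blast
  have "a n \<le> real K * b n" for n
  proof (cases "n < n0")
    case True
    have "\<bar>a n\<bar> / b n \<le> (\<Sum>n<n0. \<bar>a n\<bar> / b n)"
      using True b by (intro member_le_sum) (auto intro!: divide_nonneg_pos)
    then have "\<bar>a n\<bar> / b n \<le> real K" using K by simp
    then show ?thesis using b[of n] by (simp add: field_simps)
  next
    case False
    have "0 \<le> (\<Sum>n<n0. \<bar>a n\<bar> / b n)"
      using b by (intro sum_nonneg) (auto intro!: divide_nonneg_pos)
    then have "1 * b n \<le> real K * b n" using K b[of n] by (intro mult_right_mono) auto
    then show ?thesis using n0[of n] False by auto
  qed
  then show ?thesis by blast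
qed

lemma dyadic_at_right: "filterlim (\<lambda>n. (1/2)^n :: real) (at_right 0) sequentially"
  by (auto simp: filterlim_at intro!: always_eventually LIMSEQ_realpow_zero)

lemma dyadic_bracket:
  fixes \<rho> :: real
  assumes "0 < \<rho>" "\<rho> \<le> 1"
  obtains n where "(1/2)^Suc n < \<rho>" "\<rho> \<le> (1/2)^n"
proof -
  obtain k where k: "(1/2::real)^k < \<rho>" using assms real_arch_pow_inv[of \<rho> "1/2"] by auto
  define n where "n = (LEAST n. (1/2::real)^n < \<rho>)"
  have n: "(1/2)^n < \<rho>" unfolding n_def using k by (rule LeastI)
  with assms have "n \<noteq> 0" by (intro notI) auto
  then obtain j where j: "n = Suc j" using not0_implies_Suc by blast
  have "\<not> (1/2)^j < \<rho>" using not_less_Least[of j "\<lambda>n. (1/2::real)^n < \<rho>"] j n_def by auto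
  then show ?thesis using that[of j] n j by auto
qed

text \<open>Between consecutive dyadic radii monotonicity costs at most a factor
  \<open>2 powr \<bar>s\<bar>\<close>. The absolute value is there because exponents of the form
  \<open>d - \<epsilon>\<close> may be negative.\<close>

lemma dyadic_to_real:
  fixes m :: "real \<Rightarrow> real"
  assumes mono: "\<And>r r'. 0 < r \<Longrightarrow> r \<le> r' \<Longrightarrow> m r \<le> m r'"
    and K: "0 \<le> K" "\<And>n. m ((1/2)^n) \<le> K * ((1/2)^n) powr s"
    and \<rho>: "0 < \<rho>" "\<rho> \<le> 1"
  shows "m \<rho> \<le> K * 2 powr \<bar>s\<bar> * \<rho> powr s"
proof -
  obtain n where n: "(1/2)^Suc n < \<rho>" "\<rho> \<le> (1/2)^n" using dyadic_bracket[OF \<rho>] .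
  have "((1/2)^n) powr s \<le> 2 powr \<bar>s\<bar> * \<rho> powr s"
  proof (cases "s \<ge> 0")
    case True
    have "((1/2)^n) powr s \<le> (2 * \<rho>) powr s" using n True by (intro powr_mono2) auto
    then show ?thesis using True \<rho> by (simp add: powr_mult)
  next
    case False
    have "((1/2)^n) powr s \<le> 1 * \<rho> powr s" using n False \<rho> by (auto intro!: powr_mono2')
    also have "\<dots> \<le> 2 powr \<bar>s\<bar> * \<rho> powr s" by (intro mult_right_mono) (auto intro: ge_one_powr_ge_zero)
    finally show ?thesis .
  qed
  then have "K * ((1/2)^n) powr s \<le> K * (2 powr \<bar>s\<bar> * \<rho> powr s)" using K by (intro mult_left_mono)
  moreover have "m \<rho> \<le> m ((1/2)^n)" using n \<rho> by (intro mono) auto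
  ultimately show ?thesis using K(2)[of n] by (simp add: mult.assoc)
qed

lemma dyadic_to_real_lower:
  fixes m :: "real \<Rightarrow> real"
  assumes mono: "\<And>r r'. 0 < r \<Longrightarrow> r \<le> r' \<Longrightarrow> m r \<le> m r'"
    and K: "0 \<le> K" "\<And>n. ((1/2)^n) powr s \<le> K * m ((1/2)^n)"
    and \<rho>: "0 < \<rho>" "\<rho> \<le> 1"
  shows "\<rho> powr s \<le> K * 2 powr \<bar>s\<bar> * m \<rho>"
proof -
  obtain n where n: "(1/2)^Suc n < \<rho>" "\<rho> \<le> (1/2)^n" using dyadic_bracket[OF \<rho>] .
  have "\<rho> powr s \<le> 2 powr \<bar>s\<bar> * ((1/2)^Suc n) powr s"
  proof (cases "s \<ge> 0")
    case True
    have "\<rho> powr s \<le> (2 * (1/2)^Suc n) powr s" using n True \<rho> by (intro powr_mono2) auto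
    also have "\<dots> = 2 powr s * ((1/2)^Suc n) powr s" by (subst powr_mult) auto
    finally show ?thesis using True by simp
  next
    case False
    have "\<rho> powr s \<le> 1 * ((1/2)^Suc n) powr s" using n False \<rho>
      by (auto intro!: powr_mono2' simp del: power_Suc)
    also have "\<dots> \<le> 2 powr \<bar>s\<bar> * ((1/2)^Suc n) powr s"
      by (intro mult_right_mono) (auto intro: ge_one_powr_ge_zero)
    finally show ?thesis .
  qed
  also have "\<dots> \<le> 2 powr \<bar>s\<bar> * (K * m ((1/2)^Suc n))"
    by (intro mult_left_mono K(2)) auto
  also have "\<dots> \<le> 2 powr \<bar>s\<bar> * (K * m \<rho>)"
    using K n by (intro mult_left_mono mono) auto
  finally show ?thesis by (simp add: mult_ac)
qed

section \<open>Packing\<close>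

text \<open>A maximal separated set is a net.\<close>

lemma packing_net:
  fixes f :: "'a \<Rightarrow> 'b::{metric_space, second_countable_topology}"
  assumes "prob_space N" and f: "f \<in> borel_measurable N" and S: "S \<subseteq> space N"
    and B: "B \<in> sets N" "measure N B \<le> M" and c: "c > 0"
    and ball: "\<And>x. x \<in> S \<Longrightarrow> {y \<in> space N. dist (f x) (f y) \<le> s/2} \<subseteq> B"
    and lower: "\<And>x. x \<in> S \<Longrightarrow> c \<le> measure N {y \<in> space N. dist (f x) (f y) \<le> s/2}"
  shows "\<exists>F\<subseteq>S. finite F \<and> real (card F) * c \<le> M \<and> (\<forall>x\<in>S. \<exists>y\<in>F. dist (f x) (f y) \<le> s)"
proof -
  interpret prob_space N by fact
  have [measurable]: "f \<in> borel_measurable N" by fact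
  define sep where "sep F \<longleftrightarrow> F \<subseteq> S \<and> finite F \<and> (\<forall>x\<in>F. \<forall>y\<in>F. x \<noteq> y \<longrightarrow> dist (f x) (f y) > s)" for F
  define D where "D x = {y \<in> space N. dist (f x) (f y) \<le> s/2}" for x
  have D[measurable]: "D x \<in> sets N" for x unfolding D_def by measurable
  have bound: "real (card F) * c \<le> M" if "sep F" for F
  proof -
    have "real (card F) * c = (\<Sum>x\<in>F. c)" by simp
    also have "\<dots> \<le> (\<Sum>x\<in>F. measure N (D x))"
      using that lower by (intro sum_mono) (auto simp: D_def sep_def)
    also have "\<dots> = measure N (\<Union>x\<in>F. D x)"
    proof (rule finite_measure_finite_Union[symmetric])
      show "disjoint_family_on D F"
        unfolding disjoint_family_on_def
      proof (intro ballI impI)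
        fix x y assume xy: "x \<in> F" "y \<in> F" "x \<noteq> y"
        then have "dist (f x) (f y) > s" using that by (auto simp: sep_def)
        then have "\<not> (dist (f x) (f z) \<le> s/2 \<and> dist (f y) (f z) \<le> s/2)" for z
          using dist_triangle2[of "f x" "f y" "f z"] by linarith
        then show "D x \<inter> D y = {}" unfolding D_def by blast
      qed
    qed (use that in \<open>auto simp: sep_def\<close>)
    also have "\<dots> \<le> measure N B"
      using that ball B by (intro finite_measure_mono) (auto simp: D_def sep_def)
    finally show ?thesis using B by simp
  qed
  have "card F \<le> nat \<lceil>M / c\<rceil>" if "sep F" for F
  proof -
    have "real (card F) \<le> M / c" using bound[OF that] c by (simp add: field_simps)
    then show ?thesis by linarith
  qed
  moreover have "sep {}" by (auto simp: sep_def)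
  ultimately obtain F where F: "sep F" "\<And>G. sep G \<Longrightarrow> card G \<le> card F"
    using ex_has_greatest_nat[of sep "{}" card "Suc (nat \<lceil>M / c\<rceil>)"] by (auto simp: less_Suc_eq_le)
  have "\<exists>y\<in>F. dist (f x) (f y) \<le> s" if "x \<in> S" for x
  proof (rule ccontr)
    assume neg: "\<not> ?thesis"
    show False
    proof (cases "x \<in> F")
      case False
      have "sep (insert x F)" using F(1) neg that by (auto simp: sep_def dist_commute not_le)
      from F(2)[OF this] show False using False F(1) by (simp add: sep_def)
    next
      case True
      \<comment> \<open>As \<open>c\<close> is positive, the half ball around \<open>f x\<close> is
        non-empty, so \<open>s\<close> cannot be negative; then \<open>x\<close> is its own
        neighbour in the net.\<close>
      have "0 < measure N {y \<in> space N. dist (f x) (f y) \<le> s/2}" using lower[OF that] c by simp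
      then have "{y \<in> space N. dist (f x) (f y) \<le> s/2} \<noteq> {}" by (metis measure_empty less_irrefl)
      then obtain y where "dist (f x) (f y) \<le> s/2" by auto
      then have "0 \<le> s" using zero_le_dist[of "f x" "f y"] by linarith
      then show False using neg True by auto
    qed
  qed
  then show ?thesis using F(1) bound by (auto simp: sep_def intro!: exI[of _ F])
qed

section \<open>A transversality estimate\<close>

text \<open>The set \<open>S\<close> is covered by \<open>O(\<delta> powr (- g))\<close> balls of radius \<open>\<delta>\<close>; the image of such a ball
  under the Lipschitz map \<open>q\<close> meets only \<open>O(\<delta> powr s2 / r powr s1)\<close> intervals of length \<open>r\<close>.\<close>

lemma measure_thin_cells_le:
  fixes f :: "'a \<Rightarrow> 'b::{metric_space, second_countable_topology}" and q :: "'a \<Rightarrow> real"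
  assumes "prob_space N" and f[measurable]: "f \<in> borel_measurable N"
    and q[measurable]: "q \<in> borel_measurable N"
    and lip: "\<And>x y. x \<in> space N \<Longrightarrow> y \<in> space N \<Longrightarrow> \<bar>q x - q y\<bar> \<le> L * dist (f x) (f y)"
    and S: "S \<in> sets N" and K: "K > 0" and L: "L \<ge> 0" and m: "m \<ge> 0"
    and r: "0 < r" "r \<le> \<delta>" "(L + 1) * \<delta> \<le> 1"
    and f_low: "\<And>x \<rho>. x \<in> S \<Longrightarrow> 0 < \<rho> \<Longrightarrow> \<rho> \<le> 1 \<Longrightarrow>
        \<rho> powr g \<le> K * measure N {y \<in> space N. dist (f x) (f y) \<le> \<rho>}"
    and q_low: "\<And>x \<rho>. x \<in> S \<Longrightarrow> 0 < \<rho> \<Longrightarrow> \<rho> \<le> 1 \<Longrightarrow>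
        \<rho> powr s1 \<le> K * measure N {y \<in> space N. \<bar>q x - q y\<bar> \<le> \<rho>}"
    and q_up: "\<And>x \<rho>. x \<in> S \<Longrightarrow> 0 < \<rho> \<Longrightarrow> \<rho> \<le> 1 \<Longrightarrow>
        measure N {y \<in> space N. \<bar>q x - q y\<bar> \<le> \<rho>} \<le> K * \<rho> powr s2"
    and thin: "\<And>x. x \<in> S \<Longrightarrow>
        measure N {y \<in> space N. dist (f x) (f y) \<le> 2 * \<delta> \<and> \<bar>q x - q y\<bar> \<le> r} \<le> m"
  shows "measure N S \<le> K ^ 3 * (\<delta> / 2) powr (- g) * ((L + 1) * \<delta>) powr s2 * (r / 2) powr (- s1) * m"
proof -
  interpret prob_space N by fact
  have "1 * \<delta> \<le> (L + 1) * \<delta>" using r L by (intro mult_right_mono) auto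
  then have \<delta>: "0 < \<delta>" "\<delta> \<le> 1" "0 < (L + 1) * \<delta>"
    using r by linarith+
  have Ssub: "S \<subseteq> space N" using S by (rule sets.sets_into_space)
  define n1 where "n1 = K * (\<delta> / 2) powr (- g)"
  define n2 where "n2 = K\<^sup>2 * ((L + 1) * \<delta>) powr s2 * (r / 2) powr (- s1)"
  \<comment> \<open>Balls of radius \<open>\<delta>/2\<close> around separated points are disjoint
    and have mass at least \<open>(\<delta>/2) powr g / K\<close>, which limits their number by
    \<open>n1\<close>.\<close>
  have "\<exists>F\<subseteq>S. finite F \<and> real (card F) * ((\<delta>/2) powr g / K) \<le> 1 \<and> (\<forall>x\<in>S. \<exists>y\<in>F. dist (f x) (f y) \<le> \<delta>)"
    using f_low[of _ "\<delta>/2"] \<delta> K Ssub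
    by (intro packing_net[where N = N and B = "space N"])
      (auto simp: prob_space_axioms field_simps)
  then obtain F where F: "F \<subseteq> S" "finite F" "real (card F) * ((\<delta>/2) powr g / K) \<le> 1"
      "\<And>x. x \<in> S \<Longrightarrow> \<exists>y\<in>F. dist (f x) (f y) \<le> \<delta>" by auto
  have cardF: "real (card F) \<le> n1"
    using F(3) \<delta> K by (simp add: n1_def powr_minus field_simps)
  have "\<exists>G\<subseteq>S. finite G \<and> real (card G) \<le> n2 \<and> (\<forall>y\<in>S. dist (f x) (f y) \<le> \<delta> \<longrightarrow>
     (\<exists>z\<in>G. dist (f x) (f z) \<le> \<delta> \<and> dist (q y) (q z) \<le> r))" if x: "x \<in> F" for x
  proof -
    let ?T = "{y \<in> S. dist (f x) (f y) \<le> \<delta>}"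
    have xN: "x \<in> S" "x \<in> space N" using x F Ssub by auto
    have "\<exists>G\<subseteq>?T. finite G \<and> real (card G) * ((r/2) powr s1 / K) \<le> K * ((L+1) * \<delta>) powr s2 \<and>
        (\<forall>y\<in>?T. \<exists>z\<in>G. dist (q y) (q z) \<le> r)"
    \<comment> \<open>The enclosing interval has radius \<open>(L + 1) * \<delta>\<close>: the image
      of the ball accounts for \<open>L * \<delta>\<close>, and the additional
      \<open>\<delta>\<close> makes room for the intervals of radius \<open>r / 2\<close> around its
      points.\<close>
    proof (rule packing_net[where N = N and B = "{y \<in> space N. \<bar>q x - q y\<bar> \<le> (L+1) * \<delta>}"])
      fix y assume y: "y \<in> ?T"
      then have yN: "y \<in> space N" using Ssub by auto
      have "\<bar>q x - q y\<bar> \<le> L * \<delta>"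
        using lip[OF xN(2) yN] y L by (auto intro: order_trans mult_left_mono)
      then have "\<bar>q x - q z\<bar> \<le> (L+1) * \<delta>" if "dist (q y) (q z) \<le> r / 2" for z
        using that r unfolding dist_real_def distrib_right by linarith
      then show "{z \<in> space N. dist (q y) (q z) \<le> r / 2} \<subseteq> {y \<in> space N. \<bar>q x - q y\<bar> \<le> (L+1) * \<delta>}"
        by auto
      show "(r/2) powr s1 / K \<le> measure N {z \<in> space N. dist (q y) (q z) \<le> r / 2}"
        using q_low[of y "r/2"] y r \<delta> K by (simp add: dist_real_def field_simps)
    next
      show "measure N {y \<in> space N. \<bar>q x - q y\<bar> \<le> (L+1) * \<delta>} \<le> K * ((L+1) * \<delta>) powr s2"
        using q_up[OF xN(1) \<delta>(3)] r(3) by simp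
    qed (use Ssub r K in \<open>auto simp: prob_space_axioms\<close>)
    then obtain G where G: "G \<subseteq> ?T" "finite G" "real (card G) * ((r/2) powr s1 / K) \<le> K * ((L+1) * \<delta>) powr s2"
        "\<And>y. y \<in> ?T \<Longrightarrow> \<exists>z\<in>G. dist (q y) (q z) \<le> r" by auto
    have "real (card G) \<le> n2"
      using G(3) r K by (simp add: n2_def powr_minus field_simps power2_eq_square)
    then show ?thesis using G by (intro exI[of _ G]) blast
  qed
  then obtain G where G: "\<And>x. x \<in> F \<Longrightarrow> G x \<subseteq> S" "\<And>x. x \<in> F \<Longrightarrow> finite (G x)"
      "\<And>x. x \<in> F \<Longrightarrow> real (card (G x)) \<le> n2"
      "\<And>x y. x \<in> F \<Longrightarrow> y \<in> S \<Longrightarrow> dist (f x) (f y) \<le> \<delta> \<Longrightarrow>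
        \<exists>z\<in>G x. dist (f x) (f z) \<le> \<delta> \<and> dist (q y) (q z) \<le> r"
    by metis
  define C where "C z = {y \<in> space N. dist (f z) (f y) \<le> 2 * \<delta> \<and> \<bar>q z - q y\<bar> \<le> r}" for z
  have C[measurable]: "C z \<in> sets N" for z unfolding C_def by measurable
  have "S \<subseteq> (\<Union>x\<in>F. \<Union>z\<in>G x. C z)"
  proof
    fix y assume y: "y \<in> S"
    obtain x where x: "x \<in> F" "dist (f y) (f x) \<le> \<delta>" using F(4)[OF y] by auto
    then obtain z where z: "z \<in> G x" "dist (f x) (f z) \<le> \<delta>" "dist (q y) (q z) \<le> r"
      using G(4)[OF x(1) y] by (auto simp: dist_commute)
    \<comment> \<open>Both \<open>y\<close> and the net point \<open>z\<close> are within
      \<open>\<delta>\<close> of \<open>x\<close>; this is the reason for the radius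
      \<open>2 * \<delta>\<close> of a cell.\<close>
    have "dist (f z) (f y) \<le> 2 * \<delta>"
      using dist_triangle[of "f z" "f y" "f x"] x(2) z(2) by (simp add: dist_commute)
    then have "y \<in> C z" using z y Ssub by (auto simp: C_def dist_real_def)
    with x z show "y \<in> (\<Union>x\<in>F. \<Union>z\<in>G x. C z)" by auto
  qed
  then have "measure N S \<le> measure N (\<Union>x\<in>F. \<Union>z\<in>G x. C z)"
    using F(2) G(2) by (intro finite_measure_mono sets.finite_UN) auto
  also have "\<dots> \<le> (\<Sum>x\<in>F. measure N (\<Union>z\<in>G x. C z))"
    using F(2) G(2) by (intro finite_measure_subadditive_finite) auto
  also have "\<dots> \<le> (\<Sum>x\<in>F. \<Sum>z\<in>G x. measure N (C z))"
    using G(2) by (intro sum_mono finite_measure_subadditive_finite) auto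
  also have "\<dots> \<le> (\<Sum>x\<in>F. \<Sum>z\<in>G x. m)"
    using G(1) thin by (intro sum_mono) (auto simp: C_def)
  also have "\<dots> \<le> (\<Sum>x\<in>F. n2 * m)"
    using G(3) m by (intro sum_mono) (auto intro: mult_right_mono)
  also have "\<dots> = real (card F) * (n2 * m)" by simp
  also have "\<dots> \<le> n1 * (n2 * m)"
    using cardF m by (intro mult_right_mono) (auto simp: n2_def)
  finally show ?thesis by (simp add: n1_def n2_def power2_eq_square power3_eq_cube mult_ac)
qed

text \<open>For each \<open>\<xi>\<close> in \<open>S\<close> the slope
  \<open>\<Theta> \<xi>\<close> agrees with that of the chord from \<open>(x, w)\<close> to
  \<open>(x', w')\<close> up to \<open>O(r / d)\<close>, so all these slopes lie in one ball around
  any of them, and the mass of that ball is known. The chord is not steep: bounded slopes and an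
  error \<open>O(r)\<close> keep \<open>\<bar>x' - x\<bar>\<close> comparable to \<open>d\<close>
  once \<open>d\<close> is large against \<open>r\<close>.\<close>

lemma transversal_measure_le:
  fixes q\<^sub>1 q\<^sub>2 \<Theta> :: "'p \<Rightarrow> real"
  assumes "prob_space P" and S: "S \<in> sets P" and \<Theta>[measurable]: "\<Theta> \<in> borel_measurable P"
    and q: "\<And>\<xi>. \<xi> \<in> S \<Longrightarrow> \<bar>q\<^sub>1 \<xi> - q\<^sub>2 \<xi>\<bar> \<le> r"
    and trans: "\<And>\<xi>. \<xi> \<in> space P \<Longrightarrow>
       \<bar>w' - w - \<Theta> \<xi> * (x' - x)\<bar> \<le> L * (\<bar>q\<^sub>1 \<xi> - q\<^sub>2 \<xi>\<bar> + \<bar>x' - x\<bar> powr (1 + \<alpha>))"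
    and bound: "\<And>\<xi>. \<xi> \<in> space P \<Longrightarrow> \<bar>\<Theta> \<xi>\<bar> \<le> L"
    and up: "\<And>\<xi> \<rho>. \<xi> \<in> S \<Longrightarrow> 0 < \<rho> \<Longrightarrow> \<rho> \<le> 1 \<Longrightarrow>
       measure P {\<xi>' \<in> space P. \<bar>\<Theta> \<xi> - \<Theta> \<xi>'\<bar> \<le> \<rho>} \<le> K * \<rho> powr t"
    and K: "K \<ge> 1" and L: "L > 0" and t: "t \<ge> 0" and \<alpha>: "\<alpha> > 0"
    and \<delta>: "\<delta> > 0" "r = \<delta> powr (1 + \<alpha>)"
    and d: "d = dist (x, w) (x', w')" "0 < d" "d \<le> 2 * \<delta>"
  shows "measure P S \<le> K * (4 * (1 + L) * L * (1 + 2 powr (1 + \<alpha>)) * r / d) powr t"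
proof -
  interpret prob_space P by fact
  define L2 where "L2 = L * (1 + 2 powr (1 + \<alpha>))"
  define C where "C = 4 * (1 + L) * L2"
  have L2: "L2 > 0" using L by (auto simp: L2_def intro!: mult_pos_pos add_pos_pos)
  have r: "r > 0" using \<delta> by simp
  have sub: "S \<subseteq> space P" using S by (rule sets.sets_into_space)
  have "measure P S \<le> K * (C * r / d) powr t"
  \<comment> \<open>If \<open>C * r / d > 1\<close>, the claimed bound is at least 1; the estimate
    has content only for \<open>d\<close> large against \<open>r\<close>.\<close>
  proof (cases "S = {} \<or> C * r / d > 1")
    case True
    then show ?thesis
    proof
      assume "S = {}" then show ?thesis using K by simp
    next
      assume "C * r / d > 1"
      then have "1 * 1 \<le> K * (C * r / d) powr t"
        using K t by (intro mult_mono) (auto intro: ge_one_powr_ge_zero)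
      then show ?thesis using prob_le_1[of S] by linarith
    qed
  next
    case False
    then obtain \<xi> where \<xi>: "\<xi> \<in> S" and small: "C * r / d \<le> 1" by auto
    have Cr: "C * r \<le> d" using small d(2) by (simp add: field_simps)
    define D where "D = \<bar>x' - x\<bar>"
    have dD: "d \<le> D + \<bar>w' - w\<bar>" "D \<le> d"
      using d(1) dist_fst_le[of "(x,w)" "(x',w')"]
      by (auto simp: D_def dist_Pair_Pair dist_real_def abs_minus_commute
          intro: order_trans[OF sqrt_sum_squares_le_sum_abs])
    have "D powr (1 + \<alpha>) \<le> (2 * \<delta>) powr (1 + \<alpha>)"
      using dD d(3) \<alpha> by (intro powr_mono2) (auto simp: D_def)
    also have "\<dots> = 2 powr (1 + \<alpha>) * r" using \<delta> by (simp add: powr_mult)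
    finally have *: "D powr (1 + \<alpha>) \<le> 2 powr (1 + \<alpha>) * r" .
    have lin: "\<bar>w' - w - \<Theta> \<xi> * (x' - x)\<bar> \<le> L2 * r" if "\<xi> \<in> S" for \<xi>
    proof -
      have "\<bar>w' - w - \<Theta> \<xi> * (x' - x)\<bar> \<le> L * (\<bar>q\<^sub>1 \<xi> - q\<^sub>2 \<xi>\<bar> + D powr (1 + \<alpha>))"
        using trans[of \<xi>] that sub by (auto simp: D_def)
      also have "\<dots> \<le> L * (r + 2 powr (1 + \<alpha>) * r)"
        using q[OF that] * L by (intro mult_left_mono add_mono) auto
      finally show ?thesis by (simp add: L2_def algebra_simps)
    qed
    have "\<bar>\<Theta> \<xi> * (x' - x)\<bar> \<le> L * D"
      using bound[of \<xi>] \<xi> sub by (auto simp: D_def abs_mult intro!: mult_right_mono)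
    then have "d \<le> (1 + L) * D + L2 * r" using dD(1) lin[OF \<xi>] by (simp add: algebra_simps)
    \<comment> \<open>The factor 4 in \<open>C\<close> more than covers this absorption of the error
      into \<open>d\<close>, and it is exactly what the comparison of two slopes below
      requires.\<close>
    moreover have "L2 * r \<le> d / 2"
    proof -
      have "4 * 1 * (L2 * r) \<le> 4 * (1 + L) * (L2 * r)"
        using L L2 r by (intro mult_right_mono) auto
      then show ?thesis using Cr d(2) by (simp add: C_def mult_ac)
    qed
    ultimately have Dd: "d \<le> 2 * (1 + L) * D" by (simp add: algebra_simps)
    have "\<bar>\<Theta> \<xi> - \<Theta> \<xi>'\<bar> \<le> C * r / d" if "\<xi>' \<in> S" for \<xi>'
    proof -
      have "\<bar>\<Theta> \<xi> - \<Theta> \<xi>'\<bar> * D = \<bar>\<Theta> \<xi> * (x' - x) - \<Theta> \<xi>' * (x' - x)\<bar>"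
        by (simp add: D_def abs_mult[symmetric] algebra_simps)
      also have "\<dots> \<le> 2 * (L2 * r)" using lin[OF \<xi>] lin[OF that] by linarith
      finally have 1: "\<bar>\<Theta> \<xi> - \<Theta> \<xi>'\<bar> * D \<le> 2 * (L2 * r)" .
      have "\<bar>\<Theta> \<xi> - \<Theta> \<xi>'\<bar> * d \<le> \<bar>\<Theta> \<xi> - \<Theta> \<xi>'\<bar> * (2 * (1 + L) * D)"
        using Dd by (intro mult_left_mono) auto
      also have "\<dots> = 2 * (1 + L) * (\<bar>\<Theta> \<xi> - \<Theta> \<xi>'\<bar> * D)" by simp
      also have "\<dots> \<le> 2 * (1 + L) * (2 * (L2 * r))"
        using 1 L by (intro mult_left_mono) auto
      finally show ?thesis using d(2) by (simp add: C_def field_simps)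
    qed
    then have "measure P S \<le> measure P {\<xi>' \<in> space P. \<bar>\<Theta> \<xi> - \<Theta> \<xi>'\<bar> \<le> C * r / d}"
      using sub by (intro finite_measure_mono) auto
    also have "\<dots> \<le> K * (C * r / d) powr t"
      using small L L2 r d(2) by (intro up[OF \<xi>]) (auto simp: C_def intro!: divide_pos_pos mult_pos_pos add_pos_pos)
    finally show ?thesis .
  qed
  then show ?thesis by (simp add: C_def L2_def mult_ac)
qed

text \<open>Decomposition into dyadic shells \<open>a (Suc k) < d y \<le> a k\<close>: there
  \<open>h\<close> is at most \<open>A * (1 / a (Suc k)) powr t\<close> and the mass at most
  \<open>K * a k powr s\<close>, so the shells contribute a geometric series of ratio
  \<open>2 powr (t - s) < 1\<close>. This is finiteness of the \<open>t\<close>-energy below the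
  local dimension \<open>s\<close>, localised to radius \<open>\<eta>\<close>.\<close>

lemma nn_integral_inverse_dist_le:
  fixes d :: "'a \<Rightarrow> real"
  assumes "prob_space N" and d[measurable]: "d \<in> borel_measurable N"
    and nn: "\<And>y. y \<in> space N \<Longrightarrow> 0 \<le> d y"
    and up: "\<And>\<rho>. 0 < \<rho> \<Longrightarrow> \<rho> \<le> 1 \<Longrightarrow> measure N {y \<in> space N. d y \<le> \<rho>} \<le> K * \<rho> powr s"
    and t: "0 \<le> t" "t < s" and \<eta>: "0 < \<eta>" "\<eta> \<le> 1"
    and h: "\<And>y. y \<in> space N \<Longrightarrow> 0 < d y \<Longrightarrow> d y \<le> \<eta> \<Longrightarrow> h y \<le> ennreal (A * (1 / d y) powr t)"
    and h1: "\<And>y. y \<in> space N \<Longrightarrow> d y > \<eta> \<Longrightarrow> h y = 0" and A: "A \<ge> 0" and K: "K \<ge> 0"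
  shows "(\<integral>\<^sup>+y. h y \<partial>N) \<le> ennreal (A * (K * \<eta> powr (s - t) * 2 powr t / (1 - 2 powr (t - s))))"
proof -
  interpret prob_space N by fact
  define a where "a k = \<eta> * (1/2) ^ k" for k :: nat
  have a: "0 < a k" "a k \<le> 1" for k
    using \<eta> by (auto simp: a_def intro!: mult_le_one power_le_one)
  \<comment> \<open>Nothing bounds \<open>h\<close> where \<open>d\<close> vanishes; as
    \<open>s > 0\<close>, that set is null.\<close>
  have "measure N {y \<in> space N. d y \<le> 0} = 0"
  proof -
    have "(\<lambda>k. K * (a k) powr s) \<longlonglongrightarrow> K * 0"
      using t \<eta> unfolding a_def
      by (intro tendsto_intros tendsto_zero_powrI[where b = s] tendsto_mult_right_zero LIMSEQ_realpow_zero)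
        auto
    moreover have "measure N {y \<in> space N. d y \<le> 0} \<le> K * (a k) powr s" for k
      by (rule order_trans[OF finite_measure_mono up[OF a]]) (use a(1)[of k] in auto)
    ultimately have "measure N {y \<in> space N. d y \<le> 0} \<le> K * 0" by (intro LIMSEQ_le_const) auto
    then show ?thesis using measure_nonneg[of N "{y \<in> space N. d y \<le> 0}"] by simp
  qed
  then have ae: "AE y in N. 0 < d y"
    by (subst AE_iff_measurable[of "{y \<in> space N. d y \<le> 0}"])
      (auto simp: emeasure_eq_measure not_less)
  have "(\<integral>\<^sup>+y. h y \<partial>N) \<le> (\<integral>\<^sup>+y. (\<Sum>k. ennreal (A * (1 / a (Suc k)) powr t) * indicator {y \<in> space N. d y \<le> a k} y) \<partial>N)"
  proof (rule nn_integral_mono_AE)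
    show "AE y in N. h y \<le> (\<Sum>k. ennreal (A * (1 / a (Suc k)) powr t) * indicator {y \<in> space N. d y \<le> a k} y)"
      using ae AE_space
    proof eventually_elim
      case (elim y)
      show ?case
      proof (cases "d y > \<eta>")
        case True then show ?thesis using h1[OF elim(2)] by simp
      next
        case False
        then obtain k where k: "(1/2)^Suc k < d y / \<eta>" "d y / \<eta> \<le> (1/2)^k"
          using dyadic_bracket[of "d y / \<eta>"] elim \<eta> by (auto simp: field_simps)
        then have k': "a (Suc k) < d y" "d y \<le> a k" using \<eta> by (auto simp: a_def field_simps)
        have "h y \<le> ennreal (A * (1 / d y) powr t)" using h elim False by auto
        also have "\<dots> \<le> ennreal (A * (1 / a (Suc k)) powr t)"
          using k' a t A elim by (intro ennreal_leI mult_left_mono powr_mono2) (auto intro!: divide_left_mono)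
        also have "\<dots> = (\<Sum>j\<in>{k}. ennreal (A * (1 / a (Suc j)) powr t) * indicator {y \<in> space N. d y \<le> a j} y)"
          using k' elim by simp
        also have "\<dots> \<le> (\<Sum>k. ennreal (A * (1 / a (Suc k)) powr t) * indicator {y \<in> space N. d y \<le> a k} y)"
          by (rule sum_le_suminf) auto
        finally show ?thesis .
      qed
    qed
  qed
  also have "\<dots> = (\<Sum>k. \<integral>\<^sup>+y. ennreal (A * (1 / a (Suc k)) powr t) * indicator {y \<in> space N. d y \<le> a k} y \<partial>N)"
    by (rule nn_integral_suminf) measurable
  also have "\<dots> = (\<Sum>k. ennreal (A * (1 / a (Suc k)) powr t) * emeasure N {y \<in> space N. d y \<le> a k})"
    by (subst nn_integral_cmult_indicator) auto
  also have "\<dots> \<le> (\<Sum>k. ennreal (A * (K * \<eta> powr (s - t) * 2 powr t) * (2 powr (t - s)) ^ k))"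
  proof (rule suminf_le)
    fix k
    have p: "a (Suc k) = \<eta> * 2 powr (- real k) / 2" "a k = \<eta> * 2 powr (- real k)"
      by (auto simp: a_def powr_minus powr_realpow power_one_over inverse_eq_divide)
    have "ennreal (A * (1 / a (Suc k)) powr t) * emeasure N {y \<in> space N. d y \<le> a k}
      \<le> ennreal (A * (1 / a (Suc k)) powr t) * ennreal (K * a k powr s)"
      using up[OF a] by (intro mult_left_mono) (auto simp: emeasure_eq_measure intro!: ennreal_leI)
    also have "\<dots> = ennreal (A * (1 / a (Suc k)) powr t * (K * a k powr s))"
      using A K by (intro ennreal_mult[symmetric]) auto
    also have "A * (1 / a (Suc k)) powr t * (K * a k powr s) =
       A * (K * \<eta> powr (s - t) * 2 powr t) * (2 powr (t - s)) ^ k"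
    proof -
      have "(1 / a (Suc k)) powr t = \<eta> powr (- t) * 2 powr (real k * t) * 2 powr t"
        using \<eta> by (simp add: p powr_divide powr_mult powr_powr powr_minus field_simps)
      moreover have "a k powr s = \<eta> powr s * 2 powr (- real k * s)"
        using \<eta> by (simp add: p powr_mult powr_powr)
      moreover have "(2 powr (t - s)) ^ k = 2 powr (real k * t) * 2 powr (- real k * s)"
        by (simp add: powr_realpow[symmetric] powr_powr powr_add[symmetric] algebra_simps)
      moreover have "\<eta> powr (s - t) = \<eta> powr s * \<eta> powr (- t)" by (simp add: powr_add[symmetric])
      ultimately show ?thesis by (simp only: mult_ac)
    qed
    finally show "ennreal (A * (1 / a (Suc k)) powr t) * emeasure N {y \<in> space N. d y \<le> a k}
      \<le> ennreal (A * (K * \<eta> powr (s - t) * 2 powr t) * (2 powr (t - s)) ^ k)" .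
  qed auto
  also have "\<dots> = ennreal (A * (K * \<eta> powr (s - t) * 2 powr t) * (1 / (1 - 2 powr (t - s))))"
  proof -
    have "2 powr (t - s) < (1::real)" using t by (intro powr_less_one) auto
    then have "(\<lambda>k. A * (K * \<eta> powr (s - t) * 2 powr t) * (2 powr (t - s)) ^ k) sums
       (A * (K * \<eta> powr (s - t) * 2 powr t) * (1 / (1 - 2 powr (t - s))))"
      by (intro sums_mult geometric_sums) auto
    then show ?thesis using A K by (intro suminf_ennreal_eq) auto
  qed
  finally show ?thesis by simp
qed

text \<open>Balls for the image measure are pulled back to \<open>N\<close>, where all estimates
  take place. The constant depends on \<open>x\<close>; dyadic radii keep the quantifiers
  countable.\<close>

lemma exact_dim_scales:
  fixes f :: "'a \<Rightarrow> 'b::{metric_space, second_countable_topology}"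
  assumes "prob_space N" and f[measurable]: "f \<in> borel_measurable N"
    and dim: "has_exact_dim (distr N borel f) d" and "\<epsilon> > 0"
  shows "AE x in N. \<exists>K::nat. \<forall>n.
    measure N {y \<in> space N. dist (f x) (f y) \<le> (1/2)^n} \<le> real K * ((1/2)^n) powr (d - \<epsilon>) \<and>
    ((1/2)^n) powr (d + \<epsilon>) \<le> real K * measure N {y \<in> space N. dist (f x) (f y) \<le> (1/2)^n}"
proof -
  interpret prob_space N by fact
  interpret D: prob_space "distr N borel f" by (rule prob_space_distr) (rule f)
  define m where "m x r = measure N {y \<in> space N. dist (f x) (f y) \<le> r}" for x r
  have m: "measure (distr N borel f) (cball (f x) r) = m x r" for x r
    unfolding m_def by (subst measure_distr) (auto simp: vimage_def Int_def intro!: arg_cong[where f = "measure N"])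
  have "AE x in N. ((\<lambda>r. ln (measure (distr N borel f) (cball (f x) r)) / ln r) \<longlongrightarrow> d) (at_right 0)"
    using dim unfolding has_exact_dim_def by (intro AE_distrD[OF f]) simp
  moreover have "AE x in N. \<forall>r>0. 0 < measure (distr N borel f) (cball (f x) r)"
    by (rule AE_distrD[OF f], rule AE_cball_pos) (auto simp: D.prob_space_axioms)
  ultimately show ?thesis
    unfolding m unfolding m_def[symmetric]
  proof eventually_elim
    case (elim x)
    have "\<forall>\<^sub>F r in at_right 0. m x r \<le> r powr (d - \<epsilon>) \<and> (m x r > 0 \<longrightarrow> r powr (d + \<epsilon>) \<le> m x r)"
      using elim(1) \<open>\<epsilon> > 0\<close> by (rule ln_ratio_bounds) (simp add: m_def)
    then have ev: "\<forall>\<^sub>F n in sequentially. m x ((1/2)^n) \<le> ((1/2)^n) powr (d - \<epsilon>) \<and>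
        (m x ((1/2)^n) > 0 \<longrightarrow> ((1/2)^n) powr (d + \<epsilon>) \<le> m x ((1/2)^n))"
      using dyadic_at_right by (auto simp: filterlim_iff)
    have "\<exists>K::nat. \<forall>n. m x ((1/2)^n) \<le> real K * ((1/2)^n) powr (d - \<epsilon>)"
      using ev by (intro eventually_bounded_ratio) (auto elim: eventually_mono)
    then obtain K1 :: nat where K1: "\<And>n. m x ((1/2)^n) \<le> real K1 * ((1/2)^n) powr (d - \<epsilon>)" by blast
    have "\<exists>K::nat. \<forall>n. ((1/2)^n) powr (d + \<epsilon>) \<le> real K * m x ((1/2)^n)"
      using ev elim(2) by (intro eventually_bounded_ratio) (auto elim: eventually_mono)
    then obtain K2 :: nat where K2: "\<And>n. ((1/2)^n) powr (d + \<epsilon>) \<le> real K2 * m x ((1/2)^n)" by blast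
    show ?case
    proof (intro exI[of _ "K1 + K2"] allI conjI)
      fix n
      show "m x ((1/2)^n) \<le> real (K1 + K2) * ((1/2)^n) powr (d - \<epsilon>)"
        using K1[of n] by (rule order_trans) (auto intro!: mult_right_mono)
      show "((1/2)^n) powr (d + \<epsilon>) \<le> real (K1 + K2) * m x ((1/2)^n)"
        using K2[of n] by (rule order_trans) (auto intro!: mult_right_mono simp: m_def)
    qed
  qed
qed

text \<open>\<open>P\<close> is the law of the parameter \<open>\<xi>\<close> and \<open>N\<close>
  that of the base point. The assumption \<open>trans\<close> encodes the geometry of the fibres:
  the one through \<open>(x, W x)\<close> has slope \<open>\<Theta> \<xi> x\<close> there with an
  error of order \<open>1 + \<alpha>\<close>, and the height of \<open>(x', W x')\<close> above it
  is controlled by the distance of the two projections.\<close>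

locale transversal_family = P: prob_space P + N: prob_space N
  for P :: "'p measure" and N :: "real measure" +
  fixes W :: "real \<Rightarrow> real" and q \<Theta> :: "'p \<Rightarrow> real \<Rightarrow> real" and L \<alpha> :: real
  assumes ident[measurable]: "(\<lambda>x. x) \<in> borel_measurable N"
    and W[measurable]: "W \<in> borel_measurable N"
    and q[measurable]: "(\<lambda>z. q (fst z) (snd z)) \<in> borel_measurable (P \<Otimes>\<^sub>M N)"
    and \<Theta>[measurable]: "(\<lambda>z. \<Theta> (fst z) (snd z)) \<in> borel_measurable (P \<Otimes>\<^sub>M N)"
    and L: "L \<ge> 1" and \<alpha>: "\<alpha> > 0"
    and lip: "\<And>\<xi> x x'. \<xi> \<in> space P \<Longrightarrow> x \<in> space N \<Longrightarrow> x' \<in> space N \<Longrightarrow>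
        \<bar>q \<xi> x - q \<xi> x'\<bar> \<le> L * dist (x, W x) (x', W x')"
    and trans: "\<And>\<xi> x x'. \<xi> \<in> space P \<Longrightarrow> x \<in> space N \<Longrightarrow> x' \<in> space N \<Longrightarrow>
        \<bar>W x' - W x - \<Theta> \<xi> x * (x' - x)\<bar> \<le> L * (\<bar>q \<xi> x - q \<xi> x'\<bar> + \<bar>x' - x\<bar> powr (1 + \<alpha>))"
    and bound: "\<And>\<xi> x. \<xi> \<in> space P \<Longrightarrow> x \<in> space N \<Longrightarrow> \<bar>\<Theta> \<xi> x\<bar> \<le> L"
begin

sublocale PN: pair_prob_space P N ..

definition e :: "real \<Rightarrow> real \<times> real" where "e x = (x, W x)"

lemma e[measurable]: "e \<in> borel_measurable N"
  unfolding e_def[abs_def] by measurable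

lemma q_section: "\<xi> \<in> space P \<Longrightarrow> q \<xi> \<in> borel_measurable N"
  using measurable_Pair2[OF q, of \<xi>] by simp

lemma \<Theta>_section: "x \<in> space N \<Longrightarrow> (\<lambda>\<xi>. \<Theta> \<xi> x) \<in> borel_measurable P"
  using measurable_Pair1[OF \<Theta>, of x] by simp

definition mE where "mE x \<rho> = measure N {y \<in> space N. dist (e x) (e y) \<le> \<rho>}"
definition mQ where "mQ \<xi> x \<rho> = measure N {y \<in> space N. \<bar>q \<xi> x - q \<xi> y\<bar> \<le> \<rho>}"
definition mT where "mT \<xi> x \<rho> = measure P {\<xi>' \<in> space P. \<bar>\<Theta> \<xi> x - \<Theta> \<xi>' x\<bar> \<le> \<rho>}"

lemma q_fst[measurable]: "(\<lambda>z. q (fst (fst z)) (snd (fst z))) \<in> borel_measurable ((P \<Otimes>\<^sub>M N) \<Otimes>\<^sub>M N)"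
  using measurable_compose[OF measurable_fst q] by simp

lemma q_snd[measurable]: "(\<lambda>z. q (fst (fst z)) (snd z)) \<in> borel_measurable ((P \<Otimes>\<^sub>M N) \<Otimes>\<^sub>M N)"
proof -
  have "(\<lambda>z. (fst (fst z), snd z)) \<in> (P \<Otimes>\<^sub>M N) \<Otimes>\<^sub>M N \<rightarrow>\<^sub>M P \<Otimes>\<^sub>M N" by measurable
  from measurable_compose[OF this q] show ?thesis by simp
qed

lemma mE_measurable[measurable]: "(\<lambda>z. mE (snd z) \<rho>) \<in> borel_measurable (P \<Otimes>\<^sub>M N)"
  unfolding mE_def measure_def by measurable

lemma mQ_measurable[measurable]: "(\<lambda>z. mQ (fst z) (snd z) \<rho>) \<in> borel_measurable (P \<Otimes>\<^sub>M N)"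
  unfolding mQ_def measure_def by measurable

lemma mT_measurable[measurable]: "(\<lambda>z. mT (fst z) (snd z) \<rho>) \<in> borel_measurable (P \<Otimes>\<^sub>M N)"
proof -
  have 1: "(\<lambda>z. \<Theta> (fst (fst z)) (snd (fst z))) \<in> borel_measurable ((P \<Otimes>\<^sub>M N) \<Otimes>\<^sub>M P)"
    using measurable_compose[OF measurable_fst \<Theta>] by simp
  have "(\<lambda>z. (snd z, snd (fst z))) \<in> (P \<Otimes>\<^sub>M N) \<Otimes>\<^sub>M P \<rightarrow>\<^sub>M P \<Otimes>\<^sub>M N" by measurable
  from measurable_compose[OF this \<Theta>]
  have 2: "(\<lambda>z. \<Theta> (snd z) (snd (fst z))) \<in> borel_measurable ((P \<Otimes>\<^sub>M N) \<Otimes>\<^sub>M P)" by simp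
  note [measurable] = 1 2
  show ?thesis unfolding mT_def measure_def by measurable
qed

text \<open>Pairs in \<open>H\<close> are split by the mass of their cell. Light cells, of mass at
  most \<open>m\<close>, are counted for each fixed \<open>\<xi>\<close>; heavy ones are handled by
  Markov's inequality and the average of the cell mass over \<open>\<xi>\<close> for fixed
  \<open>x\<close>. The first bound grows with \<open>m\<close> and the second decreases, and
  \<open>m\<close> stays free for the final choice.\<close>

lemma measure_good_le:
  assumes H[measurable]: "H \<in> sets (P \<Otimes>\<^sub>M N)" and K: "K \<ge> 1"
    and E_up: "\<And>\<xi> x \<rho>. (\<xi>, x) \<in> H \<Longrightarrow> 0 < \<rho> \<Longrightarrow> \<rho> \<le> 1 \<Longrightarrow> mE x \<rho> \<le> K * \<rho> powr g1"
    and E_low: "\<And>\<xi> x \<rho>. (\<xi>, x) \<in> H \<Longrightarrow> 0 < \<rho> \<Longrightarrow> \<rho> \<le> 1 \<Longrightarrow> \<rho> powr g2 \<le> K * mE x \<rho>"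
    and Q_up: "\<And>\<xi> x \<rho>. (\<xi>, x) \<in> H \<Longrightarrow> 0 < \<rho> \<Longrightarrow> \<rho> \<le> 1 \<Longrightarrow> mQ \<xi> x \<rho> \<le> K * \<rho> powr s1"
    and Q_low: "\<And>\<xi> x \<rho>. (\<xi>, x) \<in> H \<Longrightarrow> 0 < \<rho> \<Longrightarrow> \<rho> \<le> 1 \<Longrightarrow> \<rho> powr s2 \<le> K * mQ \<xi> x \<rho>"
    and T_up: "\<And>\<xi> x \<rho>. (\<xi>, x) \<in> H \<Longrightarrow> 0 < \<rho> \<Longrightarrow> \<rho> \<le> 1 \<Longrightarrow> mT \<xi> x \<rho> \<le> K * \<rho> powr t"
    and t: "0 \<le> t" "t < g1"
  shows "\<exists>C. \<forall>\<delta> m. 0 < \<delta> \<longrightarrow> (L + 1) * \<delta> \<le> 1 \<longrightarrow> 0 < m \<longrightarrow>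
     measure (P \<Otimes>\<^sub>M N) H \<le> C * (\<delta> powr (s1 - g2 - (1 + \<alpha>) * s2) * m) +
       C * (\<delta> powr ((1 + \<alpha>) * t + g1 - t) / m)"
proof -
  define C1 where "C1 = K ^ 3 * (1/2) powr (- g2) * (L + 1) powr s1 * (1/2) powr (- s2)"
  define B where "B = 4 * (1 + L) * L * (1 + 2 powr (1 + \<alpha>))"
  define C2 where "C2 = K * B powr t * (K * 2 powr (g1 - t) * 2 powr t / (1 - 2 powr (t - g1)))"
  have B: "B \<ge> 0" using L by (auto simp: B_def)
  have "2 powr (t - g1) < (1::real)" using t by (intro powr_less_one) auto
  then have C: "C1 \<ge> 0" "C2 \<ge> 0" using K L t by (auto simp: C1_def C2_def intro!: divide_nonneg_pos)
  have main: "measure (P \<Otimes>\<^sub>M N) H \<le> C1 * (\<delta> powr (s1 - g2 - (1 + \<alpha>) * s2) * m) +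
       C2 * (\<delta> powr ((1 + \<alpha>) * t + g1 - t) / m)"
    if \<delta>: "0 < \<delta>" "(L + 1) * \<delta> \<le> 1" and m: "0 < m" for \<delta> m
  proof -
    define r where "r = \<delta> powr (1 + \<alpha>)"
    \<comment> \<open>\<open>L \<ge> 1\<close> brings the cell radius \<open>2 * \<delta>\<close>
      into the range of the mass bounds.\<close>
    have "2 * \<delta> \<le> (L + 1) * \<delta>" using L \<delta> by (intro mult_right_mono) auto
    then have \<delta>1: "2 * \<delta> \<le> 1" using \<delta> by linarith
    have r: "0 < r" using \<delta> by (simp add: r_def)
    have "r \<le> \<delta> powr 1" unfolding r_def using \<delta> \<delta>1 \<alpha> by (intro powr_mono') auto
    then have r\<delta>: "r \<le> \<delta>" using \<delta> by simp
    define cell where "cell z = {y \<in> space N. dist (e (snd z)) (e y) \<le> 2 * \<delta> \<and>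
        \<bar>q (fst z) (snd z) - q (fst z) y\<bar> \<le> r}" for z
    have cell_m[measurable]: "(\<lambda>z. emeasure N (cell z)) \<in> borel_measurable (P \<Otimes>\<^sub>M N)"
      unfolding cell_def by measurable
    have [measurable]: "(\<lambda>z. measure N (cell z)) \<in> borel_measurable (P \<Otimes>\<^sub>M N)"
      unfolding measure_def by measurable
    define H1 where "H1 = {z \<in> space (P \<Otimes>\<^sub>M N). z \<in> H \<and> measure N (cell z) \<le> m}"
    define H2 where "H2 = {z \<in> space (P \<Otimes>\<^sub>M N). z \<in> H \<and> m < measure N (cell z)}"
    have H12[measurable]: "H1 \<in> sets (P \<Otimes>\<^sub>M N)" "H2 \<in> sets (P \<Otimes>\<^sub>M N)"
      unfolding H1_def H2_def by measurable
    have "H \<subseteq> space (P \<Otimes>\<^sub>M N)" by (rule sets.sets_into_space[OF H])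
    then have "H = H1 \<union> H2" by (auto simp: H1_def H2_def not_le)
    then have "measure (P \<Otimes>\<^sub>M N) H \<le> measure (P \<Otimes>\<^sub>M N) H1 + measure (P \<Otimes>\<^sub>M N) H2"
      using measure_Un_le[OF H12] by simp
    moreover have "measure (P \<Otimes>\<^sub>M N) H1 \<le> C1 * (\<delta> powr (s1 - g2 - (1 + \<alpha>) * s2) * m)" (is "_ \<le> ?R1")
    proof -
      have sec: "emeasure N (Pair \<xi> -` H1) \<le> ennreal ?R1" if \<xi>: "\<xi> \<in> space P" for \<xi>
      proof -
        have [measurable]: "q \<xi> \<in> borel_measurable N" using \<xi> by (rule q_section)
        have "measure N (Pair \<xi> -` H1) \<le> K ^ 3 * (\<delta> / 2) powr (- g2) * ((L + 1) * \<delta>) powr s1 * (r / 2) powr (- s2) * m"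
          using E_low[of \<xi>] Q_low[of \<xi>] Q_up[of \<xi>] sets_Pair1[OF H12(1), of \<xi>] K L m \<delta> r r\<delta> lip[OF \<xi>]
          by (intro measure_thin_cells_le[where f = e and q = "q \<xi>" and L = L and N = N])
            (auto simp: mE_def mQ_def H1_def e_def[symmetric] cell_def N.prob_space_axioms)
        also have "\<dots> = ?R1"
        proof -
          have "(\<delta> / 2) powr (- g2) = \<delta> powr (- g2) * (1/2) powr (- g2)"
            using \<delta> by (subst powr_mult[symmetric]) auto
          moreover have "((L + 1) * \<delta>) powr s1 = (L + 1) powr s1 * \<delta> powr s1"
            using \<delta> L by (simp add: powr_mult)
          moreover have "(r / 2) powr (- s2) = \<delta> powr (- (1 + \<alpha>) * s2) * (1/2) powr (- s2)"
          proof -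
            have "(r / 2) powr (- s2) = r powr (- s2) * (1/2) powr (- s2)"
              using r by (subst powr_mult[symmetric]) auto
            moreover have "r powr (- s2) = \<delta> powr (- (1 + \<alpha>) * s2)"
              unfolding r_def powr_powr by (simp add: algebra_simps)
            ultimately show ?thesis by simp
          qed
          moreover have "\<delta> powr (s1 - g2 - (1 + \<alpha>) * s2) = \<delta> powr s1 * \<delta> powr (- g2) * \<delta> powr (- (1 + \<alpha>) * s2)"
            by (simp add: powr_add[symmetric] algebra_simps)
          ultimately show ?thesis by (simp only: C1_def mult_ac)
        qed
        finally show ?thesis by (simp add: N.emeasure_eq_measure ennreal_leI)
      qed
      have "emeasure (P \<Otimes>\<^sub>M N) H1 = (\<integral>\<^sup>+\<xi>. emeasure N (Pair \<xi> -` H1) \<partial>P)"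
        by (rule N.emeasure_pair_measure_alt) (rule H12)
      also have "\<dots> \<le> (\<integral>\<^sup>+\<xi>. ennreal ?R1 \<partial>P)" using sec by (intro nn_integral_mono)
      also have "\<dots> = ennreal ?R1" by (simp add: P.emeasure_space_1)
      finally show ?thesis using C m by (simp add: PN.emeasure_eq_measure)
    qed
    moreover have "measure (P \<Otimes>\<^sub>M N) H2 \<le> C2 * (\<delta> powr ((1 + \<alpha>) * t + g1 - t) / m)"
    proof -
      define R where "R = C2 * \<delta> powr ((1 + \<alpha>) * t + g1 - t)"
      have R: "R \<ge> 0" using C by (simp add: R_def)
      have inner: "(\<integral>\<^sup>+\<xi>. indicator H (\<xi>, x) * emeasure N (cell (\<xi>, x)) \<partial>P) \<le> ennreal R"
        if x: "x \<in> space N" for x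
      proof (cases "\<exists>\<xi>. (\<xi>, x) \<in> H")
        case False
        then show ?thesis by simp
      next
        case True
        \<comment> \<open>The bound on \<open>mE\<close> does not involve \<open>\<xi>\<close>, so
          any \<open>\<xi>0\<close> with \<open>(\<xi>0, x)\<close> in \<open>H\<close> supplies
          it.\<close>
        then obtain \<xi>0 where \<xi>0: "(\<xi>0, x) \<in> H" by blast
        \<comment> \<open>Exchanging the integrals over \<open>Z\<close> turns the average mass of
          the cell of \<open>x\<close> into an integral over \<open>y\<close> of the probability
          that \<open>x\<close> and \<open>y\<close> share a cell. The latter is bounded by
          transversality, and what remains is an inverse power of the distance.\<close>
        define Z where "Z = {(\<xi>, y) \<in> space (P \<Otimes>\<^sub>M N). (\<xi>, x) \<in> H \<and> dist (e x) (e y) \<le> 2 * \<delta> \<and> \<bar>q \<xi> x - q \<xi> y\<bar> \<le> r}"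
        have qx: "(\<lambda>\<xi>. q \<xi> x) \<in> borel_measurable P"
          using measurable_Pair1[OF q x] by simp
        have qx'[measurable]: "(\<lambda>z. q (fst z) x) \<in> borel_measurable (P \<Otimes>\<^sub>M N)"
          using measurable_compose[OF measurable_fst qx] .
        have Hx[measurable]: "(\<lambda>\<xi>. (\<xi>, x)) -` H \<in> sets P" by (rule sets_Pair2[OF H])
        have Hx'[measurable]: "Measurable.pred (P \<Otimes>\<^sub>M N) (\<lambda>z. fst z \<in> (\<lambda>\<xi>. (\<xi>, x)) -` H)" by measurable
        have Z[measurable]: "Z \<in> sets (P \<Otimes>\<^sub>M N)"
          unfolding Z_def using Hx' by (simp add: case_prod_beta')
        have "(\<integral>\<^sup>+\<xi>. indicator H (\<xi>, x) * emeasure N (cell (\<xi>, x)) \<partial>P) = (\<integral>\<^sup>+\<xi>. (\<integral>\<^sup>+y. indicator Z (\<xi>, y) \<partial>N) \<partial>P)"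
        proof (rule nn_integral_cong)
          fix \<xi> assume \<xi>: "\<xi> \<in> space P"
          have [measurable]: "q \<xi> \<in> borel_measurable N" using \<xi> by (rule q_section)
          have "cell (\<xi>, x) \<in> sets N" unfolding cell_def by simp
          then have "indicator H (\<xi>, x) * emeasure N (cell (\<xi>, x)) = (\<integral>\<^sup>+y. indicator H (\<xi>, x) * indicator (cell (\<xi>, x)) y \<partial>N)"
            by (simp add: nn_integral_cmult_indicator)
          also have "\<dots> = (\<integral>\<^sup>+y. indicator Z (\<xi>, y) \<partial>N)"
            using \<xi> by (intro nn_integral_cong) (auto simp: Z_def cell_def space_pair_measure split: split_indicator)
          finally show "indicator H (\<xi>, x) * emeasure N (cell (\<xi>, x)) = (\<integral>\<^sup>+y. indicator Z (\<xi>, y) \<partial>N)" .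
        qed
        also have "\<dots> = (\<integral>\<^sup>+y. (\<integral>\<^sup>+\<xi>. indicator Z (\<xi>, y) \<partial>P) \<partial>N)"
          by (rule PN.Fubini[symmetric]) measurable
        also have "\<dots> \<le> ennreal (K * (B * r) powr t * (K * (2 * \<delta>) powr (g1 - t) * 2 powr t / (1 - 2 powr (t - g1))))"
        proof (rule nn_integral_inverse_dist_le[where d = "\<lambda>y. dist (e x) (e y)" and \<eta> = "2 * \<delta>"])
          fix y assume y: "y \<in> space N" "0 < dist (e x) (e y)" "dist (e x) (e y) \<le> 2 * \<delta>"
          let ?S = "(\<lambda>\<xi>. (\<xi>, y)) -` Z"
          have S: "?S \<in> sets P" by (rule sets_Pair2[OF Z])
          have "measure P ?S \<le> K * (4 * (1 + L) * L * (1 + 2 powr (1 + \<alpha>)) * r / dist (e x) (e y)) powr t"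
            using T_up[of _ x] trans[of _ x y] bound[of _ x] x y K L t \<alpha> \<delta> S \<Theta>_section[OF x]
            by (intro transversal_measure_le[where \<delta> = \<delta> and \<Theta> = "\<lambda>\<xi>. \<Theta> \<xi> x" and q\<^sub>1 = "\<lambda>\<xi>. q \<xi> x" and q\<^sub>2 = "\<lambda>\<xi>. q \<xi> y"])
              (auto simp: Z_def r_def e_def mT_def P.prob_space_axioms)
          also have "\<dots> = K * (B * r) powr t * (1 / dist (e x) (e y)) powr t"
            using B r by (subst mult.assoc, subst powr_mult[symmetric]) (auto simp: B_def)
          finally show "(\<integral>\<^sup>+\<xi>. indicator Z (\<xi>, y) \<partial>P) \<le> ennreal (K * (B * r) powr t * (1 / dist (e x) (e y)) powr t)"
            using nn_integral_indicator[OF S] by (simp add: P.emeasure_eq_measure ennreal_leI indicator_vimage o_def)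
        next
          fix y assume y: "y \<in> space N" "dist (e x) (e y) > 2 * \<delta>"
          then show "(\<integral>\<^sup>+\<xi>. indicator Z (\<xi>, y) \<partial>P) = 0" by (simp add: Z_def)
        qed (use E_up[OF \<xi>0] t \<delta> \<delta>1 K in \<open>auto simp: mE_def N.prob_space_axioms\<close>)
        also have "K * (B * r) powr t * (K * (2 * \<delta>) powr (g1 - t) * 2 powr t / (1 - 2 powr (t - g1))) = R"
        proof -
          have "(B * r) powr t = B powr t * \<delta> powr ((1 + \<alpha>) * t)"
            using B \<delta> by (simp add: r_def powr_mult powr_powr)
          moreover have "(2 * \<delta>) powr (g1 - t) = 2 powr (g1 - t) * \<delta> powr (g1 - t)"
            using \<delta> by (simp add: powr_mult)
          moreover have "\<delta> powr ((1 + \<alpha>) * t + g1 - t) = \<delta> powr ((1 + \<alpha>) * t) * \<delta> powr (g1 - t)"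
            by (simp add: powr_add[symmetric] algebra_simps)
          ultimately show ?thesis by (simp only: R_def C2_def times_divide_eq_right times_divide_eq_left mult_ac)
        qed
        finally show ?thesis .
      qed
      \<comment> \<open>Markov's inequality for the cell mass.\<close>
      have "ennreal m * emeasure (P \<Otimes>\<^sub>M N) H2 = (\<integral>\<^sup>+z. ennreal m * indicator H2 z \<partial>(P \<Otimes>\<^sub>M N))"
        by (simp add: nn_integral_cmult_indicator)
      also have "\<dots> \<le> (\<integral>\<^sup>+z. indicator H z * emeasure N (cell z) \<partial>(P \<Otimes>\<^sub>M N))"
        by (intro nn_integral_mono) (auto simp: H2_def N.emeasure_eq_measure intro!: ennreal_leI split: split_indicator)
      also have "\<dots> = (\<integral>\<^sup>+x. (\<integral>\<^sup>+\<xi>. indicator H (\<xi>, x) * emeasure N (cell (\<xi>, x)) \<partial>P) \<partial>N)"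
        by (rule PN.nn_integral_snd[symmetric]) measurable
      also have "\<dots> \<le> (\<integral>\<^sup>+x. ennreal R \<partial>N)" using inner by (intro nn_integral_mono)
      also have "\<dots> = ennreal R" by (simp add: N.emeasure_space_1)
      finally have "m * measure (P \<Otimes>\<^sub>M N) H2 \<le> R"
        using R m by (simp add: PN.emeasure_eq_measure ennreal_mult[symmetric])
      then show ?thesis using m by (simp add: R_def field_simps)
    qed
    ultimately show ?thesis by linarith
  qed
  have "measure (P \<Otimes>\<^sub>M N) H \<le> (C1 + C2) * (\<delta> powr (s1 - g2 - (1 + \<alpha>) * s2) * m) +
       (C1 + C2) * (\<delta> powr ((1 + \<alpha>) * t + g1 - t) / m)"
    if "0 < \<delta>" "(L + 1) * \<delta> \<le> 1" "0 < m" for \<delta> m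
    using that C by (intro order_trans[OF main[OF that]] add_mono mult_right_mono) auto
  then show ?thesis by blast
qed

end

text \<open>At radii below 1 both logarithms are at most 0.\<close>

lemma has_exact_dim_nonneg:
  assumes "prob_space \<kappa>" "has_exact_dim \<kappa> d"
  shows "0 \<le> d"
proof -
  interpret prob_space \<kappa> by fact
  have "AE x in \<kappa>. 0 \<le> d"
    using assms(2) unfolding has_exact_dim_def
  proof eventually_elim
    case (elim x)
    have "\<forall>\<^sub>F r in at_right (0::real). 0 < r \<and> r < 1"
      by (auto simp: eventually_at_right_field intro!: exI[of _ 1])
    then have "\<forall>\<^sub>F r in at_right 0. 0 \<le> ln (prob (cball x r \<inter> space \<kappa>)) / ln r"
    proof eventually_elim
      case (elim r)
      have "ln (prob (cball x r \<inter> space \<kappa>)) \<le> 0"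
        using prob_le_1[of "cball x r \<inter> space \<kappa>"] measure_nonneg[of \<kappa> "cball x r \<inter> space \<kappa>"]
        by (cases "prob (cball x r \<inter> space \<kappa>) = 0") (auto simp: less_le)
      then show ?case using elim by (auto intro!: divide_nonpos_neg)
    qed
    with elim show ?case by (intro tendsto_lowerbound) auto
  qed
  then show ?thesis by simp
qed

context transversal_family
begin

text \<open>Dyadic radii make this a countable conjunction, hence a measurable set. For the slopes
  only an upper bound is recorded, because only their concentration is harmful.\<close>

definition good :: "real \<Rightarrow> real \<Rightarrow> real \<Rightarrow> real \<Rightarrow> real \<Rightarrow> nat \<Rightarrow> ('p \<times> real) set" where
  "good g1 g2 s1 s2 t K = {z \<in> space (P \<Otimes>\<^sub>M N). \<forall>n.
     mE (snd z) ((1/2)^n) \<le> K * ((1/2)^n) powr g1 \<and> ((1/2)^n) powr g2 \<le> K * mE (snd z) ((1/2)^n) \<and>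
     mQ (fst z) (snd z) ((1/2)^n) \<le> K * ((1/2)^n) powr s1 \<and>
     ((1/2)^n) powr s2 \<le> K * mQ (fst z) (snd z) ((1/2)^n) \<and>
     mT (fst z) (snd z) ((1/2)^n) \<le> K * ((1/2)^n) powr t}"

lemma good_sets[measurable]: "good g1 g2 s1 s2 t K \<in> sets (P \<Otimes>\<^sub>M N)"
  unfolding good_def by measurable

text \<open>The sets increase with \<open>K\<close> and almost every pair lies in one of them, so
  their measures tend to 1. The bound 1/2 stands for any positive number.\<close>

lemma good_large:
  assumes dimE: "has_exact_dim (distr N borel e) g"
    and dimQ: "AE \<xi> in P. has_exact_dim (distr N borel (q \<xi>)) d"
    and dimT: "AE x in N. has_exact_dim (distr P borel (\<lambda>\<xi>. \<Theta> \<xi> x)) 1"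
    and "\<epsilon> > 0" "t < 1"
  shows "\<exists>K::nat. 1/2 \<le> measure (P \<Otimes>\<^sub>M N) (good (g - \<epsilon>) (g + \<epsilon>) (d - \<epsilon>) (d + \<epsilon>) t K)"
proof -
  let ?H = "good (g - \<epsilon>) (g + \<epsilon>) (d - \<epsilon>) (d + \<epsilon>) t"
  have aeE: "AE z in P \<Otimes>\<^sub>M N. \<exists>K::nat. \<forall>n. mE (snd z) ((1/2)^n) \<le> K * ((1/2)^n) powr (g - \<epsilon>) \<and>
      ((1/2)^n) powr (g + \<epsilon>) \<le> K * mE (snd z) ((1/2)^n)"
  proof (rule PN.AE_pair_measure)
    show "AE \<xi> in P. AE x in N. \<exists>K::nat. \<forall>n. mE (snd (\<xi>, x)) ((1/2)^n) \<le> K * ((1/2)^n) powr (g - \<epsilon>) \<and>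
      ((1/2)^n) powr (g + \<epsilon>) \<le> K * mE (snd (\<xi>, x)) ((1/2)^n)"
      using exact_dim_scales[OF N.prob_space_axioms e dimE \<open>\<epsilon> > 0\<close>] by (simp add: mE_def)
  qed measurable
  have aeQ: "AE z in P \<Otimes>\<^sub>M N. \<exists>K::nat. \<forall>n. mQ (fst z) (snd z) ((1/2)^n) \<le> K * ((1/2)^n) powr (d - \<epsilon>) \<and>
      ((1/2)^n) powr (d + \<epsilon>) \<le> K * mQ (fst z) (snd z) ((1/2)^n)"
  proof (rule PN.AE_pair_measure)
    show "AE \<xi> in P. AE x in N. \<exists>K::nat. \<forall>n. mQ (fst (\<xi>, x)) (snd (\<xi>, x)) ((1/2)^n) \<le> K * ((1/2)^n) powr (d - \<epsilon>) \<and>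
      ((1/2)^n) powr (d + \<epsilon>) \<le> K * mQ (fst (\<xi>, x)) (snd (\<xi>, x)) ((1/2)^n)"
      using dimQ AE_space
    proof eventually_elim
      case (elim \<xi>)
      show ?case
        using exact_dim_scales[OF N.prob_space_axioms q_section[OF elim(2)] elim(1) \<open>\<epsilon> > 0\<close>]
        by (simp add: mQ_def dist_real_def)
    qed
  qed measurable
  have "AE \<xi> in P. AE x in N. \<exists>K::nat. \<forall>n. mT \<xi> x ((1/2)^n) \<le> K * ((1/2)^n) powr t"
  \<comment> \<open>The slope hypothesis speaks of almost every \<open>x\<close> first; joint
    measurability permits exchanging the quantifiers.\<close>
  proof (subst PN.AE_commute)
    show "{z \<in> space (P \<Otimes>\<^sub>M N). \<exists>K::nat. \<forall>n. mT (fst z) (snd z) ((1/2)^n) \<le> K * ((1/2)^n) powr t} \<in> sets (P \<Otimes>\<^sub>M N)"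
      by measurable
    show "AE x in N. AE \<xi> in P. \<exists>K::nat. \<forall>n. mT \<xi> x ((1/2)^n) \<le> K * ((1/2)^n) powr t"
      using dimT AE_space
    proof eventually_elim
      case (elim x)
      \<comment> \<open>Dimension 1 with the loss \<open>1 - t\<close> gives the exponent
        \<open>t\<close>.\<close>
      have "AE \<xi> in P. \<exists>K::nat. \<forall>n. mT \<xi> x ((1/2)^n) \<le> K * ((1/2)^n) powr (1 - (1 - t)) \<and>
          ((1/2)^n) powr (1 + (1 - t)) \<le> K * mT \<xi> x ((1/2)^n)"
        using exact_dim_scales[OF P.prob_space_axioms \<Theta>_section[OF elim(2)] elim(1), of "1 - t"] \<open>t < 1\<close>
        by (simp add: mT_def dist_real_def)
      then show ?case by eventually_elim auto
    qed
  qed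
  then have aeT: "AE z in P \<Otimes>\<^sub>M N. \<exists>K::nat. \<forall>n. mT (fst z) (snd z) ((1/2)^n) \<le> K * ((1/2)^n) powr t"
    by (intro PN.AE_pair_measure) auto
  have mono: "z \<in> ?H K \<Longrightarrow> K \<le> K' \<Longrightarrow> z \<in> ?H K'" for z K K'
    unfolding good_def
    by (auto simp: mE_def mQ_def intro: order_trans mult_right_mono)
      (meson measure_nonneg mult_right_mono of_nat_le_iff order_trans powr_ge_zero)+
  have "AE z in P \<Otimes>\<^sub>M N. z \<in> (\<Union>K. ?H K)"
    using aeE aeQ aeT AE_space
  proof eventually_elim
    case (elim z)
    then obtain K1 K2 K3 :: nat where
      "\<forall>n. mE (snd z) ((1/2)^n) \<le> K1 * ((1/2)^n) powr (g - \<epsilon>) \<and> ((1/2)^n) powr (g + \<epsilon>) \<le> K1 * mE (snd z) ((1/2)^n)"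
      "\<forall>n. mQ (fst z) (snd z) ((1/2)^n) \<le> K2 * ((1/2)^n) powr (d - \<epsilon>) \<and>
      ((1/2)^n) powr (d + \<epsilon>) \<le> K2 * mQ (fst z) (snd z) ((1/2)^n)"
      "\<forall>n. mT (fst z) (snd z) ((1/2)^n) \<le> K3 * ((1/2)^n) powr t"
      by blast
    note K = this
    have up: "a \<le> real (K1 + K2 + K3) * b" if "a \<le> real K1 * b \<or> a \<le> real K2 * b \<or> a \<le> real K3 * b" "0 \<le> b" for a b
      using that by (auto simp: algebra_simps intro: order_trans add_increasing add_increasing2)
    have "z \<in> ?H (K1 + K2 + K3)"
      unfolding good_def using K elim(4)
      by (auto intro!: up simp del: of_nat_add simp: mE_def[of "snd z"] mQ_def)
    then show ?case by blast
  qed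
  then have "measure (P \<Otimes>\<^sub>M N) (\<Union>K. ?H K) = 1"
    by (subst PN.prob_eq_1) auto
  moreover have "(\<lambda>K. measure (P \<Otimes>\<^sub>M N) (?H K)) \<longlonglongrightarrow> measure (P \<Otimes>\<^sub>M N) (\<Union>K. ?H K)"
    using mono by (intro PN.finite_Lim_measure_incseq) (auto simp: incseq_def)
  ultimately have "\<forall>\<^sub>F K in sequentially. 1/2 < measure (P \<Otimes>\<^sub>M N) (?H K)"
    by (intro order_tendstoD(1)) auto
  then show ?thesis using eventually_happens' sequentially_bot less_imp_le by blast
qed

text \<open>The free threshold \<open>m\<close> is placed between the two estimates, at an exponent
  slightly above \<open>g + \<alpha> * d\<close>. If \<open>d\<close> were below 1, some
  \<open>t > d\<close> would be available, and both bounds for the measure of the good set would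
  vanish with \<open>\<delta>\<close>, although that measure is at least 1/2.\<close>

theorem projection_dim_ge_1:
  assumes dimE: "has_exact_dim (distr N borel e) g"
    and dimQ: "AE \<xi> in P. has_exact_dim (distr N borel (q \<xi>)) d"
    and dimT: "AE x in N. has_exact_dim (distr P borel (\<lambda>\<xi>. \<Theta> \<xi> x)) 1"
    and "d < g"
  shows "1 \<le> d"
proof (rule ccontr)
  assume "\<not> 1 \<le> d"
  \<comment> \<open>\<open>t < 1\<close> is what the slope dimension supports, \<open>t < g\<close>
    makes the inverse distance integrable, and \<open>t > d\<close> produces the gain.\<close>
  define t where "t = (d + min 1 g) / 2"
  have t: "d < t" "t < 1" "t < g" using \<open>\<not> 1 \<le> d\<close> \<open>d < g\<close> by (auto simp: t_def min_def)
  have "AE \<xi> in P. \<xi> \<in> space P \<and> has_exact_dim (distr N borel (q \<xi>)) d"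
    using dimQ AE_space[of P] by eventually_elim simp
  then have "\<exists>\<xi>. \<xi> \<in> space P \<and> has_exact_dim (distr N borel (q \<xi>)) d"
    by (rule eventually_happens'[OF P.ae_filter_bot])
  then have "0 \<le> d" by (metis has_exact_dim_nonneg N.prob_space_distr q_section)
  then have "0 \<le> t" using t by simp
  \<comment> \<open>The first entry keeps \<open>t < g - \<epsilon>\<close>; the second makes the
    accumulated loss \<open>(5 + \<alpha>) * \<epsilon>\<close> smaller than the gain
    \<open>\<alpha> * (t - d)\<close>.\<close>
  define \<epsilon> where "\<epsilon> = min ((g - t) / 2) (\<alpha> * (t - d) / (2 * (5 + \<alpha>)))"
  have \<epsilon>: "0 < \<epsilon>" "t < g - \<epsilon>" "\<epsilon> * (5 + \<alpha>) < \<alpha> * (t - d)"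
  proof -
    have "\<alpha> * (t - d) > 0" using t \<alpha> by simp
    then show "0 < \<epsilon>" using t \<alpha> by (simp add: \<epsilon>_def)
    have "\<epsilon> \<le> (g - t) / 2" unfolding \<epsilon>_def by (rule min.cobounded1)
    then show "t < g - \<epsilon>" using t(3) by (simp add: field_simps)
    have "\<epsilon> \<le> \<alpha> * (t - d) / (2 * (5 + \<alpha>))" unfolding \<epsilon>_def by (rule min.cobounded2)
    then have "2 * (\<epsilon> * (5 + \<alpha>)) \<le> \<alpha> * (t - d)" using \<alpha> by (simp add: field_simps)
    then show "\<epsilon> * (5 + \<alpha>) < \<alpha> * (t - d)" using \<open>\<alpha> * (t - d) > 0\<close> by linarith
  qed
  obtain K0 :: nat where K0: "1/2 \<le> measure (P \<Otimes>\<^sub>M N) (good (g - \<epsilon>) (g + \<epsilon>) (d - \<epsilon>) (d + \<epsilon>) t K0)"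
    using good_large[OF dimE dimQ dimT \<epsilon>(1) t(2)] by blast
  define H where "H = good (g - \<epsilon>) (g + \<epsilon>) (d - \<epsilon>) (d + \<epsilon>) t K0"
  \<comment> \<open>One constant dominates the factors lost in passing from dyadic to arbitrary
    radii, for all five exponents.\<close>
  define K where "K = 1 + (\<Sum>s\<in>{g - \<epsilon>, g + \<epsilon>, d - \<epsilon>, d + \<epsilon>, t}. real K0 * 2 powr \<bar>s\<bar>)"
  have Ks: "real K0 * 2 powr \<bar>s\<bar> \<le> K" if "s \<in> {g - \<epsilon>, g + \<epsilon>, d - \<epsilon>, d + \<epsilon>, t}" for s
    using member_le_sum[OF that, of "\<lambda>s. real K0 * 2 powr \<bar>s\<bar>"] unfolding K_def by simp
  have K1: "1 \<le> K" by (auto simp: K_def intro!: sum_nonneg)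
  have up: "m \<rho> \<le> K * \<rho> powr s"
    if s: "s \<in> {g - \<epsilon>, g + \<epsilon>, d - \<epsilon>, d + \<epsilon>, t}" and mono: "\<And>r r'. 0 < r \<Longrightarrow> r \<le> r' \<Longrightarrow> m r \<le> m r'"
      and b: "\<And>n. m ((1/2)^n) \<le> K0 * ((1/2)^n) powr s" and \<rho>: "0 < \<rho>" "\<rho> \<le> 1" for m :: "real \<Rightarrow> real" and s \<rho>
    using dyadic_to_real[OF mono _ b \<rho>] mult_right_mono[OF Ks[OF s], of "\<rho> powr s"] by auto
  have low: "\<rho> powr s \<le> K * m \<rho>"
    if s: "s \<in> {g - \<epsilon>, g + \<epsilon>, d - \<epsilon>, d + \<epsilon>, t}" and mono: "\<And>r r'. 0 < r \<Longrightarrow> r \<le> r' \<Longrightarrow> m r \<le> m r'"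
      and nn: "\<And>r. 0 \<le> m r" and b: "\<And>n. ((1/2)^n) powr s \<le> K0 * m ((1/2)^n)" and \<rho>: "0 < \<rho>" "\<rho> \<le> 1" for m :: "real \<Rightarrow> real" and s \<rho>
    using dyadic_to_real_lower[OF mono _ b \<rho>] mult_right_mono[OF Ks[OF s] nn[of \<rho>]] by auto
  have Hsub: "\<xi> \<in> space P \<and> x \<in> space N" if "(\<xi>, x) \<in> H" for \<xi> x
    using that by (auto simp: H_def good_def space_pair_measure)
  have monoE: "mE x r \<le> mE x r'" if "r \<le> r'" for x r r'
    unfolding mE_def using that by (intro N.finite_measure_mono) auto
  have monoQ: "mQ \<xi> x r \<le> mQ \<xi> x r'" if "\<xi> \<in> space P" "r \<le> r'" for \<xi> x r r'
    unfolding mQ_def using that q_section[OF that(1)] by (intro N.finite_measure_mono) auto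
  have monoT: "mT \<xi> x r \<le> mT \<xi> x r'" if "x \<in> space N" "r \<le> r'" for \<xi> x r r'
    unfolding mT_def using that \<Theta>_section[OF that(1)] by (intro P.finite_measure_mono) auto
  have nn: "0 \<le> mE x r" "0 \<le> mQ \<xi> x r" "0 \<le> mT \<xi> x r" for \<xi> x r
    by (auto simp: mE_def mQ_def mT_def)
  have "\<exists>C. \<forall>\<delta> m. 0 < \<delta> \<longrightarrow> (L + 1) * \<delta> \<le> 1 \<longrightarrow> 0 < m \<longrightarrow>
     measure (P \<Otimes>\<^sub>M N) H \<le> C * (\<delta> powr ((d - \<epsilon>) - (g + \<epsilon>) - (1 + \<alpha>) * (d + \<epsilon>)) * m) +
       C * (\<delta> powr ((1 + \<alpha>) * t + (g - \<epsilon>) - t) / m)"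
  proof (rule measure_good_le[where K = K])
    fix \<xi> x \<rho> assume H: "(\<xi>, x) \<in> H" and \<rho>: "0 < \<rho>" "\<rho> \<le> (1::real)"
    have b: "mE x ((1/2)^n) \<le> K0 * ((1/2)^n) powr (g - \<epsilon>)" "((1/2)^n) powr (g + \<epsilon>) \<le> K0 * mE x ((1/2)^n)"
     "mQ \<xi> x ((1/2)^n) \<le> K0 * ((1/2)^n) powr (d - \<epsilon>)" "((1/2)^n) powr (d + \<epsilon>) \<le> K0 * mQ \<xi> x ((1/2)^n)"
     "mT \<xi> x ((1/2)^n) \<le> K0 * ((1/2)^n) powr t" for n
      using H by (auto simp: H_def good_def)
    show "mE x \<rho> \<le> K * \<rho> powr (g - \<epsilon>)" using b \<rho> monoE nn by (intro up) auto
    show "\<rho> powr (g + \<epsilon>) \<le> K * mE x \<rho>" using b \<rho> monoE nn by (intro low) auto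
    show "mQ \<xi> x \<rho> \<le> K * \<rho> powr (d - \<epsilon>)" using b \<rho> monoQ nn Hsub[OF H] by (intro up) auto
    show "\<rho> powr (d + \<epsilon>) \<le> K * mQ \<xi> x \<rho>" using b \<rho> monoQ nn Hsub[OF H] by (intro low) auto
    show "mT \<xi> x \<rho> \<le> K * \<rho> powr t" using b \<rho> monoT nn Hsub[OF H] by (intro up) auto
  qed (use \<epsilon> \<open>0 \<le> t\<close> K1 in \<open>auto simp: H_def\<close>)
  then obtain C where C: "\<And>\<delta> m. 0 < \<delta> \<Longrightarrow> (L + 1) * \<delta> \<le> 1 \<Longrightarrow> 0 < m \<Longrightarrow>
     measure (P \<Otimes>\<^sub>M N) H \<le> C * (\<delta> powr ((d - \<epsilon>) - (g + \<epsilon>) - (1 + \<alpha>) * (d + \<epsilon>)) * m) +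
       C * (\<delta> powr ((1 + \<alpha>) * t + (g - \<epsilon>) - t) / m)"
    by blast
  define \<beta> where "\<beta> = \<alpha> * (t - d) - (5 + \<alpha>) * \<epsilon>"
  have \<beta>: "\<beta> > 0" using \<epsilon>(3) by (simp add: \<beta>_def mult.commute)
  have ineq: "1/2 \<le> C * \<delta> powr \<epsilon> + C * \<delta> powr \<beta>" if \<delta>: "0 < \<delta>" "(L + 1) * \<delta> \<le> 1" for \<delta>
  proof -
    \<comment> \<open>The counting bound loses \<open>(3 + \<alpha>) * \<epsilon>\<close>; one more
      \<open>\<epsilon>\<close> in the exponent makes it vanish, and the other bound is left with
      the exponent \<open>\<beta>\<close>.\<close>
    define m where "m = \<delta> powr (g + \<alpha> * d + (4 + \<alpha>) * \<epsilon>)"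
    have 1: "\<delta> powr ((d - \<epsilon>) - (g + \<epsilon>) - (1 + \<alpha>) * (d + \<epsilon>)) * m = \<delta> powr \<epsilon>"
      unfolding m_def powr_add[symmetric] by (rule arg_cong[where f = "(powr) \<delta>"]) (simp add: algebra_simps)
    have 2: "\<delta> powr ((1 + \<alpha>) * t + (g - \<epsilon>) - t) / m = \<delta> powr \<beta>"
      unfolding m_def powr_diff[symmetric] by (rule arg_cong[where f = "(powr) \<delta>"]) (simp add: algebra_simps \<beta>_def)
    show ?thesis using C[OF \<delta>, of m] K0 \<delta> unfolding 1 2 H_def[symmetric] by (simp add: m_def)
  qed
  have "((\<lambda>\<delta>. C * \<delta> powr \<epsilon> + C * \<delta> powr \<beta>) \<longlongrightarrow> C * 0 + C * 0) (at_right 0)"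
    using \<epsilon> \<beta> by (intro tendsto_intros tendsto_zero_powrI[OF tendsto_ident_at tendsto_const])
       (auto simp: eventually_at_right_field intro!: exI[of _ 1])
  moreover have "\<forall>\<^sub>F \<delta> in at_right 0. 1/2 \<le> C * \<delta> powr \<epsilon> + C * \<delta> powr \<beta>"
    unfolding eventually_at_right_field
    using L ineq by (intro exI[of _ "1 / (L + 1)"]) (auto simp: field_simps)
  ultimately have "1/2 \<le> C * 0 + C * 0" by (intro tendsto_lowerbound) auto
  then show False by simp
qed

end

section \<open>Upper bounds for the dimension of an image measure\<close>

lemma lipschitz_image_dim_le:
  fixes f :: "'a \<Rightarrow> 'b::{metric_space, second_countable_topology}"
    and h :: "'a \<Rightarrow> 'c::{metric_space, second_countable_topology}"
  assumes "prob_space N" and f[measurable]: "f \<in> borel_measurable N" and h[measurable]: "h \<in> borel_measurable N"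
    and lip: "\<And>x y. x \<in> space N \<Longrightarrow> y \<in> space N \<Longrightarrow> dist (h x) (h y) \<le> L * dist (f x) (f y)"
    and dims: "has_exact_dim (distr N borel f) g" "has_exact_dim (distr N borel h) d"
  shows "d \<le> g"
proof (rule ccontr)
  assume "\<not> d \<le> g"
  define \<epsilon> where "\<epsilon> = (d - g) / 4"
  have \<epsilon>: "\<epsilon> > 0" using \<open>\<not> d \<le> g\<close> by (simp add: \<epsilon>_def)
  interpret prob_space N by fact
  \<comment> \<open>A Lipschitz constant of at most \<open>2 ^ l\<close> becomes a shift by
    \<open>l\<close> dyadic scales: \<open>f\<close>-balls of radius \<open>(1/2)^(n + l)\<close>
    lie in \<open>h\<close>-balls of radius \<open>(1/2)^n\<close>. For \<open>d > g\<close> the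
    masses contradict this as \<open>n\<close> grows.\<close>
  obtain l :: nat where l: "L \<le> 2 ^ l"
    using real_arch_pow[of 2 L] by (auto intro: less_imp_le)
  have "AE x in N. False"
    using exact_dim_scales[OF assms(1) f dims(1) \<epsilon>] exact_dim_scales[OF assms(1) h dims(2) \<epsilon>] AE_space
  proof eventually_elim
    case (elim x)
    then obtain K1 K2 :: nat where
      K1: "\<And>n. ((1/2)^n) powr (g + \<epsilon>) \<le> real K1 * measure N {y \<in> space N. dist (f x) (f y) \<le> (1/2)^n}"
      and K2: "\<And>n. measure N {y \<in> space N. dist (h x) (h y) \<le> (1/2)^n} \<le> real K2 * ((1/2)^n) powr (d - \<epsilon>)"
      by blast
    define C where "C = real K1 * real K2 / ((1/2)^l) powr (g + \<epsilon>)"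
    have "(2 powr (2 * \<epsilon>)) ^ n \<le> C" for n
    proof -
      have "measure N {y \<in> space N. dist (f x) (f y) \<le> (1/2)^(n + l)}
          \<le> measure N {y \<in> space N. dist (h x) (h y) \<le> (1/2)^n}"
      proof (rule finite_measure_mono)
        show "{y \<in> space N. dist (f x) (f y) \<le> (1/2)^(n + l)} \<subseteq> {y \<in> space N. dist (h x) (h y) \<le> (1/2)^n}"
        proof safe
          fix y assume y: "y \<in> space N" "dist (f x) (f y) \<le> (1/2)^(n + l)"
          have "dist (h x) (h y) \<le> L * dist (f x) (f y)" using lip elim(3) y(1) .
          also have "\<dots> \<le> 2 ^ l * (1/2)^(n + l)" using l y by (intro mult_mono) auto
          also have "\<dots> = (1/2)^n" by (simp add: power_add power_one_over)
          finally show "dist (h x) (h y) \<le> (1/2)^n" .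
        qed
      qed measurable
      then have "real K1 * measure N {y \<in> space N. dist (f x) (f y) \<le> (1/2)^(n + l)} \<le>
          real K1 * (real K2 * ((1/2)^n) powr (d - \<epsilon>))"
        by (intro mult_left_mono order_trans[OF _ K2]) auto
      then have "((1/2)^(n + l)) powr (g + \<epsilon>) \<le> real K1 * real K2 * ((1/2)^n) powr (d - \<epsilon>)"
        using K1[of "n + l"] by (simp add: mult.assoc)
      moreover have "((1/2)^(n + l)) powr (g + \<epsilon>) = ((1/2)^l) powr (g + \<epsilon>) * ((1/2)^n) powr (g + \<epsilon>)"
        by (simp add: power_add powr_mult)
      ultimately have "((1/2)^n) powr (g + \<epsilon>) \<le> C * ((1/2)^n) powr (d - \<epsilon>)"
        by (simp add: C_def field_simps)
      then have "((1/2)^n) powr (g + \<epsilon>) / ((1/2)^n) powr (d - \<epsilon>) \<le> C"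
        by (simp add: field_simps)
      also have "((1/2)^n) powr (g + \<epsilon>) / ((1/2)^n) powr (d - \<epsilon>) = ((1/2)^n) powr (g + \<epsilon> - (d - \<epsilon>))"
        by (rule powr_diff[symmetric])
      also have "g + \<epsilon> - (d - \<epsilon>) = - (2 * \<epsilon>)" by (simp add: \<epsilon>_def field_simps)
      also have "((1/2)^n) powr (- (2 * \<epsilon>)) = (2 powr (2 * \<epsilon>)) ^ n"
        by (simp add: powr_realpow[symmetric] powr_powr powr_minus power_one_over powr_divide field_simps)
      finally show ?thesis .
    qed
    moreover obtain n where "C < (2 powr (2 * \<epsilon>)) ^ n"
      using real_arch_pow[of "2 powr (2 * \<epsilon>)" C] \<epsilon> by auto
    ultimately show False by (meson not_le)
  qed
  then show False by simp
qed

text \<open>A bounded subset of the line meets \<open>O(2 ^ n)\<close> grid cells of length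
  \<open>(1/2)^n\<close>. If the dimension exceeded 1, the part of \<open>S K\<close> in each cell
  would lie in a ball of mass at most \<open>real K * ((1/2)^n) powr (1 + \<epsilon>)\<close>, so
  that the total tends to 0.\<close>

lemma bounded_real_dim_le_1:
  fixes f :: "'a \<Rightarrow> real"
  assumes "prob_space N" and f[measurable]: "f \<in> borel_measurable N"
    and R: "\<And>x. x \<in> space N \<Longrightarrow> \<bar>f x\<bar> \<le> R"
    and dim: "has_exact_dim (distr N borel f) d"
  shows "d \<le> 1"
proof (rule ccontr)
  assume "\<not> d \<le> 1"
  define \<epsilon> where "\<epsilon> = (d - 1) / 2"
  have \<epsilon>: "\<epsilon> > 0" "d - \<epsilon> = 1 + \<epsilon>" using \<open>\<not> d \<le> 1\<close> by (auto simp: \<epsilon>_def field_simps)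
  interpret prob_space N by fact
  define m where "m x r = measure N {y \<in> space N. dist (f x) (f y) \<le> r}" for x r
  have [measurable]: "(\<lambda>x. m x r) \<in> borel_measurable N" for r
    unfolding m_def measure_def by measurable
  define S where "S K = {x \<in> space N. \<forall>n. m x ((1/2)^n) \<le> real K * ((1/2)^n) powr (1 + \<epsilon>)}" for K
  have S[measurable]: "S K \<in> sets N" for K unfolding S_def by measurable
  have small: "measure N (S K) = 0" for K
  proof -
    have le: "measure N (S K) \<le> (2 * R + 3) * real K * (1/2 powr \<epsilon>) ^ n" for n
    proof -
      define c where "c x = \<lfloor>f x * 2^n\<rfloor>" for x
      define D where "D x = {y \<in> space N. dist (f x) (f y) \<le> (1/2)^n}" for x
      have D[measurable]: "D x \<in> sets N" for x unfolding D_def by measurable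
      define J where "J = {\<lfloor>- R * 2^n\<rfloor>..\<lfloor>R * 2^n\<rfloor>}"
      have cJ: "c x \<in> J" if "x \<in> space N" for x
      proof -
        have "- R \<le> f x" "f x \<le> R" using R[OF that] by auto
        then have "- R * 2^n \<le> f x * 2^n" "f x * 2^n \<le> R * 2^n" by (intro mult_right_mono; simp)+
        then show ?thesis unfolding c_def J_def by (auto intro!: floor_mono)
      qed
      obtain x0 where x0: "x0 \<in> space N" using not_empty by auto
      have R0: "R \<ge> 0" using R[OF x0] by linarith
      \<comment> \<open>The mass bound holds only for balls centred in \<open>S K\<close>, so each
        occupied cell is represented by one of its points in \<open>S K\<close>.\<close>
      define p where "p j = (SOME x. x \<in> S K \<and> c x = j)" for j
      have p: "p (c x) \<in> S K \<and> c (p (c x)) = c x" if "x \<in> S K" for x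
        unfolding p_def using that by (intro someI[of "\<lambda>y. y \<in> S K \<and> c y = c x"]) auto
      have "S K \<subseteq> (\<Union>j\<in>c ` S K. D (p j))"
      proof
        fix x assume x: "x \<in> S K"
        have "\<lfloor>f (p (c x)) * 2^n\<rfloor> = \<lfloor>f x * 2^n\<rfloor>" using p[OF x] by (simp add: c_def)
        then have "\<bar>f (p (c x)) * 2^n - f x * 2^n\<bar> \<le> 1" by linarith
        moreover have "\<bar>(f (p (c x)) - f x) * 2^n\<bar> = \<bar>f (p (c x)) - f x\<bar> * 2^n" by (simp add: abs_mult)
        ultimately have "\<bar>f (p (c x)) - f x\<bar> * 2^n \<le> 1" by (simp add: left_diff_distrib)
        then have "x \<in> D (p (c x))"
          using x by (auto simp: D_def S_def dist_real_def field_simps)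
        then show "x \<in> (\<Union>j\<in>c ` S K. D (p j))" using x by auto
      qed
      moreover have sub: "c ` S K \<subseteq> J" using cJ by (auto simp: S_def)
      then have fin: "finite (c ` S K)" by (rule finite_subset) (auto simp: J_def)
      ultimately have "measure N (S K) \<le> measure N (\<Union>j\<in>c ` S K. D (p j))"
        by (intro finite_measure_mono sets.finite_UN) auto
      also have "\<dots> \<le> (\<Sum>j\<in>c ` S K. measure N (D (p j)))"
        using fin by (intro finite_measure_subadditive_finite) auto
      also have "\<dots> \<le> (\<Sum>j\<in>c ` S K. real K * ((1/2)^n) powr (1 + \<epsilon>))"
      proof (rule sum_mono)
        fix j assume "j \<in> c ` S K"
        then have "p j \<in> S K" using p by auto
        then show "measure N (D (p j)) \<le> real K * ((1/2)^n) powr (1 + \<epsilon>)" by (auto simp: S_def D_def m_def)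
      qed
      also have "\<dots> = real (card (c ` S K)) * (real K * ((1/2)^n) powr (1 + \<epsilon>))" by simp
      also have "\<dots> \<le> ((2 * R + 3) * 2^n) * (real K * ((1/2)^n) powr (1 + \<epsilon>))"
      proof (rule mult_right_mono)
        have "card (c ` S K) \<le> card J" using sub by (intro card_mono) (auto simp: J_def)
        moreover have R2: "0 \<le> R * 2^n" using R0 by simp
        ultimately have "int (card (c ` S K)) \<le> \<lfloor>R * 2^n\<rfloor> - \<lfloor>- (R * 2^n)\<rfloor> + 1"
          unfolding J_def by simp linarith
        then have "real_of_int (int (card (c ` S K))) \<le> real_of_int (\<lfloor>R * 2^n\<rfloor> - \<lfloor>- (R * 2^n)\<rfloor> + 1)"
          by (simp only: of_int_le_iff)
        then have "real (card (c ` S K)) \<le> 2 * (R * 2^n) + 2"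
          by simp linarith
        also have "\<dots> \<le> (2 * R + 3) * 2^n"
        proof -
          have "(2 * R + 3) * 2^n = 2 * (R * 2^n) + 3 * 2^n" by (simp add: algebra_simps)
          then show ?thesis using one_le_power[of "2::real" n] by linarith
        qed
        finally show "real (card (c ` S K)) \<le> (2 * R + 3) * 2^n" .
      qed auto
      also have "\<dots> = (2 * R + 3) * real K * (1/2 powr \<epsilon>) ^ n"
        by (simp add: powr_add powr_realpow[symmetric] powr_powr power_one_over powr_divide field_simps)
      finally show ?thesis .
    qed
    have "(\<lambda>n. (2 * R + 3) * real K * (1/2 powr \<epsilon>) ^ n) \<longlonglongrightarrow> (2 * R + 3) * real K * 0"
      using \<epsilon> by (intro tendsto_intros LIMSEQ_realpow_zero) (auto simp: field_simps)
    then have "measure N (S K) \<le> (2 * R + 3) * real K * 0"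
      using le by (intro LIMSEQ_le_const) auto
    then show ?thesis using measure_nonneg[of N "S K"] by simp
  qed
  have "AE x in N. \<forall>K. x \<notin> S K"
    using small by (subst AE_all_countable) (auto simp: AE_not_in null_setsI emeasure_eq_measure)
  with exact_dim_scales[OF assms(1) f dim \<epsilon>(1)] AE_space have "AE x in N. False"
    by eventually_elim (auto simp: S_def m_def \<epsilon>(2))
  then show False by simp
qed

section \<open>Linear fibre equations\<close>

definition hol :: "real \<Rightarrow> real \<Rightarrow> real set \<Rightarrow> (real \<Rightarrow> real) \<Rightarrow> bool" where
  "hol \<alpha> C U f \<longleftrightarrow> 0 \<le> C \<and> (\<forall>u\<in>U. \<bar>f u\<bar> \<le> C) \<and> (\<forall>u\<in>U. \<forall>v\<in>U. \<bar>f u - f v\<bar> \<le> C * \<bar>u - v\<bar> powr \<alpha>)"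

text \<open>The integrating factor of \<open>f' = - (a * f + b)\<close>; \<open>ode_B\<close> below
  is a primitive of \<open>b * ode_E a\<close>. Both are normalised at 0, so that the solution
  through \<open>(x, y)\<close> has the value \<open>ode_E a x * y + ode_B a b x\<close> at 0, which
  is the projection along the fibres.\<close>

definition ode_E :: "(real \<Rightarrow> real) \<Rightarrow> real \<Rightarrow> real" where
  "ode_E a v = exp (integral {0..v} a)"

definition ode_B :: "(real \<Rightarrow> real) \<Rightarrow> (real \<Rightarrow> real) \<Rightarrow> real \<Rightarrow> real" where
  "ode_B a b v = integral {0..v} (\<lambda>s. b s * ode_E a s)"

lemma ode_E_deriv:
  assumes "continuous_on {0..1} a" "v \<in> {0..1}"
  shows "(ode_E a has_real_derivative a v * ode_E a v) (at v within {0..1})"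
  unfolding ode_E_def[abs_def]
  by (rule derivative_eq_intros integral_has_real_derivative[OF assms] refl)+ simp

lemma ode_E_cont: "continuous_on {0..1} a \<Longrightarrow> continuous_on {0..1} (ode_E a)"
  by (rule DERIV_continuous_on[OF ode_E_deriv])

lemma ode_B_deriv:
  assumes "continuous_on {0..1} a" "continuous_on {0..1} b" "v \<in> {0..1}"
  shows "(ode_B a b has_real_derivative b v * ode_E a v) (at v within {0..1})"
  unfolding ode_B_def[abs_def]
  by (rule integral_has_real_derivative) (use assms ode_E_cont[OF assms(1)] in \<open>auto intro!: continuous_intros\<close>)

lemma ode_E_pos[simp]: "ode_E a v > 0" by (simp add: ode_E_def)
lemma abs_ode_E[simp]: "\<bar>ode_E a v\<bar> = ode_E a v" by (simp add: ode_E_def)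
lemma ode_E_0[simp]: "ode_E a 0 = 1" by (simp add: ode_E_def)
lemma ode_B_0[simp]: "ode_B a b 0 = 0" by (simp add: ode_B_def)

text \<open>Along a solution \<open>f\<close>, the function \<open>ode_E a v * f v + ode_B a b v\<close> is constant.\<close>

lemma linear_ode_unique:
  assumes a: "continuous_on {0..1} a" and b: "continuous_on {0..1} b" and x: "x \<in> {0..1}"
  shows "(THE f. f \<in> extensional {0..1} \<and>
        (\<forall>v\<in>{0..1}. (f has_real_derivative - (a v * f v + b v)) (at v within {0..1})) \<and> f x = y)
     = (\<lambda>v\<in>{0..1}. (ode_E a x * y + ode_B a b x - ode_B a b v) / ode_E a v)"
proof (rule the_equality)
  define c where "c = ode_E a x * y + ode_B a b x"
  define h where "h = (\<lambda>v. (c - ode_B a b v) / ode_E a v)"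
  have E0: "ode_E a v \<noteq> 0" for v using ode_E_pos[of a v] by linarith
  have h: "(h has_real_derivative - (a v * h v + b v)) (at v within {0..1})" if "v \<in> {0..1}" for v
    unfolding h_def
    by (rule derivative_eq_intros ode_E_deriv[OF a that] ode_B_deriv[OF a b that] E0 refl)+
      (simp add: E0 field_simps)
  have "((\<lambda>v\<in>{0..1}. h v) has_real_derivative - (a v * (\<lambda>v\<in>{0..1}. h v) v + b v)) (at v within {0..1})"
    if v: "v \<in> {0..1}" for v
    using h[OF v] v by (subst has_field_derivative_cong_ev[where g = h]) (auto intro!: always_eventually)
  then show "(\<lambda>v\<in>{0..1}. (ode_E a x * y + ode_B a b x - ode_B a b v) / ode_E a v) \<in> extensional {0..1} \<and>
    (\<forall>v\<in>{0..1}. ((\<lambda>v\<in>{0..1}. (ode_E a x * y + ode_B a b x - ode_B a b v) / ode_E a v) has_real_derivative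
      - (a v * (\<lambda>v\<in>{0..1}. (ode_E a x * y + ode_B a b x - ode_B a b v) / ode_E a v) v + b v)) (at v within {0..1})) \<and>
    (\<lambda>v\<in>{0..1}. (ode_E a x * y + ode_B a b x - ode_B a b v) / ode_E a v) x = y"
    using x E0 by (auto simp: h_def c_def)
next
  fix f
  assume f: "f \<in> extensional {0..1} \<and>
      (\<forall>v\<in>{0..1}. (f has_real_derivative - (a v * f v + b v)) (at v within {0..1})) \<and> f x = y"
  have E0: "ode_E a v \<noteq> 0" for v using ode_E_pos[of a v] by linarith
  have "\<exists>c. \<forall>v\<in>{0..1}. ode_E a v * f v + ode_B a b v = c"
  proof (rule has_field_derivative_zero_constant)
    fix v :: real assume v: "v \<in> {0..1}"
    have fd: "(f has_real_derivative - (a v * f v + b v)) (at v within {0..1})" using f v by blast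
    show "((\<lambda>v. ode_E a v * f v + ode_B a b v) has_real_derivative 0) (at v within {0..1})"
      by (rule derivative_eq_intros ode_E_deriv[OF a v] ode_B_deriv[OF a b v] fd refl)+ (simp add: algebra_simps)
  qed simp
  then have "ode_E a v * f v + ode_B a b v = ode_E a x * y + ode_B a b x" if "v \<in> {0..1}" for v
    using that x f by metis
  then have "f v = (ode_E a x * y + ode_B a b x - ode_B a b v) / ode_E a v" if "v \<in> {0..1}" for v
    using that E0[of v] by (subst nonzero_eq_divide_eq) (auto simp: mult.commute eq_diff_eq)
  then show "f = (\<lambda>v\<in>{0..1}. (ode_E a x * y + ode_B a b x - ode_B a b v) / ode_E a v)"
    using f by (intro extensionalityI[of _ "{0..1}"]) auto
qed

abbreviation holder01 :: "real \<Rightarrow> real \<Rightarrow> (real \<Rightarrow> real) \<Rightarrow> bool" where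
  "holder01 \<alpha> M \<equiv> hol \<alpha> M {0..1}"

lemma holder01D:
  assumes "holder01 \<alpha> M f" "u \<in> {0..1}"
  shows "\<bar>f u\<bar> \<le> M" "v \<in> {0..1} \<Longrightarrow> \<bar>f u - f v\<bar> \<le> M * \<bar>u - v\<bar> powr \<alpha>"
  using assms unfolding hol_def by blast+

lemma holder01_nonneg: "holder01 \<alpha> M f \<Longrightarrow> 0 \<le> M"
  by (simp add: hol_def)

lemma holder01_continuous:
  assumes "holder01 \<alpha> M f" "\<alpha> > 0"
  shows "continuous_on {0..1} f"
  unfolding continuous_on_def
proof
  fix x :: real assume x: "x \<in> {0..1}"
  have "((\<lambda>y. \<bar>y - x\<bar>) \<longlongrightarrow> \<bar>x - x\<bar>) (at x within {0..1})"
    by (intro tendsto_rabs tendsto_diff tendsto_ident_at tendsto_const)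
  then have "((\<lambda>y. \<bar>y - x\<bar>) \<longlongrightarrow> 0) (at x within {0..1})" by simp
  then have "((\<lambda>y. \<bar>y - x\<bar> powr \<alpha>) \<longlongrightarrow> 0) (at x within {0..1})"
    by (rule tendsto_zero_powrI[OF _ tendsto_const _ \<open>\<alpha> > 0\<close>])
      (rule always_eventually, simp)
  then have "((\<lambda>y. M * \<bar>y - x\<bar> powr \<alpha>) \<longlongrightarrow> 0) (at x within {0..1})"
    by (rule tendsto_mult_right_zero)
  moreover have "\<forall>\<^sub>F y in at x within {0..1}. norm (f y - f x) \<le> M * \<bar>y - x\<bar> powr \<alpha>"
    unfolding eventually_at_filter
    by (rule always_eventually) (use holder01D(2)[OF assms(1) _ x] in simp)
  ultimately have "((\<lambda>y. f y - f x) \<longlongrightarrow> 0) (at x within {0..1})"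
    by (rule Lim_null_comparison[rotated])
  then show "(f \<longlongrightarrow> f x) (at x within {0..1})" by (rule LIM_zero_cancel)
qed

text \<open>The mean value theorem turns the difference into \<open>f' z * (y - x)\<close>, and the
  Hoelder bound compares \<open>f' z\<close> with \<open>f' x\<close>.\<close>

lemma taylor_holder:
  fixes f f' :: "real \<Rightarrow> real"
  assumes f: "\<And>v. v \<in> {0..1} \<Longrightarrow> (f has_real_derivative f' v) (at v within {0..1})"
    and hol: "holder01 \<alpha> M f'" and \<alpha>: "\<alpha> > 0" and xy: "x \<in> {0..1}" "y \<in> {0..1}"
  shows "\<bar>f y - f x\<bar> \<le> M * \<bar>y - x\<bar>" "\<bar>f y - f x - f' x * (y - x)\<bar> \<le> M * \<bar>y - x\<bar> powr (1 + \<alpha>)"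
proof -
  have "\<exists>z\<in>{min x y..max x y}. f (max x y) - f (min x y) = (*) (f' z) (max x y - min x y)"
  proof (rule mvt_very_simple)
    fix v assume "min x y \<le> v" "v \<le> max x y"
    then have "v \<in> {0..1}" using xy by auto
    from f[OF this] have "(f has_real_derivative f' v) (at v within {min x y..max x y})"
      by (rule has_field_derivative_subset) (use xy in auto)
    then show "(f has_derivative (*) (f' v)) (at v within {min x y..max x y})"
      by (simp add: has_field_derivative_def)
  qed auto
  then obtain z where z: "z \<in> {min x y..max x y}" "f (max x y) - f (min x y) = f' z * (max x y - min x y)"
    by blast
  have eq: "f y - f x = f' z * (y - x)"
    using z(2) by (cases "x \<le> y") (auto simp: algebra_simps)
  have z01: "z \<in> {0..1}" using z(1) xy by auto
  show "\<bar>f y - f x\<bar> \<le> M * \<bar>y - x\<bar>"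
    unfolding eq abs_mult using holder01D(1)[OF hol z01] by (intro mult_right_mono) auto
  have M: "0 \<le> M" using hol by (rule holder01_nonneg)
  have "\<bar>f y - f x - f' x * (y - x)\<bar> = \<bar>f' z - f' x\<bar> * \<bar>y - x\<bar>"
    by (simp add: eq abs_mult[symmetric] algebra_simps)
  also have "\<dots> \<le> (M * \<bar>z - x\<bar> powr \<alpha>) * \<bar>y - x\<bar>"
    using holder01D(2)[OF hol z01 xy(1)] by (intro mult_right_mono) auto
  also have "\<dots> \<le> (M * \<bar>y - x\<bar> powr \<alpha>) * \<bar>y - x\<bar>"
    using z(1) \<alpha> M by (intro mult_right_mono mult_left_mono powr_mono2) auto
  also have "\<dots> = M * \<bar>y - x\<bar> powr (1 + \<alpha>)"
    by (cases "x = y") (auto simp: powr_add)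
  finally show "\<bar>f y - f x - f' x * (y - x)\<bar> \<le> M * \<bar>y - x\<bar> powr (1 + \<alpha>)" .
qed

lemma holder01_mult:
  assumes f: "holder01 \<alpha> M f" and g: "holder01 \<alpha> M' g"
  shows "holder01 \<alpha> (2 * M * M') (\<lambda>x. f x * g x)"
proof -
  have M: "0 \<le> M" "0 \<le> M'" using holder01_nonneg[OF f] holder01_nonneg[OF g] by auto
  have 1: "\<bar>f u * g u\<bar> \<le> 2 * M * M'" if "u \<in> {0..1}" for u
  proof -
    have "\<bar>f u * g u\<bar> \<le> M * M'" unfolding abs_mult 
      using holder01D(1)[OF f that] holder01D(1)[OF g that] M by (intro mult_mono) auto
    also have "\<dots> \<le> 2 * M * M'" using M by simp
    finally show ?thesis .
  qed
  have 2: "\<bar>f u * g u - f v * g v\<bar> \<le> 2 * M * M' * \<bar>u - v\<bar> powr \<alpha>" if "u \<in> {0..1}" "v \<in> {0..1}" for u v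
  proof -
    have "\<bar>f u * g u - f v * g v\<bar> = \<bar>f u * (g u - g v) + (f u - f v) * g v\<bar>" by (simp add: algebra_simps)
    also have "\<dots> \<le> \<bar>f u\<bar> * \<bar>g u - g v\<bar> + \<bar>f u - f v\<bar> * \<bar>g v\<bar>"
      unfolding abs_mult[symmetric] by (rule abs_triangle_ineq)
    also have "\<dots> \<le> M * (M' * \<bar>u - v\<bar> powr \<alpha>) + (M * \<bar>u - v\<bar> powr \<alpha>) * M'"
      using holder01D(1)[OF f that(1)] holder01D(2)[OF g that] holder01D(2)[OF f that] holder01D(1)[OF g that(2)] M
      by (intro add_mono mult_mono) auto
    finally show ?thesis by (simp add: algebra_simps)
  qed
  show ?thesis unfolding hol_def using M by (intro ballI conjI 1 2) simp
qed

text \<open>All bounds are functions of \<open>M\<close>, which makes the later estimates on fibres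
  uniform in the parameter.\<close>

lemma ode_bounds:
  assumes a: "holder01 \<alpha> M a" and b: "holder01 \<alpha> M b" and \<alpha>: "0 < \<alpha>" "\<alpha> \<le> 1"
  shows "\<And>v. v \<in> {0..1} \<Longrightarrow> ode_E a v \<le> exp M" "\<And>v. v \<in> {0..1} \<Longrightarrow> exp (- M) \<le> ode_E a v"
    and "holder01 \<alpha> (2 * M * exp M * (1 + M)) (\<lambda>v. a v * ode_E a v)"
    and "holder01 \<alpha> (2 * M * exp M * (1 + M)) (\<lambda>v. b v * ode_E a v)"
proof -
  have M: "0 \<le> M" using a by (rule holder01_nonneg)
  have ca: "continuous_on {0..1} a" using a \<alpha>(1) by (rule holder01_continuous)
  have I: "\<bar>integral {0..v} a\<bar> \<le> M" if "v \<in> {0..1}" for v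
  proof -
    have "norm (integral {0..v} a) \<le> M * (v - 0)"
      using that a by (intro integral_bound continuous_on_subset[OF ca]) (auto simp: holder01D(1))
    also have "\<dots> \<le> M * 1" using that M by (intro mult_left_mono) auto
    finally show ?thesis by simp
  qed
  show E: "ode_E a v \<le> exp M" if "v \<in> {0..1}" for v
    using I[OF that] by (simp add: ode_E_def)
  show "exp (- M) \<le> ode_E a v" if "v \<in> {0..1}" for v
    using I[OF that] by (simp add: ode_E_def)
  have lipE: "\<bar>ode_E a u - ode_E a v\<bar> \<le> (M * exp M) * \<bar>u - v\<bar>" if uv: "u \<in> {0..1}" "v \<in> {0..1}" for u v
    using uv M by (intro field_differentiable_bound[OF _ ode_E_deriv[OF ca], simplified])
      (use holder01D(1)[OF a] E in \<open>auto simp: abs_mult intro!: mult_mono less_imp_le[OF ode_E_pos]\<close>)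
  have "holder01 \<alpha> (exp M * (1 + M)) (ode_E a)"
    unfolding hol_def
  proof (intro ballI conjI)
    show "0 \<le> exp M * (1 + M)" using M by simp
    fix u :: real assume u: "u \<in> {0..1}"
    have "ode_E a u \<le> exp M * 1" using E u by simp
    also have "\<dots> \<le> exp M * (1 + M)" using M by (intro mult_left_mono) auto
    finally show "\<bar>ode_E a u\<bar> \<le> exp M * (1 + M)" using ode_E_pos[of a u] by simp
    fix v :: real assume "v \<in> {0..1}"
    with u have uv: "u \<in> {0..1}" "v \<in> {0..1}" by auto
    have le: "\<bar>u - v\<bar> powr 1 \<le> \<bar>u - v\<bar> powr \<alpha>" using uv \<alpha> by (intro powr_mono') auto
    have "M * exp M \<le> exp M * (1 + M)" by (simp add: algebra_simps)
    from mult_mono[OF this le] have "(M * exp M) * \<bar>u - v\<bar> \<le> (exp M * (1 + M)) * \<bar>u - v\<bar> powr \<alpha>"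
      using M by simp
    then show "\<bar>ode_E a u - ode_E a v\<bar> \<le> exp M * (1 + M) * \<bar>u - v\<bar> powr \<alpha>"
      using lipE[OF uv] by linarith
  qed
  from holder01_mult[OF a this] holder01_mult[OF b this]
  show "holder01 \<alpha> (2 * M * exp M * (1 + M)) (\<lambda>v. a v * ode_E a v)"
    "holder01 \<alpha> (2 * M * exp M * (1 + M)) (\<lambda>v. b v * ode_E a v)"
    by (simp_all add: mult.assoc)
qed

text \<open>\<open>L\<close> is chosen before \<open>a\<close>, \<open>b\<close> and
  \<open>w\<close>, hence serves all parameters at once. For the last estimate
  \<open>ode_E a\<close> and \<open>ode_B a b\<close> are expanded at \<open>x\<close>: up to Taylor
  errors the difference of the projections is \<open>ode_E a y\<close> times the deviation of
  \<open>w y\<close> from the tangent line of the fibre through \<open>(x, w x)\<close>, and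
  \<open>ode_E a y \<ge> exp (- M)\<close> permits dividing.\<close>

lemma fibre_projection_bounds:
  assumes \<alpha>: "0 < \<alpha>" "\<alpha> \<le> 1" and M: "0 \<le> M" and R: "0 \<le> R"
  shows "\<exists>L\<ge>1. \<forall>a b w. holder01 \<alpha> M a \<longrightarrow> holder01 \<alpha> M b \<longrightarrow> (\<forall>x\<in>{0..1}. \<bar>w x\<bar> \<le> R) \<longrightarrow>
    (\<forall>x\<in>{0..1}. \<bar>a x * w x + b x\<bar> \<le> L \<and> \<bar>ode_E a x * w x + ode_B a b x\<bar> \<le> L \<and> (\<forall>y\<in>{0..1}.
      \<bar>(ode_E a x * w x + ode_B a b x) - (ode_E a y * w y + ode_B a b y)\<bar> \<le> L * dist (x, w x) (y, w y) \<and>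
      \<bar>w y - w x - (- (a x * w x + b x)) * (y - x)\<bar> \<le>
        L * (\<bar>(ode_E a x * w x + ode_B a b x) - (ode_E a y * w y + ode_B a b y)\<bar> + \<bar>y - x\<bar> powr (1 + \<alpha>))))"
proof -
  define D where "D = 2 * M * exp M * (1 + M)"
  have D: "D \<ge> 0" using M by (simp add: D_def)
  define L where "L = 1 + (M * R + M) + (exp M * R + D) + (exp M + (R * D + D)) + exp M * (1 + R * D + D + M * (R + 1) * D)"
  have Ls: "1 \<le> L" "M * R + M \<le> L" "exp M * R + D \<le> L" "exp M + (R * D + D) \<le> L"
     "exp M * (1 + R * D + D + M * (R + 1) * D) \<le> L"
    using M R D by (auto simp: L_def)
  show ?thesis
  proof (intro exI[of _ L] conjI allI impI Ls(1) ballI)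
    fix a b w :: "real \<Rightarrow> real" and x :: real
    assume a: "holder01 \<alpha> M a" and b: "holder01 \<alpha> M b" and w: "\<forall>x\<in>{0..1}. \<bar>w x\<bar> \<le> R" and x: "x \<in> {0..1}"
    let ?q = "\<lambda>x. ode_E a x * w x + ode_B a b x"
    have E: "ode_E a v \<le> exp M" "exp (- M) \<le> ode_E a v" if "v \<in> {0..1}" for v
      using ode_bounds(1,2)[OF a b \<alpha> that] by auto
    have hol: "holder01 \<alpha> D (\<lambda>v. a v * ode_E a v)" "holder01 \<alpha> D (\<lambda>v. b v * ode_E a v)"
      using ode_bounds(3,4)[OF a b \<alpha>] by (auto simp: D_def)
    have ca: "continuous_on {0..1} a" "continuous_on {0..1} b"
      using a b \<alpha>(1) by (auto intro: holder01_continuous)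
    have der: "(ode_E a has_real_derivative a v * ode_E a v) (at v within {0..1})"
      "(ode_B a b has_real_derivative b v * ode_E a v) (at v within {0..1})" if "v \<in> {0..1}" for v
      using that ca by (auto intro: ode_E_deriv ode_B_deriv simp del: atLeastAtMost_iff)
    have TE: "\<bar>ode_E a y - ode_E a x\<bar> \<le> D * \<bar>y - x\<bar>"
        "\<bar>ode_E a y - ode_E a x - a x * ode_E a x * (y - x)\<bar> \<le> D * \<bar>y - x\<bar> powr (1 + \<alpha>)"
      and TB: "\<bar>ode_B a b y - ode_B a b x\<bar> \<le> D * \<bar>y - x\<bar>"
        "\<bar>ode_B a b y - ode_B a b x - b x * ode_E a x * (y - x)\<bar> \<le> D * \<bar>y - x\<bar> powr (1 + \<alpha>)"
      if "x \<in> {0..1}" "y \<in> {0..1}" for x y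
      by (rule taylor_holder[OF der(1) hol(1) \<alpha>(1) that] taylor_holder[OF der(2) hol(2) \<alpha>(1) that]; assumption)+
    have abx: "\<bar>a x\<bar> \<le> M" "\<bar>b x\<bar> \<le> M" "\<bar>w x\<bar> \<le> R" using holder01D(1)[OF a x] holder01D(1)[OF b x] w x by auto
    have aw: "\<bar>a x * w x\<bar> \<le> M * R" unfolding abs_mult using abx M by (intro mult_mono) auto
    then show "\<bar>a x * w x + b x\<bar> \<le> L" using abx Ls(2) by linarith
    have "\<bar>ode_E a x * w x\<bar> \<le> exp M * R" unfolding abs_mult
      using E[OF x] abx by (intro mult_mono) auto
    moreover have "\<bar>ode_B a b x\<bar> \<le> D * 1"
    proof -
      have "D * x \<le> D * 1" using x D by (intro mult_left_mono) auto
      then show ?thesis using TB(1)[of 0 x] x by auto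
    qed
    ultimately show "\<bar>?q x\<bar> \<le> L" using Ls(3) by linarith
    fix y :: real assume y: "y \<in> {0..1}"
    have dW: "\<bar>w x - w y\<bar> \<le> dist (x, w x) (y, w y)" "\<bar>x - y\<bar> \<le> dist (x, w x) (y, w y)"
      using dist_snd_le[of "(x, w x)" "(y, w y)"] dist_fst_le[of "(x, w x)" "(y, w y)"] by (auto simp: dist_real_def)
    have id1: "?q x - ?q y = ode_E a y * (w x - w y) + (ode_E a x - ode_E a y) * w x + (ode_B a b x - ode_B a b y)"
      by (simp add: algebra_simps)
    have "\<bar>?q x - ?q y\<bar> \<le> \<bar>ode_E a y * (w x - w y)\<bar> + \<bar>(ode_E a x - ode_E a y) * w x\<bar> + \<bar>ode_B a b x - ode_B a b y\<bar>"
      unfolding id1 by linarith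
    also have "\<dots> \<le> exp M * dist (x, w x) (y, w y) + (D * dist (x, w x) (y, w y)) * R + D * dist (x, w x) (y, w y)"
      unfolding abs_mult using E[OF y] dW abx D TE(1)[OF y x] TB(1)[OF y x]
      by (intro add_mono mult_mono) (auto intro: order_trans[OF _ mult_left_mono])
    also have "\<dots> = (exp M + (R * D + D)) * dist (x, w x) (y, w y)" by (simp add: algebra_simps)
    also have "\<dots> \<le> L * dist (x, w x) (y, w y)" using Ls(4) by (intro mult_right_mono) auto
    finally show "\<bar>?q x - ?q y\<bar> \<le> L * dist (x, w x) (y, w y)" .
    define h where "h = y - x"
    define p where "p = \<bar>h\<bar> powr (1 + \<alpha>)"
    define rE where "rE = ode_E a y - ode_E a x - a x * ode_E a x * h"
    define rB where "rB = ode_B a b y - ode_B a b x - b x * ode_E a x * h"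
    define dE where "dE = ode_E a y - ode_E a x"
    have rr: "\<bar>rE\<bar> \<le> D * p" "\<bar>rB\<bar> \<le> D * p"
      using TE(2)[OF x y] TB(2)[OF x y] by (auto simp: rE_def rB_def p_def h_def)
    have h1: "\<bar>h\<bar> \<le> 1" using x y by (auto simp: h_def)
    \<comment> \<open>A product of two first-order differences is of order 2, which is at least
      \<open>1 + \<alpha>\<close>, and distances are at most 1.\<close>
    have dE: "\<bar>dE * h\<bar> \<le> D * p"
    proof -
      have "\<bar>dE * h\<bar> \<le> D * \<bar>h\<bar> * \<bar>h\<bar>" unfolding abs_mult dE_def h_def
        using TE(1)[OF x y] by (intro mult_right_mono) auto
      also have "\<bar>h\<bar> * \<bar>h\<bar> = \<bar>h\<bar> powr 2" by (cases "h = 0") (auto simp: powr_numeral power2_eq_square)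
      then have "D * \<bar>h\<bar> * \<bar>h\<bar> = D * \<bar>h\<bar> powr 2" by (simp add: mult.assoc)
      also have "\<dots> \<le> D * p" unfolding p_def using h1 \<alpha> D by (intro mult_left_mono powr_mono') auto
      finally show ?thesis .
    qed
    \<comment> \<open>An exact identity: \<open>rE\<close> and \<open>rB\<close> are the Taylor
      remainders, and \<open>dE * h\<close> accounts for taking the integrating factor at
      \<open>y\<close> instead of \<open>x\<close>.\<close>
    have id2: "ode_E a y * (w y - w x - (- (a x * w x + b x)) * h) =
       (?q y - ?q x) - rE * w x - rB + (a x * w x + b x) * (dE * h)"
      by (simp add: rE_def rB_def dE_def algebra_simps)
    have "ode_E a y * \<bar>w y - w x - (- (a x * w x + b x)) * h\<bar> = \<bar>(?q y - ?q x) - rE * w x - rB + (a x * w x + b x) * (dE * h)\<bar>"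
      unfolding id2[symmetric] abs_mult by simp
    also have "\<dots> \<le> \<bar>?q x - ?q y\<bar> + \<bar>rE * w x\<bar> + \<bar>rB\<bar> + \<bar>(a x * w x + b x) * (dE * h)\<bar>"
      by linarith
    also have "\<dots> \<le> \<bar>?q x - ?q y\<bar> + D * p * R + D * p + (M * (R + 1)) * (D * p)"
    proof -
      have "\<bar>a x * w x + b x\<bar> \<le> M * (R + 1)" using aw abx by (simp add: algebra_simps)
      then have "\<bar>(a x * w x + b x) * (dE * h)\<bar> \<le> (M * (R + 1)) * (D * p)"
        unfolding abs_mult[of "a x * w x + b x"] using dE by (intro mult_mono) auto
      moreover have "\<bar>rE * w x\<bar> \<le> D * p * R" unfolding abs_mult using rr abx by (intro mult_mono) auto
      ultimately show ?thesis using rr by linarith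
    qed
    finally have 1: "ode_E a y * \<bar>w y - w x - (- (a x * w x + b x)) * h\<bar> \<le>
       \<bar>?q x - ?q y\<bar> + (R * D + D + M * (R + 1) * D) * p" by (simp add: algebra_simps)
    have "\<bar>w y - w x - (- (a x * w x + b x)) * h\<bar> = exp M * (exp (- M) * \<bar>w y - w x - (- (a x * w x + b x)) * h\<bar>)"
      by (simp add: exp_minus)
    also have "\<dots> \<le> exp M * (ode_E a y * \<bar>w y - w x - (- (a x * w x + b x)) * h\<bar>)"
      using E[OF y] by (intro mult_left_mono mult_right_mono) auto
    also have "\<dots> \<le> exp M * (\<bar>?q x - ?q y\<bar> + (R * D + D + M * (R + 1) * D) * p)"
      using 1 by (intro mult_left_mono) auto
    also have "\<dots> \<le> exp M * ((1 + R * D + D + M * (R + 1) * D) * (\<bar>?q x - ?q y\<bar> + p))"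
    proof (rule mult_left_mono)
      have "0 \<le> (R * D + D + M * (R + 1) * D) * \<bar>?q x - ?q y\<bar> + p"
        using R D M by (intro add_nonneg_nonneg mult_nonneg_nonneg) (auto simp: p_def)
      then show "\<bar>?q x - ?q y\<bar> + (R * D + D + M * (R + 1) * D) * p \<le> (1 + R * D + D + M * (R + 1) * D) * (\<bar>?q x - ?q y\<bar> + p)"
        by (simp add: algebra_simps)
    qed simp
    also have "\<dots> \<le> L * (\<bar>?q x - ?q y\<bar> + p)"
      unfolding mult.assoc[symmetric] using Ls(5) by (intro mult_right_mono) (auto simp: p_def)
    finally show "\<bar>w y - w x - (- (a x * w x + b x)) * (y - x)\<bar> \<le> L * (\<bar>?q x - ?q y\<bar> + \<bar>y - x\<bar> powr (1 + \<alpha>))"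
      by (simp add: p_def h_def)
  qed
qed

text \<open>Parameters with a common initial itinerary have uniformly close coefficients; this
  transfers the closeness to the projections and so to their measurability in the parameter.\<close>

lemma ode_dependence:
  assumes a: "holder01 \<alpha> M a" "holder01 \<alpha> M a'" and b: "holder01 \<alpha> M b" "holder01 \<alpha> M b'" and \<alpha>: "0 < \<alpha>" "\<alpha> \<le> 1"
    and d: "\<And>v. v \<in> {0..1} \<Longrightarrow> \<bar>a v - a' v\<bar> \<le> d" "\<And>v. v \<in> {0..1} \<Longrightarrow> \<bar>b v - b' v\<bar> \<le> d" and x: "x \<in> {0..1}"
  shows "\<bar>ode_E a x - ode_E a' x\<bar> \<le> exp M * d" "\<bar>ode_B a b x - ode_B a' b' x\<bar> \<le> (1 + M) * exp M * d"
proof -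
  have M: "0 \<le> M" using a(1) by (rule holder01_nonneg)
  have d0: "0 \<le> d" using d(1)[of 0] by (auto intro: order_trans[OF abs_ge_zero])
  have cont: "continuous_on {0..1} a" "continuous_on {0..1} a'" "continuous_on {0..1} b" "continuous_on {0..1} b'"
    using a b \<alpha> by (auto intro: holder01_continuous)
  have le: "integral {0..v} f - integral {0..v} g \<le> e \<and> integral {0..v} g - integral {0..v} f \<le> e"
    if v: "v \<in> {0..1}" and fg: "continuous_on {0..1} f" "continuous_on {0..1} g"
      and e: "\<And>u. u \<in> {0..1} \<Longrightarrow> \<bar>f u - g u\<bar> \<le> e" "0 \<le> e" for v e :: real and f g :: "real \<Rightarrow> real"
  proof -
    have sub: "{0..v} \<subseteq> {0..1}" using v by auto
    have int: "f integrable_on {0..v}" "g integrable_on {0..v}"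
      using fg by (auto intro!: integrable_continuous_real continuous_on_subset[OF _ sub])
    have "norm (integral {0..v} (\<lambda>u. f u - g u)) \<le> e * (v - 0)"
      using v fg sub e by (intro integral_bound continuous_on_diff continuous_on_subset[OF _ sub]) auto
    also have "\<dots> \<le> e * 1" using v e by (intro mult_left_mono) auto
    finally show ?thesis using int by (simp add: integral_diff abs_le_iff)
  qed
  have E: "\<bar>ode_E a v - ode_E a' v\<bar> \<le> exp M * d" if v: "v \<in> {0..1}" for v
  proof -
    \<comment> \<open>By convexity \<open>exp\<close> is Lipschitz with constant
      \<open>exp M\<close> below \<open>M\<close>; the estimate is used in both orders.\<close>
    have "exp p - exp p' \<le> exp M * d" if "p \<le> p' + d" "p \<le> M" for p p' :: real
    proof -
      have "1 + (p' - p) \<le> exp (p' - p)" by (rule exp_ge_add_one_self)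
      then have "exp p * (1 + (p' - p)) \<le> exp p * exp (p' - p)" by (intro mult_left_mono) auto
      then have 1: "exp p - exp p' \<le> exp p * (p - p')" by (simp add: exp_diff algebra_simps)
      show ?thesis
      proof (cases "p' \<le> p")
        case True
        then have "exp p * (p - p') \<le> exp M * d" using that by (intro mult_mono) auto
        then show ?thesis using 1 by linarith
      next
        case False
        then have "exp p \<le> exp p'" by simp
        moreover have "0 \<le> exp M * d" using d0 by simp
        ultimately show ?thesis by linarith
      qed
    qed
    moreover have "ode_E a v \<le> exp M" "ode_E a' v \<le> exp M"
      using ode_bounds(1)[OF a(1) b(1) \<alpha> v] ode_bounds(1)[OF a(2) b(1) \<alpha> v] by auto
    moreover have "integral {0..v} a \<le> integral {0..v} a' + d" "integral {0..v} a' \<le> integral {0..v} a + d"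
      using le[OF v cont(1,2) d(1) d0] by auto
    ultimately show ?thesis by (simp add: ode_E_def abs_le_iff)
  qed
  from E[OF x] show "\<bar>ode_E a x - ode_E a' x\<bar> \<le> exp M * d" .
  have "\<bar>b u * ode_E a u - b' u * ode_E a' u\<bar> \<le> (1 + M) * exp M * d" if u: "u \<in> {0..1}" for u
  proof -
    have "b u * ode_E a u - b' u * ode_E a' u = (b u - b' u) * ode_E a u + b' u * (ode_E a u - ode_E a' u)"
      by (simp add: algebra_simps)
    also have "\<bar>\<dots>\<bar> \<le> \<bar>b u - b' u\<bar> * ode_E a u + \<bar>b' u\<bar> * \<bar>ode_E a u - ode_E a' u\<bar>"
      by (rule order_trans[OF abs_triangle_ineq]) (simp add: abs_mult)
    also have "\<dots> \<le> d * exp M + M * (exp M * d)"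
      using d(2)[OF u] E[OF u] holder01D(1)[OF b(2) u] ode_bounds(1)[OF a(1) b(1) \<alpha> u] d0 M
      by (intro add_mono mult_mono) (auto intro: less_imp_le)
    finally show ?thesis by (simp add: algebra_simps)
  qed
  moreover have "0 \<le> (1 + M) * exp M * d" using M d0 by simp
  ultimately show "\<bar>ode_B a b x - ode_B a' b' x\<bar> \<le> (1 + M) * exp M * d"
    unfolding ode_B_def using cont x ode_E_cont
    by (intro abs_leI; use le[of x "\<lambda>s. b s * ode_E a s" "\<lambda>s. b' s * ode_E a' s" "(1 + M) * exp M * d"] in
      \<open>auto simp: continuous_on_mult ode_E_cont\<close>)
qed

section \<open>Hoelder functions and inverse branches\<close>

lemma hol_mono:
  assumes h: "hol \<alpha> C U f" and le: "\<alpha>' \<le> \<alpha>" "C \<le> C'" and U: "U \<subseteq> {0..1}"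
  shows "hol \<alpha>' C' U f"
  unfolding hol_def
proof (intro conjI ballI)
  show "0 \<le> C'" using h le by (auto simp: hol_def)
  show "\<bar>f u\<bar> \<le> C'" if "u \<in> U" for u using h le that unfolding hol_def by (meson order_trans)
  fix u v assume uv: "u \<in> U" "v \<in> U"
  then have "u \<in> {0..1}" "v \<in> {0..1}" using U by auto
  then have "\<bar>u - v\<bar> \<le> 1" by auto
  then have "\<bar>u - v\<bar> powr \<alpha> \<le> \<bar>u - v\<bar> powr \<alpha>'" using le by (intro powr_mono') auto
  then have "C * \<bar>u - v\<bar> powr \<alpha> \<le> C' * \<bar>u - v\<bar> powr \<alpha>'" using h le by (intro mult_mono) (auto simp: hol_def)
  moreover have "\<bar>f u - f v\<bar> \<le> C * \<bar>u - v\<bar> powr \<alpha>" using h uv unfolding hol_def by blast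
  ultimately show "\<bar>f u - f v\<bar> \<le> C' * \<bar>u - v\<bar> powr \<alpha>'" by linarith
qed

text \<open>Finitely many functions share the smallest exponent and the largest constant; lowering
  an exponent is harmless inside the unit interval.\<close>

lemma hol_uniform:
  assumes "finite A" "\<And>z. z \<in> A \<Longrightarrow> \<exists>\<alpha> C. 0 < \<alpha> \<and> \<alpha> \<le> 1 \<and> hol \<alpha> C (U z) (f z)" "\<And>z. z \<in> A \<Longrightarrow> U z \<subseteq> {0..1}"
  shows "\<exists>\<alpha> C. 0 < \<alpha> \<and> \<alpha> \<le> 1 \<and> 0 \<le> C \<and> (\<forall>z\<in>A. hol \<alpha> C (U z) (f z))"
  using assms
proof (induction A rule: finite_induct)
  case empty
  then show ?case by (intro exI[of _ 1]) auto
next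
  case (insert z A)
  obtain \<alpha> C where 1: "0 < \<alpha>" "\<alpha> \<le> 1" "0 \<le> C" "\<And>z. z \<in> A \<Longrightarrow> hol \<alpha> C (U z) (f z)"
    using insert by auto
  obtain \<beta> D where 2: "0 < \<beta>" "\<beta> \<le> 1" "hol \<beta> D (U z) (f z)"
    using insert.prems(1)[of z] by auto
  have "hol (min \<alpha> \<beta>) (max C D) (U y) (f y)" if "y \<in> insert z A" for y
  proof (cases "y = z")
    case True then show ?thesis using 2(3) insert.prems(2)[of z] by (auto intro: hol_mono)
  next
    case False then show ?thesis using 1(4)[of y] that insert.prems(2)[of y] by (auto intro: hol_mono)
  qed
  then show ?case using 1 2 by (intro exI[of _ "min \<alpha> \<beta>"] exI[of _ "max C D"]) auto
qed

text \<open>\<open>C1plus_on\<close> contains no bound on the derivative; it follows from the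
  Hoelder condition because \<open>U\<close> has diameter at most 1. The function itself is then
  Lipschitz, as \<open>U\<close> is convex.\<close>

lemma C1plus_on_hol:
  assumes f: "C1plus_on U f" and U: "convex U" "U \<subseteq> {0..1}" "U \<noteq> {}"
  shows "\<exists>\<alpha> C. 0 < \<alpha> \<and> \<alpha> \<le> 1 \<and> hol \<alpha> C U (deriv f)"
    and "\<exists>\<alpha> C. 0 < \<alpha> \<and> \<alpha> \<le> 1 \<and> hol \<alpha> C U f"
proof -
  obtain \<alpha> C where \<alpha>: "0 < \<alpha>" "\<alpha> \<le> 1" and C: "\<And>x y. x \<in> U \<Longrightarrow> y \<in> U \<Longrightarrow> \<bar>deriv f x - deriv f y\<bar> \<le> C * \<bar>x - y\<bar> powr \<alpha>"
    using f unfolding C1plus_on_def by blast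
  obtain u0 where u0: "u0 \<in> U" using U by auto
  have le1: "\<bar>u - v\<bar> powr \<alpha> \<le> 1" if "u \<in> U" "v \<in> U" for u v
  proof -
    have "u \<in> {0..1}" "v \<in> {0..1}" using that U(2) by auto
    then have "\<bar>u - v\<bar> \<le> 1" by auto
    then have "\<bar>u - v\<bar> powr \<alpha> \<le> 1 powr \<alpha>" using \<alpha> by (intro powr_mono2) auto
    then show ?thesis by simp
  qed
  \<comment> \<open>The sign of \<open>C\<close> is unknown, hence the absolute value.\<close>
  define D where "D = \<bar>deriv f u0\<bar> + \<bar>C\<bar>"
  have D: "hol \<alpha> D U (deriv f)"
    unfolding hol_def
  proof (intro conjI ballI)
    show "0 \<le> D" by (simp add: D_def)
    fix u assume u: "u \<in> U"
    have "C * \<bar>u - u0\<bar> powr \<alpha> \<le> \<bar>C\<bar> * \<bar>u - u0\<bar> powr \<alpha>" by (intro mult_right_mono) auto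
    also have "\<dots> \<le> \<bar>C\<bar> * 1" using le1[OF u u0] by (intro mult_left_mono) auto
    finally show "\<bar>deriv f u\<bar> \<le> D" using C[OF u u0] by (simp add: D_def)
    fix v assume v: "v \<in> U"
    have "C * \<bar>u - v\<bar> powr \<alpha> \<le> D * \<bar>u - v\<bar> powr \<alpha>" by (intro mult_right_mono) (auto simp: D_def)
    then show "\<bar>deriv f u - deriv f v\<bar> \<le> D * \<bar>u - v\<bar> powr \<alpha>" using C[OF u v] by linarith
  qed
  then show "\<exists>\<alpha> C. 0 < \<alpha> \<and> \<alpha> \<le> 1 \<and> hol \<alpha> C U (deriv f)" using \<alpha> by blast
  have lip: "\<bar>f u - f v\<bar> \<le> D * \<bar>u - v\<bar>" if "u \<in> U" "v \<in> U" for u v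
  proof -
    have "norm (f u - f v) \<le> D * norm (u - v)"
    proof (rule field_differentiable_bound[OF U(1)])
      fix z assume z: "z \<in> U"
      have "(f has_field_derivative deriv f z) (at z)"
        using f z by (auto simp: C1plus_on_def DERIV_deriv_iff_real_differentiable)
      then show "(f has_field_derivative deriv f z) (at z within U)" by (rule has_field_derivative_at_within)
      show "norm (deriv f z) \<le> D" using D z by (auto simp: hol_def)
    qed (use that in auto)
    then show ?thesis by simp
  qed
  have D0: "0 \<le> D" by (simp add: D_def)
  have "hol 1 (\<bar>f u0\<bar> + D) U f"
    unfolding hol_def
  proof (intro conjI ballI)
    show "0 \<le> \<bar>f u0\<bar> + D" using D0 by simp
    fix u assume u: "u \<in> U"
    have "u \<in> {0..1}" "u0 \<in> {0..1}" using u u0 U(2) by auto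
    then have "\<bar>u - u0\<bar> \<le> 1" by auto
    then have "D * \<bar>u - u0\<bar> \<le> D * 1" using D0 by (intro mult_left_mono) auto
    then show "\<bar>f u\<bar> \<le> \<bar>f u0\<bar> + D" using lip[OF u u0] by linarith
    fix v assume v: "v \<in> U"
    have "D * \<bar>u - v\<bar> \<le> (\<bar>f u0\<bar> + D) * \<bar>u - v\<bar>" by (intro mult_right_mono) auto
    then show "\<bar>f u - f v\<bar> \<le> (\<bar>f u0\<bar> + D) * \<bar>u - v\<bar> powr 1" using lip[OF u v] by simp
  qed
  then have "0 < (1::real) \<and> (1::real) \<le> 1 \<and> hol 1 (\<bar>f u0\<bar> + D) U f" by simp
  then show "\<exists>\<alpha> C. 0 < \<alpha> \<and> \<alpha> \<le> 1 \<and> hol \<alpha> C U f" by blast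
qed

text \<open>With the weight \<open>\<epsilon>\<close> on the Hoelder seminorm the norm is submultiplicative, and products of
  functions of norm at most \<open>\<theta> < 1\<close> decay geometrically together with their Hoelder seminorms.\<close>

definition nh :: "real \<Rightarrow> real \<Rightarrow> real set \<Rightarrow> real \<Rightarrow> (real \<Rightarrow> real) \<Rightarrow> bool" where
  "nh \<epsilon> \<alpha> U k f \<longleftrightarrow> (\<exists>b h. 0 \<le> b \<and> 0 \<le> h \<and> b + \<epsilon> * h \<le> k \<and> (\<forall>u\<in>U. \<bar>f u\<bar> \<le> b) \<and>
     (\<forall>u\<in>U. \<forall>v\<in>U. \<bar>f u - f v\<bar> \<le> h * \<bar>u - v\<bar> powr \<alpha>))"

lemma nhE:
  assumes "nh \<epsilon> \<alpha> U k f"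
  obtains b h where "0 \<le> b" "0 \<le> h" "b + \<epsilon> * h \<le> k" "\<And>u. u \<in> U \<Longrightarrow> \<bar>f u\<bar> \<le> b"
    "\<And>u v. u \<in> U \<Longrightarrow> v \<in> U \<Longrightarrow> \<bar>f u - f v\<bar> \<le> h * \<bar>u - v\<bar> powr \<alpha>"
  using assms unfolding nh_def by blast

lemma nhI:
  assumes "0 \<le> b" "0 \<le> h" "b + \<epsilon> * h \<le> k" "\<And>u. u \<in> U \<Longrightarrow> \<bar>f u\<bar> \<le> b"
    "\<And>u v. u \<in> U \<Longrightarrow> v \<in> U \<Longrightarrow> \<bar>f u - f v\<bar> \<le> h * \<bar>u - v\<bar> powr \<alpha>"
  shows "nh \<epsilon> \<alpha> U k f"
  using assms unfolding nh_def by blast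

lemma nh_mono: "nh \<epsilon> \<alpha> U k f \<Longrightarrow> k \<le> k' \<Longrightarrow> nh \<epsilon> \<alpha> U k' f"
  unfolding nh_def by (meson order_trans)

lemma nh_const: "nh \<epsilon> \<alpha> U \<bar>c\<bar> (\<lambda>_. c)"
  by (rule nhI[of "\<bar>c\<bar>" 0]) auto

lemma nh_add:
  assumes "nh \<epsilon> \<alpha> U k f" "nh \<epsilon> \<alpha> U l g"
  shows "nh \<epsilon> \<alpha> U (k + l) (\<lambda>x. f x + g x)"
proof -
  obtain b h where f: "0 \<le> b" "0 \<le> h" "b + \<epsilon> * h \<le> k" "\<And>u. u \<in> U \<Longrightarrow> \<bar>f u\<bar> \<le> b"
    "\<And>u v. u \<in> U \<Longrightarrow> v \<in> U \<Longrightarrow> \<bar>f u - f v\<bar> \<le> h * \<bar>u - v\<bar> powr \<alpha>" by (rule nhE[OF assms(1)]) blast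
  obtain c j where g: "0 \<le> c" "0 \<le> j" "c + \<epsilon> * j \<le> l" "\<And>u. u \<in> U \<Longrightarrow> \<bar>g u\<bar> \<le> c"
    "\<And>u v. u \<in> U \<Longrightarrow> v \<in> U \<Longrightarrow> \<bar>g u - g v\<bar> \<le> j * \<bar>u - v\<bar> powr \<alpha>" by (rule nhE[OF assms(2)]) blast
  show ?thesis
  proof (rule nhI[of "b + c" "h + j"])
    show "\<bar>f u + g u\<bar> \<le> b + c" if "u \<in> U" for u using f(4)[OF that] g(4)[OF that] by linarith
    show "\<bar>f u + g u - (f v + g v)\<bar> \<le> (h + j) * \<bar>u - v\<bar> powr \<alpha>" if "u \<in> U" "v \<in> U" for u v
      using f(5)[OF that] g(5)[OF that] by (simp add: distrib_right)
  qed (use f g in \<open>auto simp: algebra_simps\<close>)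
qed

text \<open>The product rule gives the seminorm bound \<open>b * j + h * c\<close>; the surplus
  \<open>(\<epsilon> * h) * (\<epsilon> * j)\<close> in the product of the norms is dropped.\<close>

lemma nh_mult:
  assumes "nh \<epsilon> \<alpha> U k f" "nh \<epsilon> \<alpha> U l g" "0 \<le> \<epsilon>"
  shows "nh \<epsilon> \<alpha> U (k * l) (\<lambda>x. f x * g x)"
proof -
  obtain b h where f: "0 \<le> b" "0 \<le> h" "b + \<epsilon> * h \<le> k" "\<And>u. u \<in> U \<Longrightarrow> \<bar>f u\<bar> \<le> b"
    "\<And>u v. u \<in> U \<Longrightarrow> v \<in> U \<Longrightarrow> \<bar>f u - f v\<bar> \<le> h * \<bar>u - v\<bar> powr \<alpha>" by (rule nhE[OF assms(1)]) blast
  obtain c j where g: "0 \<le> c" "0 \<le> j" "c + \<epsilon> * j \<le> l" "\<And>u. u \<in> U \<Longrightarrow> \<bar>g u\<bar> \<le> c"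
    "\<And>u v. u \<in> U \<Longrightarrow> v \<in> U \<Longrightarrow> \<bar>g u - g v\<bar> \<le> j * \<bar>u - v\<bar> powr \<alpha>" by (rule nhE[OF assms(2)]) blast
  show ?thesis
  proof (rule nhI[of "b * c" "b * j + h * c"])
    show "\<bar>f u * g u\<bar> \<le> b * c" if "u \<in> U" for u
      unfolding abs_mult using f(4)[OF that] g(4)[OF that] f(1) by (intro mult_mono) auto
    show "\<bar>f u * g u - f v * g v\<bar> \<le> (b * j + h * c) * \<bar>u - v\<bar> powr \<alpha>" if "u \<in> U" "v \<in> U" for u v
    proof -
      have "\<bar>f u * g u - f v * g v\<bar> = \<bar>f u * (g u - g v) + (f u - f v) * g v\<bar>" by (simp add: algebra_simps)
      also have "\<dots> \<le> \<bar>f u\<bar> * \<bar>g u - g v\<bar> + \<bar>f u - f v\<bar> * \<bar>g v\<bar>"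
        unfolding abs_mult[symmetric] by (rule abs_triangle_ineq)
      also have "\<dots> \<le> b * (j * \<bar>u - v\<bar> powr \<alpha>) + (h * \<bar>u - v\<bar> powr \<alpha>) * c"
        using f(4)[OF that(1)] f(5)[OF that] g(4)[OF that(2)] g(5)[OF that] f(1,2)
        by (intro add_mono mult_mono) auto
      finally show ?thesis by (simp add: algebra_simps)
    qed
    have "(b + \<epsilon> * h) * (c + \<epsilon> * j) \<le> k * l"
      using f g \<open>0 \<le> \<epsilon>\<close> by (intro mult_mono) (auto intro: order_trans[of 0 "b + \<epsilon> * h"])
    moreover have "0 \<le> (\<epsilon> * h) * (\<epsilon> * j)" using f g \<open>0 \<le> \<epsilon>\<close> by (intro mult_nonneg_nonneg) auto
    ultimately show "b * c + \<epsilon> * (b * j + h * c) \<le> k * l" by (simp add: algebra_simps)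
  qed (use f g in auto)
qed

lemma nh_compose:
  assumes "nh \<epsilon> \<alpha> U k f" and p: "\<And>v. v \<in> V \<Longrightarrow> p v \<in> U" "\<And>u v. u \<in> V \<Longrightarrow> v \<in> V \<Longrightarrow> \<bar>p u - p v\<bar> \<le> \<bar>u - v\<bar>"
    and "0 \<le> \<alpha>"
  shows "nh \<epsilon> \<alpha> V k (\<lambda>x. f (p x))"
proof -
  obtain b h where f: "0 \<le> b" "0 \<le> h" "b + \<epsilon> * h \<le> k" "\<And>u. u \<in> U \<Longrightarrow> \<bar>f u\<bar> \<le> b"
    "\<And>u v. u \<in> U \<Longrightarrow> v \<in> U \<Longrightarrow> \<bar>f u - f v\<bar> \<le> h * \<bar>u - v\<bar> powr \<alpha>" by (rule nhE[OF assms(1)]) blast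
  show ?thesis
  proof (rule nhI[of b h])
    fix u v assume uv: "u \<in> V" "v \<in> V"
    have "h * \<bar>p u - p v\<bar> powr \<alpha> \<le> h * \<bar>u - v\<bar> powr \<alpha>"
      using p(2)[OF uv] f(2) \<open>0 \<le> \<alpha>\<close> by (intro mult_left_mono powr_mono2) auto
    then show "\<bar>f (p u) - f (p v)\<bar> \<le> h * \<bar>u - v\<bar> powr \<alpha>"
      using f(5)[OF p(1)[OF uv(1)] p(1)[OF uv(2)]] by linarith
  qed (use f p(1) in auto)
qed

lemma nh_cong: "nh \<epsilon> \<alpha> U k f \<Longrightarrow> (\<And>u. u \<in> U \<Longrightarrow> f u = g u) \<Longrightarrow> nh \<epsilon> \<alpha> U k g"
  unfolding nh_def by (metis (no_types, lifting))

lemma hol_nh: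
  assumes "hol \<alpha> C U f" "0 \<le> \<epsilon>" "0 \<le> b" "\<And>u. u \<in> U \<Longrightarrow> \<bar>f u\<bar> \<le> b" "b + \<epsilon> * C \<le> k"
  shows "nh \<epsilon> \<alpha> U k f"
  using assms by (intro nhI[of b C]) (auto simp: hol_def)

lemma nhD:
  assumes "nh \<epsilon> \<alpha> U k f" "0 < \<epsilon>"
  shows "u \<in> U \<Longrightarrow> \<bar>f u\<bar> \<le> k" "u \<in> U \<Longrightarrow> v \<in> U \<Longrightarrow> \<bar>f u - f v\<bar> \<le> k / \<epsilon> * \<bar>u - v\<bar> powr \<alpha>" "0 \<le> k"
proof -
  obtain b h where f: "0 \<le> b" "0 \<le> h" "b + \<epsilon> * h \<le> k" "\<And>u. u \<in> U \<Longrightarrow> \<bar>f u\<bar> \<le> b"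
    "\<And>u v. u \<in> U \<Longrightarrow> v \<in> U \<Longrightarrow> \<bar>f u - f v\<bar> \<le> h * \<bar>u - v\<bar> powr \<alpha>" by (rule nhE[OF assms(1)]) blast
  have eh: "0 \<le> \<epsilon> * h" using f assms by auto
  show "0 \<le> k" using f eh by linarith
  show "\<bar>f u\<bar> \<le> k" if "u \<in> U" using f(3) f(4)[OF that] eh by linarith
  show "\<bar>f u - f v\<bar> \<le> k / \<epsilon> * \<bar>u - v\<bar> powr \<alpha>" if "u \<in> U" "v \<in> U"
  proof -
    have "h \<le> k / \<epsilon>" using f(1,3) assms(2) by (simp add: field_simps)
    then have "h * \<bar>u - v\<bar> powr \<alpha> \<le> k / \<epsilon> * \<bar>u - v\<bar> powr \<alpha>" by (intro mult_right_mono) auto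
    then show ?thesis using f(5)[OF that] by linarith
  qed
qed

lemma at_within_01_nontrivial: "x \<in> {0..1::real} \<Longrightarrow> at x within {0<..<1} \<noteq> bot"
proof -
  assume x: "x \<in> {0..1}"
  have "x islimpt {0<..<1}"
    using x islimpt_greaterThanLessThan1[of 0 "1::real"] islimpt_greaterThanLessThan2[of 0 "1::real"]
      interior_limit_point[of x "{0<..<1}"]
    by (cases "x = 0"; cases "x = 1") auto
  then show ?thesis by (simp add: trivial_limit_within)
qed

text \<open>\<open>int_lim\<close> is built on \<open>Lim\<close>, which is meaningful only if the
  limit exists. A Hoelder bound makes \<open>f\<close> uniformly continuous, so it extends to the
  closed interval.\<close>

lemma int_lim_tendsto:
  assumes f: "nh \<epsilon> \<alpha> {0<..<1} k f" and \<epsilon>: "0 < \<epsilon>" and \<alpha>: "0 < \<alpha>" and x: "x \<in> {0..1}"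
  shows "(f \<longlongrightarrow> int_lim f x) (at x within {0<..<1})"
proof -
  have "uniformly_continuous_on {0<..<1} f"
    unfolding uniformly_continuous_on_def
  proof (intro allI impI)
    fix e :: real assume e: "e > 0"
    \<comment> \<open>Solves \<open>(k / \<epsilon> + 1) * d powr \<alpha> = e\<close>; the 1 keeps
      the divisor positive when \<open>k = 0\<close>.\<close>
    define d where "d = (e / (k / \<epsilon> + 1)) powr (1 / \<alpha>)"
    have k: "k / \<epsilon> + 1 > 0" using nhD(3)[OF f \<epsilon>] \<epsilon> by (intro add_nonneg_pos) auto
    have d: "d > 0" using e k by (simp add: d_def)
    have "dist (f v) (f u) < e" if "u \<in> {0<..<1}" "v \<in> {0<..<1}" "dist v u < d" for u v
    proof -
      have "\<bar>v - u\<bar> powr \<alpha> < d powr \<alpha>" using that(3) \<alpha> by (intro powr_less_mono2) (auto simp: dist_real_def)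
      also have "d powr \<alpha> = e / (k / \<epsilon> + 1)" using e k \<alpha> by (simp add: d_def powr_powr)
      finally have "(k / \<epsilon> + 1) * \<bar>v - u\<bar> powr \<alpha> < e" using k by (simp add: pos_less_divide_eq mult.commute)
      moreover have "k / \<epsilon> * \<bar>v - u\<bar> powr \<alpha> \<le> (k / \<epsilon> + 1) * \<bar>v - u\<bar> powr \<alpha>" by (intro mult_right_mono) auto
      ultimately show ?thesis using nhD(2)[OF f \<epsilon> that(2,1)] by (simp add: dist_real_def)
    qed
    then show "\<exists>d>0. \<forall>x\<in>{0<..<1}. \<forall>x'\<in>{0<..<1}. dist x' x < d \<longrightarrow> dist (f x') (f x) < e" using d by blast
  qed
  note uc = this
  show ?thesis
  proof (cases "x \<in> {0<..<1}")
    case True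
    then show ?thesis using uniformly_continuous_imp_continuous[OF uc] by (simp add: int_lim_def continuous_on_def)
  next
    case False
    have "x \<in> closure {0<..<1}" using x by simp
    then obtain l where l: "(f \<longlongrightarrow> l) (at x within {0<..<1})"
      using uniformly_continuous_on_extension_at_closure[OF uc] by blast
    then have "Lim (at x within {0<..<1}) f = l" using at_within_01_nontrivial[OF x] by (intro tendsto_Lim) auto
    then show ?thesis using l False by (auto simp: int_lim_def)
  qed
qed

text \<open>Non-strict bounds survive limits; the two variables are moved to the boundary one after
  the other.\<close>

lemma nh_int_lim:
  assumes f: "nh \<epsilon> \<alpha> {0<..<1} k f" and \<epsilon>: "0 < \<epsilon>" and \<alpha>: "0 < \<alpha>"
  shows "nh \<epsilon> \<alpha> {0..1} k (int_lim f)"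
proof -
  obtain b h where b: "0 \<le> b" "0 \<le> h" "b + \<epsilon> * h \<le> k" "\<And>u. u \<in> {0<..<1} \<Longrightarrow> \<bar>f u\<bar> \<le> b"
    "\<And>u v. u \<in> {0<..<1} \<Longrightarrow> v \<in> {0<..<1} \<Longrightarrow> \<bar>f u - f v\<bar> \<le> h * \<bar>u - v\<bar> powr \<alpha>" by (rule nhE[OF f]) blast
  note lim = int_lim_tendsto[OF f \<epsilon> \<alpha>] and nt = at_within_01_nontrivial
  have ev: "\<forall>\<^sub>F u in at x within {0<..<1}. u \<in> {0<..<1}" for x :: real
    by (auto simp: eventually_at_filter)
  have pw: "((\<lambda>u. h * \<bar>u - v\<bar> powr \<alpha>) \<longlongrightarrow> h * \<bar>x - v\<bar> powr \<alpha>) (at x within {0<..<1})" for x v :: real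
    using \<alpha> by (intro tendsto_mult tendsto_const tendsto_powr2 tendsto_rabs tendsto_diff tendsto_ident_at) auto
  show ?thesis
  proof (rule nhI[OF b(1,2,3)])
    fix x :: real assume x: "x \<in> {0..1}"
    show "\<bar>int_lim f x\<bar> \<le> b"
      by (rule tendsto_upperbound[OF tendsto_rabs[OF lim[OF x]] _ nt[OF x]])
        (rule eventually_mono[OF ev b(4)])
    have 1: "\<bar>int_lim f x - f v\<bar> \<le> h * \<bar>x - v\<bar> powr \<alpha>" if "v \<in> {0<..<1}" for v
      by (rule tendsto_le[OF nt[OF x] pw tendsto_rabs[OF tendsto_diff[OF lim[OF x] tendsto_const]]])
        (rule eventually_mono[OF ev], rule b(5)[OF _ that])
    fix y :: real assume y: "y \<in> {0..1}"
    have "\<bar>int_lim f y - int_lim f x\<bar> \<le> h * \<bar>y - x\<bar> powr \<alpha>"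
      by (rule tendsto_le[OF nt[OF y] pw tendsto_rabs[OF tendsto_diff[OF lim[OF y] tendsto_const]]])
        (rule eventually_mono[OF ev], use 1 in \<open>simp add: abs_minus_commute\<close>)
    then show "\<bar>int_lim f x - int_lim f y\<bar> \<le> h * \<bar>x - y\<bar> powr \<alpha>" by (simp add: abs_minus_commute)
  qed
qed

section \<open>Inverse branches of the system and their uniform Hoelder control\<close>

locale weierstrass =
  fixes S :: wsystem
  assumes sys: "weierstrass_system S"
begin

abbreviation ips :: "nat \<Rightarrow> real set" where "ips i \<equiv> interior (piece S i)"

lemma piece_interval: "i < branches S \<Longrightarrow> is_interval (piece S i)"
  and piece_disjoint: "i < branches S \<Longrightarrow> j < branches S \<Longrightarrow> x \<in> piece S i \<Longrightarrow> x \<in> piece S j \<Longrightarrow> i = j"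
  and piece_cover: "(\<Union>i<branches S. piece S i) = {0..1}"
  and tau_range: "x \<in> {0..1} \<Longrightarrow> tau S x \<in> {0..1}"
  and lam_range: "x \<in> {0..1} \<Longrightarrow> lam S x \<in> {0<..<1}"
  and tau_bij: "i < branches S \<Longrightarrow> bij_betw (tau S) (ips i) {0<..<1}"
  and tau_C1: "i < branches S \<Longrightarrow> C1plus_on (ips i) (tau S)"
  and lam_C1: "i < branches S \<Longrightarrow> C1plus_on (ips i) (lam S)"
  and gen_C1: "i < branches S \<Longrightarrow> C1plus_on (ips i) (gen S)"
  and tau_cont: "i < branches S \<Longrightarrow> continuous_on (piece S i) (tau S)"
  and lam_cont: "i < branches S \<Longrightarrow> continuous_on (piece S i) (lam S)"
  and gen_cont: "i < branches S \<Longrightarrow> continuous_on (piece S i) (gen S)"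
  and tau_expand: "\<exists>c>1. \<forall>i<branches S. \<forall>x\<in>ips i. c \<le> deriv (tau S) x"
  and lam_contract: "\<exists>c<1. \<forall>x\<in>{0..1}. lam S x \<le> c"
  and lam_tau: "\<exists>c>1. \<forall>i<branches S. \<forall>x\<in>ips i. c \<le> lam S x * deriv (tau S) x"
  using sys unfolding weierstrass_system_def C1plus_diffeo_def disjoint_family_on_def by (blast | fast)+

lemma piece_sub: "i < branches S \<Longrightarrow> piece S i \<subseteq> {0..1}"
  using piece_cover by blast

lemma ips_sub: "i < branches S \<Longrightarrow> ips i \<subseteq> {0<..<1}"
  using interior_mono[OF piece_sub[of i]] by simp

lemma ips_ne: "i < branches S \<Longrightarrow> ips i \<noteq> {}"
  using tau_bij[of i] by (auto simp: bij_betw_def)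

lemma ips_convex: "i < branches S \<Longrightarrow> convex (ips i)"
  using piece_interval[of i] by (simp add: is_interval_convex_1 convex_interior)

lemma ips_between: "i < branches S \<Longrightarrow> x \<in> ips i \<Longrightarrow> y \<in> ips i \<Longrightarrow> x \<le> z \<Longrightarrow> z \<le> y \<Longrightarrow> z \<in> ips i"
  using ips_convex[of i] by (meson is_interval_1 is_interval_convex_1)

lemma ips_deriv:
  assumes "C1plus_on (ips i) f" "x \<in> ips i"
  shows "(f has_real_derivative deriv f x) (at x)"
  using assms by (auto simp: C1plus_on_def DERIV_deriv_iff_real_differentiable)

text \<open>The mean value theorem integrates the lower bound on the derivative. In particular every
  branch is increasing.\<close>

lemma tau_expand_ips:
  obtains c where "c > 1"
    "\<And>i x y. i < branches S \<Longrightarrow> x \<in> ips i \<Longrightarrow> y \<in> ips i \<Longrightarrow> x \<le> y \<Longrightarrow> c * (y - x) \<le> tau S y - tau S x"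
proof -
  obtain c where c: "c > 1" "\<And>i x. i < branches S \<Longrightarrow> x \<in> ips i \<Longrightarrow> c \<le> deriv (tau S) x"
    using tau_expand by blast
  have "c * (y - x) \<le> tau S y - tau S x" if h: "i < branches S" "x \<in> ips i" "y \<in> ips i" "x \<le> y" for i x y
  proof (cases "x = y")
    case False
    then have "x < y" using h by simp
    moreover have "(tau S has_real_derivative deriv (tau S) z) (at z)" if "x \<le> z" "z \<le> y" for z
      by (rule ips_deriv[OF tau_C1[OF h(1)] ips_between[OF h(1,2,3) that]])
    ultimately obtain z where z: "z > x" "z < y" "tau S y - tau S x = (y - x) * deriv (tau S) z"
      using MVT2[of x y "tau S" "deriv (tau S)"] by blast
    have "c \<le> deriv (tau S) z" using z h by (intro c(2)[OF h(1)] ips_between[of i x y z]) auto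
    from mult_left_mono[OF this, of "y - x"] show ?thesis using z(3) h(4) by (simp add: mult.commute)
  qed simp
  then show ?thesis using c(1) that by blast
qed

lemma rho_interior:
  assumes "i < branches S" "u \<in> {0<..<1}"
  shows "rho S i u \<in> ips i" "tau S (rho S i u) = u"
proof -
  have inj: "inj_on (tau S) (ips i)" and im: "tau S ` ips i = {0<..<1}"
    using tau_bij[OF assms(1)] by (auto simp: bij_betw_def)
  have "rho S i u = the_inv_into (ips i) (tau S) u" using assms(2) by (simp add: rho_def int_lim_def)
  then show "rho S i u \<in> ips i" "tau S (rho S i u) = u"
    using the_inv_into_into[OF inj _ order_refl, of u] f_the_inv_into_f[OF inj, of u] im assms(2) by auto
qed

lemma rho_range: "i < branches S \<Longrightarrow> u \<in> {0<..<1} \<Longrightarrow> rho S i u \<in> {0<..<1}"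
  using rho_interior(1) ips_sub by blast

lemma rho_contract:
  assumes "i < branches S" "u \<in> {0<..<1}" "v \<in> {0<..<1}"
  shows "\<bar>rho S i u - rho S i v\<bar> \<le> \<bar>u - v\<bar>"
proof -
  obtain c where c: "c > 1"
    "\<And>i x y. i < branches S \<Longrightarrow> x \<in> ips i \<Longrightarrow> y \<in> ips i \<Longrightarrow> x \<le> y \<Longrightarrow> c * (y - x) \<le> tau S y - tau S x"
    using tau_expand_ips by blast
  have *: "rho S i v - rho S i u \<le> \<bar>u - v\<bar>"
    if uv: "u \<in> {0<..<1}" "v \<in> {0<..<1}" "rho S i u \<le> rho S i v" for u v
  proof -
    have "1 * (rho S i v - rho S i u) \<le> c * (rho S i v - rho S i u)" using c(1) uv(3) by (intro mult_right_mono) auto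
    also have "\<dots> \<le> v - u"
      using c(2)[OF assms(1) rho_interior(1)[OF assms(1) uv(1)] rho_interior(1)[OF assms(1) uv(2)] uv(3)]
      by (simp add: rho_interior(2)[OF assms(1) uv(1)] rho_interior(2)[OF assms(1) uv(2)])
    finally show ?thesis by auto
  qed
  show ?thesis using *[OF assms(2,3)] *[OF assms(3,2)] by linarith
qed

lemma rho_word_Nil[simp]: "rho_word S [] u = u"
  and rho_word_snoc[simp]: "rho_word S (w @ [i]) u = rho S i (rho_word S w u)"
  by (auto simp: rho_word_def)

definition valid :: "nat list \<Rightarrow> bool" where "valid w \<longleftrightarrow> set w \<subseteq> {..<branches S}"

lemma valid_simps[simp]: "valid []" "valid (w @ w') \<longleftrightarrow> valid w \<and> valid w'" "valid (i # w) \<longleftrightarrow> i < branches S \<and> valid w"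
  by (auto simp: valid_def)

lemma rho_word_range: "valid w \<Longrightarrow> u \<in> {0<..<1} \<Longrightarrow> rho_word S w u \<in> {0<..<1}"
  by (induction w rule: rev_induct) (auto simp del: greaterThanLessThan_iff intro: rho_range)

lemma rho_word_contract:
  assumes "valid w" "u \<in> {0<..<1}" "v \<in> {0<..<1}"
  shows "\<bar>rho_word S w u - rho_word S w v\<bar> \<le> \<bar>u - v\<bar>"
  using assms
proof (induction w rule: rev_induct)
  case (snoc i w)
  then have "\<bar>rho_word S (w @ [i]) u - rho_word S (w @ [i]) v\<bar> \<le> \<bar>rho_word S w u - rho_word S w v\<bar>"
    by (auto simp del: greaterThanLessThan_iff intro: rho_contract rho_word_range)
  with snoc show ?case by auto
qed simp

lemma rho_word_snoc_interior:
  assumes "valid (w @ [i])" "u \<in> {0<..<1}"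
  shows "rho_word S (w @ [i]) u \<in> ips i" "tau S (rho_word S (w @ [i]) u) = rho_word S w u"
  using assms rho_interior[of i "rho_word S w u"] rho_word_range[of w u] by auto

lemma cocycle_0[simp]: "cocycle S \<phi> 0 x = 1"
  and cocycle_Suc: "cocycle S \<phi> (Suc n) x = \<phi> x * cocycle S \<phi> n (tau S x)"
  unfolding cocycle_def by (auto simp: prod.lessThan_Suc_shift funpow_swap1 simp del: prod.lessThan_Suc)

lemma W_part_0[simp]: "W_part S 0 x = 0"
  and W_part_Suc: "W_part S (Suc n) x = gen S x + lam S x * W_part S n (tau S x)"
  unfolding W_part_def
  by (auto simp: sum.lessThan_Suc_shift cocycle_Suc funpow_swap1 sum_distrib_left mult.assoc simp del: sum.lessThan_Suc)

text \<open>The functions multiplied along orbits, \<open>gam\<close> and \<open>lam\<close>,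
  receive a norm \<open>\<theta> < 1\<close>; those evaluated once per term only need some finite
  \<open>K\<close>. All share the weight \<open>\<epsilon>\<close> and the exponent
  \<open>\<alpha>\<close>.\<close>

definition unif :: "real \<Rightarrow> real \<Rightarrow> real \<Rightarrow> real \<Rightarrow> bool" where
  "unif \<alpha> \<epsilon> \<theta> K \<longleftrightarrow> 0 < \<alpha> \<and> \<alpha> \<le> 1 \<and> 0 < \<epsilon> \<and> 0 < \<theta> \<and> \<theta> < 1 \<and> 0 \<le> K \<and> (\<forall>i<branches S.
     nh \<epsilon> \<alpha> (ips i) \<theta> (gam S) \<and> nh \<epsilon> \<alpha> (ips i) \<theta> (lam S) \<and> nh \<epsilon> \<alpha> (ips i) K (gen S) \<and>
     nh \<epsilon> \<alpha> (ips i) K (deriv (lam S)) \<and> nh \<epsilon> \<alpha> (ips i) K (deriv (gen S)))"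

text \<open>The uniform hypotheses on \<open>lam S\<close> and on
  \<open>lam S * deriv (tau S)\<close> bound the sup norms of \<open>lam\<close> and
  \<open>gam\<close> by some \<open>m < 1\<close>; a small weight on the Hoelder seminorms then
  keeps the full norms below 1.\<close>

lemma unif_exists: "\<exists>\<alpha> \<epsilon> \<theta> K. unif \<alpha> \<epsilon> \<theta> K"
proof -
  define A where "A = {..<branches S} \<times> {deriv (tau S), deriv (lam S), deriv (gen S), lam S, gen S}"
  have "\<exists>\<alpha> C. 0 < \<alpha> \<and> \<alpha> \<le> 1 \<and> 0 \<le> C \<and> (\<forall>z\<in>A. hol \<alpha> C (ips (fst z)) (snd z))"
  proof (rule hol_uniform)
    fix z assume "z \<in> A"
    then obtain i f where z: "z = (i, f)" "i < branches S" "f \<in> {deriv (tau S), deriv (lam S), deriv (gen S), lam S, gen S}"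
      by (auto simp: A_def)
    have U: "convex (ips i)" "ips i \<subseteq> {0..1}" "ips i \<noteq> {}"
      using ips_convex ips_ne ips_sub[OF z(2)] z(2) by auto
    note C = C1plus_on_hol[OF tau_C1[OF z(2)] U] C1plus_on_hol[OF lam_C1[OF z(2)] U] C1plus_on_hol[OF gen_C1[OF z(2)] U]
    show "\<exists>\<alpha> C. 0 < \<alpha> \<and> \<alpha> \<le> 1 \<and> hol \<alpha> C (ips (fst z)) (snd z)"
      using C z by auto
    show "ips (fst z) \<subseteq> {0..1}" using U z by simp
  qed (simp add: A_def)
  then obtain \<alpha> C where \<alpha>: "0 < \<alpha>" "\<alpha> \<le> 1" "0 \<le> C" and H: "\<And>i f. (i, f) \<in> A \<Longrightarrow> hol \<alpha> C (ips i) f"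
    by force
  obtain cl where cl: "cl < 1" "\<And>x. x \<in> {0..1} \<Longrightarrow> lam S x \<le> cl" using lam_contract by blast
  obtain cg where cg: "1 < cg" "\<And>i x. i < branches S \<Longrightarrow> x \<in> ips i \<Longrightarrow> cg \<le> lam S x * deriv (tau S) x"
    using lam_tau by blast
  define m where "m = max (1/2) (max cl (1 / cg))"
  have m: "0 < m" "m < 1" "cl \<le> m" "1 / cg \<le> m" using cl cg by (auto simp: m_def)
  define \<theta> where "\<theta> = (1 + m) / 2"
  define C' where "C' = C + 2 * C * C + 1"
  have C': "C \<le> C'" "2 * C * C \<le> C'" "0 < C'" using \<alpha>(3) by (auto simp: C'_def intro!: add_nonneg_pos)
  \<comment> \<open>Half of the gap between \<open>m\<close> and 1 is given to the seminorms;
    \<open>C'\<close> dominates those of \<open>lam\<close> and \<open>gam\<close>.\<close>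
  define \<epsilon> where "\<epsilon> = (1 - m) / (2 * C')"
  have \<epsilon>: "0 < \<epsilon>" "m + \<epsilon> * C' = \<theta>" using m C' by (auto simp: \<epsilon>_def \<theta>_def field_simps)
  have \<epsilon>C: "m + \<epsilon> * C \<le> \<theta>" "m + \<epsilon> * (2 * C * C) \<le> \<theta>"
    unfolding \<epsilon>(2)[symmetric] using C' \<epsilon>(1) by (intro add_left_mono mult_left_mono; simp)+
  have "unif \<alpha> \<epsilon> \<theta> (C + \<epsilon> * C)"
    unfolding unif_def
  proof (intro conjI allI impI)
    fix i assume i: "i < branches S"
    have in01: "x \<in> {0..1}" if "x \<in> ips i" for x using ips_sub[OF i] that by auto
    have Hi: "hol \<alpha> C (ips i) f" if "f \<in> {deriv (tau S), deriv (lam S), deriv (gen S), lam S, gen S}" for f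
      using H[of i f] that i by (simp add: A_def)
    show "nh \<epsilon> \<alpha> (ips i) \<theta> (lam S)"
    proof (rule hol_nh[of \<alpha> C _ _ _ m])
      show "\<bar>lam S u\<bar> \<le> m" if "u \<in> ips i" for u
        using lam_range[OF in01[OF that]] cl(2)[OF in01[OF that]] m by auto
    qed (use Hi m \<epsilon> \<epsilon>C in auto)
    have b: "\<bar>f u\<bar> \<le> C" if "u \<in> ips i" "f \<in> {deriv (tau S), deriv (lam S), deriv (gen S), lam S, gen S}" for f u
      using Hi[OF that(2)] that(1) unfolding hol_def by blast
    show "nh \<epsilon> \<alpha> (ips i) (C + \<epsilon> * C) (gen S)" "nh \<epsilon> \<alpha> (ips i) (C + \<epsilon> * C) (deriv (lam S))"
      "nh \<epsilon> \<alpha> (ips i) (C + \<epsilon> * C) (deriv (gen S))"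
      using Hi \<epsilon> \<alpha> b by (auto intro!: hol_nh[of \<alpha> C _ _ _ C])
    show "nh \<epsilon> \<alpha> (ips i) \<theta> (gam S)"
    proof (rule nhI[of m "2 * C * C"])
      let ?p = "\<lambda>u. deriv (tau S) u * lam S u"
      have p: "cg \<le> ?p u" if "u \<in> ips i" for u using cg(2)[OF i that] by (simp add: mult.commute)
      show "\<bar>gam S u\<bar> \<le> m" if "u \<in> ips i" for u
      proof -
        have "1 / ?p u \<le> 1 / cg" using p[OF that] cg(1) by (intro divide_left_mono) auto
        moreover have "0 < ?p u" using p[OF that] cg(1) by linarith
        ultimately show ?thesis using m(4) by (simp add: gam_def)
      qed
      show "\<bar>gam S u - gam S v\<bar> \<le> 2 * C * C * \<bar>u - v\<bar> powr \<alpha>" if uv: "u \<in> ips i" "v \<in> ips i" for u v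
      proof -
        \<comment> \<open>The denominators are at least 1, so taking reciprocals does not enlarge
          differences.\<close>
        have p1: "1 \<le> ?p u" "1 \<le> ?p v" using p uv cg(1) by force+
        have "1 * 1 \<le> ?p u * ?p v" using p1 by (intro mult_mono) auto
        have "gam S u - gam S v = (?p v - ?p u) / (?p u * ?p v)"
        proof -
          have "?p u \<noteq> 0" "?p v \<noteq> 0" using p1 by auto
          then show ?thesis unfolding gam_def by (subst diff_frac_eq) auto
        qed
        also have "\<bar>\<dots>\<bar> = \<bar>?p v - ?p u\<bar> / (?p u * ?p v)"
          unfolding abs_divide using \<open>1 * 1 \<le> ?p u * ?p v\<close> by simp
        also have "\<dots> \<le> \<bar>?p v - ?p u\<bar> / 1"
          using \<open>1 * 1 \<le> ?p u * ?p v\<close> by (intro divide_left_mono) auto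
        also have "\<bar>?p v - ?p u\<bar> = \<bar>deriv (tau S) u * (lam S u - lam S v) + (deriv (tau S) u - deriv (tau S) v) * lam S v\<bar>"
          by (simp add: algebra_simps abs_minus_commute)
        also have "\<dots> / 1 \<le> \<bar>deriv (tau S) u\<bar> * \<bar>lam S u - lam S v\<bar> + \<bar>deriv (tau S) u - deriv (tau S) v\<bar> * \<bar>lam S v\<bar>"
          unfolding abs_mult[symmetric] by (simp add: abs_triangle_ineq)
        also have "\<dots> \<le> C * (C * \<bar>u - v\<bar> powr \<alpha>) + (C * \<bar>u - v\<bar> powr \<alpha>) * C"
        proof -
          have "\<bar>lam S u - lam S v\<bar> \<le> C * \<bar>u - v\<bar> powr \<alpha>" "\<bar>deriv (tau S) u - deriv (tau S) v\<bar> \<le> C * \<bar>u - v\<bar> powr \<alpha>"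
            using Hi[of "lam S"] Hi[of "deriv (tau S)"] uv unfolding hol_def by blast+
          then show ?thesis using b[OF uv(1), of "deriv (tau S)"] b[OF uv(2), of "lam S"] \<alpha>(3)
            by (intro add_mono mult_mono) auto
        qed
        finally show ?thesis by (simp add: algebra_simps)
      qed
    qed (use m \<alpha> \<epsilon>C in auto)
  qed (use \<alpha> \<epsilon> m in \<open>auto simp: \<theta>_def\<close>)
  then show ?thesis by blast
qed

lemma nh_rho_word:
  assumes "nh \<epsilon> \<alpha> (ips i) k f" "valid (w @ [i])" "0 \<le> \<alpha>"
  shows "nh \<epsilon> \<alpha> {0<..<1} k (\<lambda>u. f (rho_word S (w @ [i]) u))"
  using assms rho_word_snoc_interior(1)[of w i] rho_word_contract[of "w @ [i]"]
  by (intro nh_compose[OF assms(1)]) auto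

text \<open>At \<open>rho_word S w u\<close> each factor of the cocycle is \<open>f\<close> composed
  with the inverse branch of a prefix of \<open>w\<close>. These branches are contractions, so each
  factor has norm at most \<open>\<theta>\<close> as a function of \<open>u\<close>.\<close>

lemma nh_cocycle:
  assumes f: "\<And>i. i < branches S \<Longrightarrow> nh \<epsilon> \<alpha> (ips i) \<theta> f" and w: "valid w" and "0 \<le> \<alpha>" "0 \<le> \<epsilon>"
  shows "nh \<epsilon> \<alpha> {0<..<1} (\<theta> ^ length w) (\<lambda>u. cocycle S f (length w) (rho_word S w u))"
  using w
proof (induction w rule: rev_induct)
  case Nil
  then show ?case using nh_const[of \<epsilon> \<alpha> _ 1] by simp
next
  case (snoc i w)
  have "nh \<epsilon> \<alpha> {0<..<1} (\<theta> * \<theta> ^ length w)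
      (\<lambda>u. f (rho_word S (w @ [i]) u) * cocycle S f (length w) (rho_word S w u))"
    using snoc assms by (intro nh_mult nh_rho_word f) auto
  then show ?case
    using rho_word_snoc_interior(2)[OF snoc.prems]
    by (auto simp: cocycle_Suc simp del: rho_word_snoc intro: nh_cong)
qed

text \<open>\<open>K / (1 - \<theta>)\<close> solves \<open>k = K + \<theta> * k\<close>, the
  recursion of the norm when a letter is added.\<close>

lemma nh_W_part:
  assumes u: "unif \<alpha> \<epsilon> \<theta> K" and w: "valid w"
  shows "nh \<epsilon> \<alpha> {0<..<1} (K / (1 - \<theta>)) (\<lambda>u. W_part S (length w) (rho_word S w u))"
  using w
proof (induction w rule: rev_induct)
  case Nil
  have "0 \<le> K / (1 - \<theta>)" using u by (auto simp: unif_def)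
  then show ?case using nh_const[of \<epsilon> \<alpha> _ 0] by (auto intro: nh_mono)
next
  case (snoc i w)
  have "nh \<epsilon> \<alpha> {0<..<1} (K + \<theta> * (K / (1 - \<theta>)))
      (\<lambda>u. gen S (rho_word S (w @ [i]) u) + lam S (rho_word S (w @ [i]) u) * W_part S (length w) (rho_word S w u))"
    using snoc u by (intro nh_add nh_mult nh_rho_word) (auto simp: unif_def)
  moreover have "K + \<theta> * (K / (1 - \<theta>)) = K / (1 - \<theta>)" using u by (simp add: unif_def field_simps)
  ultimately show ?case
    using rho_word_snoc_interior(2)[OF snoc.prems]
    by (auto simp: W_part_Suc simp del: rho_word_snoc intro: nh_cong)
qed

lemma letter:
  assumes "x \<in> {0..1}"
  shows "letter S x < branches S" "x \<in> piece S (letter S x)"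
proof -
  have "\<exists>!i. i < branches S \<and> x \<in> piece S i" using assms piece_cover piece_disjoint by blast
  from theI'[OF this] show "letter S x < branches S" "x \<in> piece S (letter S x)" by (auto simp: letter_def)
qed

lemma letter_eq: "i < branches S \<Longrightarrow> x \<in> piece S i \<Longrightarrow> letter S x = i"
  using letter[of x] piece_sub[of i] piece_disjoint by blast

lemma funpow_tau_range: "x \<in> {0..1} \<Longrightarrow> (tau S ^^ j) x \<in> {0..1}"
  by (induction j) (auto simp del: atLeastAtMost_iff intro: tau_range)

lemma length_itin[simp]: "length (itin S n x) = n"
  by (simp add: itin_def)

lemma valid_itin: "x \<in> {0..1} \<Longrightarrow> valid (itin S n x)"
  using funpow_tau_range letter(1) by (auto simp: valid_def itin_def simp del: atLeastAtMost_iff)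

lemma itin_snoc: "itin S (Suc n) x = itin S n x @ [letter S ((tau S ^^ n) x)]"
  by (simp add: itin_def)

lemma itin_0[simp]: "itin S 0 x = []"
  by (simp add: itin_def)

lemma itin_Suc: "itin S (Suc n) x = letter S x # itin S n (tau S x)"
  by (rule nth_equalityI) (auto simp: itin_def nth_Cons funpow_swap1 simp del: upt_Suc split: nat.split)

lemma itin_take: "m \<le> n \<Longrightarrow> itin S m x = take m (itin S n x)"
  by (simp add: itin_def take_map take_upt)


text \<open>A piece is an interval with non-empty interior, so each of its points, end points
  included, is a limit of interior points. Bounds known on interiors pass to the whole piece in this
  way.\<close>

lemma piece_within:
  fixes f :: "real \<Rightarrow> real"
  assumes i: "i < branches S" and x: "x \<in> piece S i"
  shows "at x within ips i \<noteq> bot" "continuous_on (piece S i) f \<Longrightarrow> (f \<longlongrightarrow> f x) (at x within ips i)"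
proof -
  have "closure (ips i) = closure (piece S i)"
    using ips_ne[OF i] piece_interval[OF i] by (intro convex_closure_interior) (auto simp: is_interval_convex_1)
  then have "x \<in> closure (ips i)" using x closure_subset by blast
  then have "x islimpt ips i"
    using interior_limit_point[of x "ips i"] by (auto simp: closure_def)
  then show "at x within ips i \<noteq> bot" by (simp add: trivial_limit_within)
  show "(f \<longlongrightarrow> f x) (at x within ips i)" if "continuous_on (piece S i) f"
    using that x by (auto simp: continuous_on_def intro: tendsto_within_subset[OF _ interior_subset])
qed

lemma eventually_ips: "\<forall>\<^sub>F u in at x within ips i. u \<in> ips i"
  by (auto simp: eventually_at_filter)

lemma gen_bounded: "\<exists>G. \<forall>x\<in>{0..1}. \<bar>gen S x\<bar> \<le> G"
proof -
  obtain \<alpha> \<epsilon> \<theta> K where u: "unif \<alpha> \<epsilon> \<theta> K" using unif_exists by blast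
  have "\<bar>gen S x\<bar> \<le> K" if x: "x \<in> {0..1}" for x
  proof -
    note i = letter[OF x]
    have nh: "nh \<epsilon> \<alpha> (ips (letter S x)) K (gen S)" and \<epsilon>: "0 < \<epsilon>" using u i(1) by (auto simp: unif_def)
    have "((\<lambda>u. \<bar>gen S u\<bar>) \<longlongrightarrow> \<bar>gen S x\<bar>) (at x within ips (letter S x))"
      using piece_within(2)[OF i gen_cont[OF i(1)]] by (rule tendsto_rabs)
    moreover have "\<forall>\<^sub>F u in at x within ips (letter S x). \<bar>gen S u\<bar> \<le> K"
      using eventually_ips by (rule eventually_mono) (rule nhD(1)[OF nh \<epsilon>])
    ultimately show ?thesis using piece_within(1)[OF i] by (rule tendsto_upperbound)
  qed
  then show ?thesis by blast
qed

lemma piece_borel: "i < branches S \<Longrightarrow> piece S i \<in> sets borel"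
  by (drule piece_interval, drule is_real_interval, elim exE disjE) simp_all

lemma piecewise_measurable:
  fixes f :: "real \<Rightarrow> real"
  assumes "\<And>i. i < branches S \<Longrightarrow> continuous_on (piece S i) f"
  shows "f \<in> borel_measurable borel01"
proof (rule measurable_piecewise_restrict[of "piece S ` {..<branches S}"])
  fix \<Omega> assume "\<Omega> \<in> piece S ` {..<branches S}"
  then obtain i where i: "i < branches S" "\<Omega> = piece S i" by auto
  have "\<Omega> \<subseteq> {0..1}" using piece_sub i by simp
  then show "\<Omega> \<inter> space borel01 \<in> sets borel01"
    using piece_borel[OF i(1)] i(2) by (auto simp: sets_restrict_space space_restrict_space)
  have "{0..1} \<inter> \<Omega> = \<Omega>" using \<open>\<Omega> \<subseteq> {0..1}\<close> by auto
  then have "restrict_space borel01 \<Omega> = restrict_space borel \<Omega>"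
    using piece_borel[OF i(1)] i(2) by (simp add: restrict_restrict_space)
  then show "f \<in> borel_measurable (restrict_space borel01 \<Omega>)"
    using assms[OF i(1)] i(2) by (simp add: borel_measurable_continuous_on_restrict)
qed (use piece_cover in \<open>auto simp: space_restrict_space\<close>)

lemma tau_measurable[measurable]: "tau S \<in> borel01 \<rightarrow>\<^sub>M borel01"
  using piecewise_measurable[OF tau_cont] tau_range
  by (intro measurable_restrict_space2) (auto simp: space_restrict_space)

lemma lam_measurable[measurable]: "lam S \<in> borel_measurable borel01"
  and gen_measurable[measurable]: "gen S \<in> borel_measurable borel01"
  using piecewise_measurable lam_cont gen_cont by blast+

lemma funpow_tau_measurable[measurable]: "tau S ^^ n \<in> borel01 \<rightarrow>\<^sub>M borel01"
proof (induction n)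
  case (Suc n)
  then have "(\<lambda>x. tau S ((tau S ^^ n) x)) \<in> borel01 \<rightarrow>\<^sub>M borel01" by measurable
  then show ?case by (simp add: comp_def)
qed (simp add: id_def)

lemma letter_measurable[measurable]: "letter S \<in> borel01 \<rightarrow>\<^sub>M count_space UNIV"
proof (subst measurable_count_space_eq2_countable, rule conjI)
  show "\<forall>i\<in>UNIV. letter S -` {i} \<inter> space borel01 \<in> sets borel01"
  proof
    fix i :: nat
    have "letter S -` {i} \<inter> {0..1} = (if i < branches S then piece S i else {})"
    proof (cases "i < branches S")
      case True
      then have "letter S x = i \<and> x \<in> {0..1} \<longleftrightarrow> x \<in> piece S i" for x
        using letter(2)[of x] letter_eq[OF True, of x] piece_sub[OF True] by blast
      then show ?thesis using True by (intro set_eqI) (simp del: atLeastAtMost_iff)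
    next
      case False
      have "letter S x \<noteq> i" if "x \<in> {0..1}" for x using letter(1)[OF that] False by blast
      then show ?thesis using False by (intro set_eqI) (auto simp del: atLeastAtMost_iff)
    qed
    then have "letter S -` {i} \<inter> {0..1} \<in> sets borel" using piece_borel by simp
    then have "{0..1} \<inter> (letter S -` {i} \<inter> {0..1}) \<in> sets borel01"
      unfolding sets_restrict_space by (rule imageI)
    moreover have "{0..1} \<inter> (letter S -` {i} \<inter> {0..1}) = letter S -` {i} \<inter> space borel01"
      by (auto simp: space_restrict_space)
    ultimately show "letter S -` {i} \<inter> space borel01 \<in> sets borel01" by simp
  qed
qed auto

lemma itin_measurable[measurable]: "itin S n \<in> borel01 \<rightarrow>\<^sub>M count_space UNIV"
proof (induction n)
  case 0
  show ?case by simp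
next
  case (Suc n)
  have "(\<lambda>x. i # itin S n (tau S x)) \<in> borel01 \<rightarrow>\<^sub>M count_space UNIV" for i
    using measurable_compose[OF measurable_compose[OF tau_measurable Suc], of "\<lambda>w. i # w"] by simp
  then have "(\<lambda>x. letter S x # itin S n (tau S x)) \<in> borel01 \<rightarrow>\<^sub>M count_space UNIV"
    by (rule measurable_compose_countable[OF _ letter_measurable])
  then show ?case by (simp add: itin_Suc)
qed

lemma W_measurable[measurable]: "W S \<in> borel_measurable borel01"
proof -
  have g[measurable]: "(\<lambda>x. gen S ((tau S ^^ n) x)) \<in> borel_measurable borel01" for n
    by (rule measurable_compose[OF funpow_tau_measurable gen_measurable])
  have l[measurable]: "(\<lambda>x. lam S ((tau S ^^ n) x)) \<in> borel_measurable borel01" for n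
    by (rule measurable_compose[OF funpow_tau_measurable lam_measurable])
  have "(\<lambda>x. cocycle S (lam S) n x * gen S ((tau S ^^ n) x)) \<in> borel_measurable borel01" for n
    unfolding cocycle_def by measurable
  then show ?thesis unfolding W_def[abs_def] by (rule borel_measurable_suminf)
qed

lemma W_bounded: "\<exists>R\<ge>0. \<forall>x\<in>{0..1}. \<bar>W S x\<bar> \<le> R"
proof -
  obtain G where G: "\<And>x. x \<in> {0..1} \<Longrightarrow> \<bar>gen S x\<bar> \<le> G" using gen_bounded by blast
  obtain c where c: "c < 1" "\<And>x. x \<in> {0..1} \<Longrightarrow> lam S x \<le> c" using lam_contract by blast
  have c0: "0 < c" using c(2)[of 0] lam_range[of 0] by auto
  have G0: "0 \<le> G" using G[of 0] by auto
  have tb: "\<bar>cocycle S (lam S) n x * gen S ((tau S ^^ n) x)\<bar> \<le> c ^ n * G" if x: "x \<in> {0..1}" for n x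
  proof -
    have "\<bar>cocycle S (lam S) n x\<bar> = (\<Prod>j<n. \<bar>lam S ((tau S ^^ j) x)\<bar>)" by (simp add: cocycle_def abs_prod)
    also have "\<dots> \<le> (\<Prod>j<n. c)"
    proof (intro prod_mono conjI)
      fix j
      show "\<bar>lam S ((tau S ^^ j) x)\<bar> \<le> c"
        using c(2)[OF funpow_tau_range[OF x, of j]] lam_range[OF funpow_tau_range[OF x, of j]] by auto
    qed auto
    finally have "\<bar>cocycle S (lam S) n x\<bar> \<le> c ^ n" by simp
    then show ?thesis unfolding abs_mult using G[OF funpow_tau_range[OF x, of n]] c0 by (intro mult_mono) auto
  qed
  have s: "summable (\<lambda>n. c ^ n * G)" using c c0 by (intro summable_mult2 summable_geometric) auto
  have "\<bar>W S x\<bar> \<le> (\<Sum>n. c ^ n * G)" if x: "x \<in> {0..1}" for x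
  proof -
    have sm: "summable (\<lambda>n. \<bar>cocycle S (lam S) n x * gen S ((tau S ^^ n) x)\<bar>)"
      using tb[OF x] by (intro summable_comparison_test'[OF s, of 0]) auto
    have "\<bar>W S x\<bar> \<le> (\<Sum>n. \<bar>cocycle S (lam S) n x * gen S ((tau S ^^ n) x)\<bar>)"
      unfolding W_def by (rule summable_rabs[OF sm])
    also have "\<dots> \<le> (\<Sum>n. c ^ n * G)" using tb[OF x] sm s by (intro suminf_le) auto
    finally show ?thesis .
  qed
  moreover have "0 \<le> (\<Sum>n. c ^ n * G)" using s c0 G0 by (intro suminf_nonneg) auto
  ultimately show ?thesis by blast
qed

text \<open>\<open>X3\<close> is affine in its last argument; \<open>fibre_a\<close> and \<open>fibre_b\<close> are its coefficients.\<close>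

definition term_a :: "nat \<Rightarrow> real \<Rightarrow> real \<Rightarrow> real" where
  "term_a n \<xi> x = pull S \<xi> (Suc n) (cocycle S (gam S) (Suc n)) x *
     (pull S \<xi> n (cocycle S (lam S) n) x * pull S \<xi> (Suc n) (deriv (lam S)) x)"

definition term_b :: "nat \<Rightarrow> real \<Rightarrow> real \<Rightarrow> real" where
  "term_b n \<xi> x = pull S \<xi> (Suc n) (cocycle S (gam S) (Suc n)) x *
     (pull S \<xi> n (W_part S n) x * pull S \<xi> (Suc n) (deriv (lam S)) x + pull S \<xi> (Suc n) (deriv (gen S)) x)"

definition fibre_a :: "real \<Rightarrow> real \<Rightarrow> real" where "fibre_a \<xi> x = (\<Sum>n. term_a n \<xi> x)"
definition fibre_b :: "real \<Rightarrow> real \<Rightarrow> real" where "fibre_b \<xi> x = (\<Sum>n. term_b n \<xi> x)"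

section \<open>Uniform Hoelder bounds for the coefficients of the fibre equation\<close>

lemma nh_pull_Suc:
  assumes u: "unif \<alpha> \<epsilon> \<theta> K" and f: "\<And>i. i < branches S \<Longrightarrow> nh \<epsilon> \<alpha> (ips i) K f" and \<xi>: "\<xi> \<in> {0..1}"
  shows "nh \<epsilon> \<alpha> {0..1} K (pull S \<xi> (Suc n) f)"
  unfolding pull_def itin_snoc
  using u valid_itin[OF \<xi>, of n] letter(1)[OF funpow_tau_range[OF \<xi>, of n]]
  by (intro nh_int_lim nh_rho_word f) (auto simp: unif_def)

lemma nh_pull_cocycle:
  assumes u: "unif \<alpha> \<epsilon> \<theta> K" and f: "\<And>i. i < branches S \<Longrightarrow> nh \<epsilon> \<alpha> (ips i) \<theta> f" and \<xi>: "\<xi> \<in> {0..1}"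
  shows "nh \<epsilon> \<alpha> {0..1} (\<theta> ^ n) (pull S \<xi> n (cocycle S f n))"
  unfolding pull_def
  using u nh_cocycle[OF f valid_itin[OF \<xi>, of n]]
  by (intro nh_int_lim) (auto simp: unif_def)

lemma nh_pull_W_part:
  assumes u: "unif \<alpha> \<epsilon> \<theta> K" and \<xi>: "\<xi> \<in> {0..1}"
  shows "nh \<epsilon> \<alpha> {0..1} (K / (1 - \<theta>)) (pull S \<xi> n (W_part S n))"
  unfolding pull_def
  using u nh_W_part[OF u valid_itin[OF \<xi>, of n]]
  by (intro nh_int_lim) (auto simp: unif_def)

text \<open>The cocycle of \<open>gam\<close> supplies the decay \<open>\<theta> ^ n\<close>; the
  cocycle of \<open>lam\<close> and the partial sums of \<open>W\<close> only have to stay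
  bounded.\<close>

lemma nh_terms:
  assumes u: "unif \<alpha> \<epsilon> \<theta> K" and \<xi>: "\<xi> \<in> {0..1}"
  shows "nh \<epsilon> \<alpha> {0..1} (\<theta> ^ n * (K + K / (1 - \<theta>) * K)) (term_a n \<xi>)"
    and "nh \<epsilon> \<alpha> {0..1} (\<theta> ^ n * (K + K / (1 - \<theta>) * K)) (term_b n \<xi>)"
proof -
  have c: "0 \<le> K" "0 < \<theta>" "\<theta> < 1" "0 < \<epsilon>" using u by (auto simp: unif_def)
  have g: "nh \<epsilon> \<alpha> {0..1} (\<theta> ^ Suc n) (pull S \<xi> (Suc n) (cocycle S (gam S) (Suc n)))"
    and l: "nh \<epsilon> \<alpha> {0..1} (\<theta> ^ n) (pull S \<xi> n (cocycle S (lam S) n))"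
    and dl: "nh \<epsilon> \<alpha> {0..1} K (pull S \<xi> (Suc n) (deriv (lam S)))"
    and dg: "nh \<epsilon> \<alpha> {0..1} K (pull S \<xi> (Suc n) (deriv (gen S)))"
    using u by (intro nh_pull_cocycle[OF u _ \<xi>] nh_pull_Suc[OF u _ \<xi>]; auto simp: unif_def)+
  have KK: "0 \<le> K / (1 - \<theta>) * K" using c by simp
  have le1: "\<theta> ^ Suc n \<le> \<theta> ^ n" "\<theta> ^ n \<le> 1" "0 \<le> \<theta> ^ n" using c by (auto intro: mult_left_le_one_le power_le_one)
  have "nh \<epsilon> \<alpha> {0..1} (\<theta> ^ Suc n * (\<theta> ^ n * K)) (term_a n \<xi>)"
    unfolding term_a_def[abs_def] using c by (intro nh_mult g l dl) auto
  moreover have "\<theta> ^ Suc n * (\<theta> ^ n * K) \<le> \<theta> ^ n * (K + K / (1 - \<theta>) * K)"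
  proof (rule mult_mono)
    have "\<theta> ^ n * K \<le> 1 * K" using le1 c by (intro mult_right_mono) auto
    then show "\<theta> ^ n * K \<le> K + K / (1 - \<theta>) * K" using KK by linarith
  qed (use le1 c in auto)
  ultimately show "nh \<epsilon> \<alpha> {0..1} (\<theta> ^ n * (K + K / (1 - \<theta>) * K)) (term_a n \<xi>)" by (rule nh_mono)
  have "nh \<epsilon> \<alpha> {0..1} (\<theta> ^ Suc n * (K / (1 - \<theta>) * K + K)) (term_b n \<xi>)"
    unfolding term_b_def[abs_def] using c by (intro nh_mult nh_add g dl dg nh_pull_W_part[OF u \<xi>]) auto
  moreover have "\<theta> ^ Suc n * (K / (1 - \<theta>) * K + K) \<le> \<theta> ^ n * (K + K / (1 - \<theta>) * K)"
    using le1 c KK by (intro mult_mono) auto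
  ultimately show "nh \<epsilon> \<alpha> {0..1} (\<theta> ^ n * (K + K / (1 - \<theta>) * K)) (term_b n \<xi>)" by (rule nh_mono)
qed

text \<open>Weighted norms are summed termwise; reading off the Hoelder seminorm costs the factor
  \<open>1 / \<epsilon>\<close>.\<close>

lemma holder01_suminf:
  fixes f :: "nat \<Rightarrow> real \<Rightarrow> real"
  assumes f: "\<And>n. nh \<epsilon> \<alpha> {0..1} (\<theta> ^ n * C) (f n)" and \<theta>: "0 < \<theta>" "\<theta> < 1" and \<epsilon>: "0 < \<epsilon>"
  shows "\<And>x. x \<in> {0..1} \<Longrightarrow> summable (\<lambda>n. f n x)"
    and "holder01 \<alpha> (C / (1 - \<theta>) * (1 + 1 / \<epsilon>)) (\<lambda>x. \<Sum>n. f n x)"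
proof -
  have C: "0 \<le> C" using nhD(3)[OF f[of 0] \<epsilon>] by simp
  have geo: "(\<lambda>n. \<theta> ^ n * c) sums (c / (1 - \<theta>))" for c
    using sums_mult2[OF geometric_sums[of \<theta>], of c] \<theta> by (simp add: field_simps)
  show s: "summable (\<lambda>n. f n x)" if "x \<in> {0..1}" for x
    by (rule summable_comparison_test'[OF sums_summable[OF geo[of C]], of 0])
      (use nhD(1)[OF f \<epsilon> that] in simp)
  have bound: "\<bar>\<Sum>n. g n\<bar> \<le> c / (1 - \<theta>)" if "\<And>n. \<bar>g n\<bar> \<le> \<theta> ^ n * c" for g :: "nat \<Rightarrow> real" and c
  proof -
    have sm: "summable (\<lambda>n. \<bar>g n\<bar>)"
      using that by (intro summable_comparison_test'[OF sums_summable[OF geo[of c]], of 0]) auto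
    have "\<bar>\<Sum>n. g n\<bar> \<le> (\<Sum>n. \<bar>g n\<bar>)" by (rule summable_rabs[OF sm])
    also have "\<dots> \<le> (\<Sum>n. \<theta> ^ n * c)" using that sm sums_summable[OF geo[of c]] by (intro suminf_le) auto
    also have "\<dots> = c / (1 - \<theta>)" using geo[of c] by (simp add: sums_iff)
    finally show ?thesis .
  qed
  have C1: "0 \<le> C / (1 - \<theta>)" "0 \<le> C / (1 - \<theta>) * (1 / \<epsilon>)" using C \<theta> \<epsilon> by auto
  show "holder01 \<alpha> (C / (1 - \<theta>) * (1 + 1 / \<epsilon>)) (\<lambda>x. \<Sum>n. f n x)"
    unfolding hol_def
  proof (intro ballI conjI)
    show "0 \<le> C / (1 - \<theta>) * (1 + 1 / \<epsilon>)" using C1 by (simp add: distrib_left)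
    fix x :: real assume x: "x \<in> {0..1}"
    have "\<bar>\<Sum>n. f n x\<bar> \<le> C / (1 - \<theta>)" using nhD(1)[OF f \<epsilon> x] by (intro bound)
    then show "\<bar>\<Sum>n. f n x\<bar> \<le> C / (1 - \<theta>) * (1 + 1 / \<epsilon>)" using C1 by (simp add: distrib_left)
    fix y :: real assume y: "y \<in> {0..1}"
    have "\<bar>\<Sum>n. f n x - f n y\<bar> \<le> (C / \<epsilon> * \<bar>x - y\<bar> powr \<alpha>) / (1 - \<theta>)"
      using nhD(2)[OF f \<epsilon> x y] by (intro bound) (simp add: mult.assoc)
    also have "\<dots> = C / (1 - \<theta>) * (1 / \<epsilon>) * \<bar>x - y\<bar> powr \<alpha>" by simp
    also have "\<dots> \<le> C / (1 - \<theta>) * (1 + 1 / \<epsilon>) * \<bar>x - y\<bar> powr \<alpha>"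
      using C1 by (intro mult_right_mono) (auto simp: distrib_left)
    finally show "\<bar>(\<Sum>n. f n x) - (\<Sum>n. f n y)\<bar> \<le> C / (1 - \<theta>) * (1 + 1 / \<epsilon>) * \<bar>x - y\<bar> powr \<alpha>"
      using suminf_diff[OF s[OF x] s[OF y]] by simp
  qed
qed

lemma suminf_tail_diff:
  fixes g g' :: "nat \<Rightarrow> real"
  assumes "\<And>j. j < n \<Longrightarrow> g j = g' j" and b: "\<And>j. \<bar>g j\<bar> \<le> \<theta> ^ j * C" "\<And>j. \<bar>g' j\<bar> \<le> \<theta> ^ j * C"
    and \<theta>: "0 < \<theta>" "\<theta> < 1"
  shows "\<bar>suminf g - suminf g'\<bar> \<le> 2 * C / (1 - \<theta>) * \<theta> ^ n"
proof -
  have geo: "(\<lambda>j. \<theta> ^ j * c) sums (c / (1 - \<theta>))" for c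
    using sums_mult2[OF geometric_sums[of \<theta>], of c] \<theta> by (simp add: field_simps)
  have s: "summable g" "summable g'"
    using b by (auto intro!: summable_comparison_test'[OF sums_summable[OF geo[of C]], of 0])
  have "suminf g - suminf g' = (\<Sum>j. g (j + n)) - (\<Sum>j. g' (j + n))"
    using suminf_split_initial_segment[OF s(1), of n] suminf_split_initial_segment[OF s(2), of n] assms(1) by simp
  also have "\<dots> = (\<Sum>j. g (j + n) - g' (j + n))"
    using s by (intro suminf_diff summable_ignore_initial_segment)
  also have "\<bar>\<dots>\<bar> \<le> (\<Sum>j. \<theta> ^ j * (2 * C * \<theta> ^ n))"
  proof -
    have le: "\<bar>g (j + n) - g' (j + n)\<bar> \<le> \<theta> ^ j * (2 * C * \<theta> ^ n)" for j
      using b(1)[of "j + n"] b(2)[of "j + n"] by (simp add: power_add mult_ac)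
    have sm: "summable (\<lambda>j. \<bar>g (j + n) - g' (j + n)\<bar>)"
      using le by (intro summable_comparison_test'[OF sums_summable[OF geo[of "2 * C * \<theta> ^ n"]], of 0]) auto
    show ?thesis
      by (rule order_trans[OF summable_rabs[OF sm] suminf_le[OF le sm sums_summable[OF geo]]])
  qed
  also have "\<dots> = 2 * C / (1 - \<theta>) * \<theta> ^ n" using sums_unique[OF geo[of "2 * C * \<theta> ^ n"]] by simp
  finally show ?thesis .
qed

text \<open>The constants are chosen before \<open>\<xi>\<close>. The term with index
  \<open>j\<close> sees only the first \<open>Suc j\<close> letters of \<open>\<xi>\<close>, so for
  parameters with a common itinerary of length \<open>n\<close> the coefficients differ only by
  tails of geometrically dominated series.\<close>

lemma fibre_coefficients:
  "\<exists>\<alpha> M \<theta> D. 0 < \<alpha> \<and> \<alpha> \<le> 1 \<and> 0 < \<theta> \<and> \<theta> < 1 \<and> (\<forall>\<xi>\<in>{0..1}. holder01 \<alpha> M (fibre_a \<xi>) \<and> holder01 \<alpha> M (fibre_b \<xi>) \<and>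
     (\<forall>x\<in>{0..1}. \<forall>y. X3 S \<xi> x y = - (fibre_a \<xi> x * y + fibre_b \<xi> x)) \<and>
     (\<forall>\<xi>'\<in>{0..1}. \<forall>n. itin S n \<xi> = itin S n \<xi>' \<longrightarrow> (\<forall>x\<in>{0..1}.
        \<bar>fibre_a \<xi> x - fibre_a \<xi>' x\<bar> \<le> D * \<theta> ^ n \<and> \<bar>fibre_b \<xi> x - fibre_b \<xi>' x\<bar> \<le> D * \<theta> ^ n)))"
proof -
  obtain \<alpha> \<epsilon> \<theta> K where u: "unif \<alpha> \<epsilon> \<theta> K" using unif_exists by blast
  define C where "C = K + K / (1 - \<theta>) * K"
  have c: "0 < \<alpha>" "\<alpha> \<le> 1" "0 < \<theta>" "\<theta> < 1" "0 < \<epsilon>" using u by (auto simp: unif_def)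
  note nt = nh_terms[OF u, folded C_def]
  have X3: "X3 S \<xi> x y = - (fibre_a \<xi> x * y + fibre_b \<xi> x)" if \<xi>: "\<xi> \<in> {0..1}" and x: "x \<in> {0..1}" for \<xi> x y
  proof -
    note s = holder01_suminf(1)[OF nt(1)[OF \<xi>] c(3,4,5) x] holder01_suminf(1)[OF nt(2)[OF \<xi>] c(3,4,5) x]
    have "X3 S \<xi> x y = - (\<Sum>n. term_a n \<xi> x * y + term_b n \<xi> x)"
      unfolding X3_def Let_def fibre_map_def term_a_def term_b_def by (simp add: algebra_simps)
    also have "(\<Sum>n. term_a n \<xi> x * y + term_b n \<xi> x) = fibre_a \<xi> x * y + fibre_b \<xi> x"
      unfolding fibre_a_def fibre_b_def using s
      by (simp add: suminf_add[symmetric] suminf_mult2 summable_mult2)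
    finally show ?thesis .
  qed
  have eq: "term_a j \<xi> = term_a j \<xi>'" "term_b j \<xi> = term_b j \<xi>'"
    if "itin S n \<xi> = itin S n \<xi>'" "j < n" for j n \<xi> \<xi>'
  proof -
    have "itin S j \<xi> = itin S j \<xi>'" "itin S (Suc j) \<xi> = itin S (Suc j) \<xi>'"
      using that itin_take[of j n] itin_take[of "Suc j" n] by auto
    then show "term_a j \<xi> = term_a j \<xi>'" "term_b j \<xi> = term_b j \<xi>'"
      by (simp_all add: term_a_def[abs_def] term_b_def[abs_def] pull_def)
  qed
  have "\<bar>fibre_a \<xi> x - fibre_a \<xi>' x\<bar> \<le> 2 * C / (1 - \<theta>) * \<theta> ^ n \<and> \<bar>fibre_b \<xi> x - fibre_b \<xi>' x\<bar> \<le> 2 * C / (1 - \<theta>) * \<theta> ^ n"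
    if \<xi>: "\<xi> \<in> {0..1}" "\<xi>' \<in> {0..1}" "itin S n \<xi> = itin S n \<xi>'" and x: "x \<in> {0..1}" for \<xi> \<xi>' n x
    unfolding fibre_a_def fibre_b_def
    using nhD(1)[OF nt(1)[OF \<xi>(1)] c(5) x] nhD(1)[OF nt(1)[OF \<xi>(2)] c(5) x]
      nhD(1)[OF nt(2)[OF \<xi>(1)] c(5) x] nhD(1)[OF nt(2)[OF \<xi>(2)] c(5) x] eq[OF \<xi>(3)] c(3,4)
    by (intro conjI suminf_tail_diff) auto
  then show ?thesis
    using holder01_suminf(2)[OF nt(1) c(3,4,5)] holder01_suminf(2)[OF nt(2) c(3,4,5)] X3 c(1-4)
    by (intro exI[of _ \<alpha>] exI[of _ "C / (1 - \<theta>) * (1 + 1 / \<epsilon>)"] exI[of _ \<theta>] exI[of _ "2 * C / (1 - \<theta>)"])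
      (simp add: fibre_a_def[abs_def] fibre_b_def[abs_def])
qed

text \<open>Replacing \<open>\<xi>\<close> by a representative of its cylinder of rank
  \<open>n\<close> leaves a function that depends on \<open>\<xi>\<close> through countably many
  words, hence is measurable; by \<open>close\<close> these functions converge uniformly.\<close>

lemma joint_measurable:
  fixes F :: "real \<Rightarrow> real \<Rightarrow> real"
  assumes F: "\<And>\<xi>. \<xi> \<in> {0..1} \<Longrightarrow> F \<xi> \<in> borel_measurable borel01"
    and close: "\<And>\<xi> \<xi>' n x. \<xi> \<in> {0..1} \<Longrightarrow> \<xi>' \<in> {0..1} \<Longrightarrow> itin S n \<xi> = itin S n \<xi>' \<Longrightarrow> x \<in> {0..1} \<Longrightarrow>
       \<bar>F \<xi> x - F \<xi>' x\<bar> \<le> C * \<theta> ^ n" and \<theta>: "0 < \<theta>" "\<theta> < 1"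
  shows "(\<lambda>z. F (fst z) (snd z)) \<in> borel_measurable (borel01 \<Otimes>\<^sub>M borel01)"
proof -
  \<comment> \<open>A word that no point realises gets 0, so that \<open>rep\<close> always lies in
    the unit interval.\<close>
  define rep where "rep w = (if \<exists>\<xi>\<in>{0..1}. itin S (length w) \<xi> = w then SOME \<xi>. \<xi> \<in> {0..1} \<and> itin S (length w) \<xi> = w else 0)" for w
  have ex: "(SOME \<xi>. \<xi> \<in> {0..1} \<and> itin S (length w) \<xi> = w) \<in> {0..1} \<and>
      itin S (length w) (SOME \<xi>. \<xi> \<in> {0..1} \<and> itin S (length w) \<xi> = w) = w"
    if "\<exists>\<xi>\<in>{0..1}. itin S (length w) \<xi> = w" for w
    by (rule someI_ex) (use that in blast)
  then have rep: "rep w \<in> {0..1}" "\<exists>\<xi>\<in>{0..1}. itin S (length w) \<xi> = w \<Longrightarrow> itin S (length w) (rep w) = w" for w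
    by (auto simp: rep_def)
  have rep_itin: "itin S n (rep (itin S n \<xi>)) = itin S n \<xi>" if "\<xi> \<in> {0..1}" for n \<xi>
  proof -
    have "\<exists>\<xi>'\<in>{0..1}. itin S n \<xi>' = itin S n \<xi>" using that by blast
    then show ?thesis using rep(2)[of "itin S n \<xi>"] by simp
  qed
  show ?thesis
  proof (rule borel_measurable_LIMSEQ_real)
    fix n
    have 1: "(\<lambda>z. F (rep w) (snd z)) \<in> borel_measurable (borel01 \<Otimes>\<^sub>M borel01)" for w
      using measurable_compose[OF measurable_snd F[OF rep(1)]] .
    have 2: "(\<lambda>z. itin S n (fst z)) \<in> borel01 \<Otimes>\<^sub>M borel01 \<rightarrow>\<^sub>M count_space UNIV"
      using measurable_compose[OF measurable_fst itin_measurable] .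
    show "(\<lambda>z. F (rep (itin S n (fst z))) (snd z)) \<in> borel_measurable (borel01 \<Otimes>\<^sub>M borel01)"
      by (rule measurable_compose_countable[OF 1 2])
  next
    fix z assume "z \<in> space (borel01 \<Otimes>\<^sub>M borel01)"
    then have z: "fst z \<in> {0..1}" "snd z \<in> {0..1}" by (auto simp: space_pair_measure space_restrict_space)
    have "(\<lambda>n. C * \<theta> ^ n) \<longlonglongrightarrow> 0" 
      by (rule tendsto_mult_right_zero, rule LIMSEQ_realpow_zero) (use \<theta> in auto)
    moreover have "\<forall>\<^sub>F n in sequentially. norm (F (rep (itin S n (fst z))) (snd z) - F (fst z) (snd z)) \<le> C * \<theta> ^ n"
      using close[OF rep(1) z(1) rep_itin[OF z(1)] z(2)] by simp
    ultimately have "(\<lambda>n. F (rep (itin S n (fst z))) (snd z) - F (fst z) (snd z)) \<longlonglongrightarrow> 0"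
      by (rule Lim_null_comparison[rotated])
    then show "(\<lambda>n. F (rep (itin S n (fst z))) (snd z)) \<longlonglongrightarrow> F (fst z) (snd z)" by (rule LIM_zero_cancel)
  qed
qed

section \<open>Cylinders\<close>


text \<open>Expansion is known on interiors and is carried to the end points of a piece by
  continuity, one end at a time.\<close>

lemma tau_expand_piece:
  obtains c where "c > 1"
    "\<And>i x y. i < branches S \<Longrightarrow> x \<in> piece S i \<Longrightarrow> y \<in> piece S i \<Longrightarrow> x \<le> y \<Longrightarrow> c * (y - x) \<le> tau S y - tau S x"
proof -
  obtain c where c: "c > 1"
    "\<And>i x y. i < branches S \<Longrightarrow> x \<in> ips i \<Longrightarrow> y \<in> ips i \<Longrightarrow> x \<le> y \<Longrightarrow> c * (y - x) \<le> tau S y - tau S x"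
    using tau_expand_ips by blast
  have 1: "c * (y - x) \<le> tau S y - tau S x"
    if i: "i < branches S" and x: "x \<in> piece S i" and y: "y \<in> ips i" and xy: "x < y" for i x y
  proof (rule tendsto_le[OF piece_within(1)[OF i x]])
    show "((\<lambda>u. tau S y - tau S u) \<longlongrightarrow> tau S y - tau S x) (at x within ips i)"
      using piece_within(2)[OF i x tau_cont[OF i]] by (intro tendsto_diff tendsto_const)
    show "((\<lambda>u. c * (y - u)) \<longlongrightarrow> c * (y - x)) (at x within ips i)"
      by (intro tendsto_mult tendsto_diff tendsto_const tendsto_ident_at)
    have "\<forall>\<^sub>F u in at x within ips i. u < y" using xy by (rule order_tendstoD(2)[OF tendsto_ident_at])
    with eventually_ips show "\<forall>\<^sub>F u in at x within ips i. c * (y - u) \<le> tau S y - tau S u"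
      by eventually_elim (use c(2)[OF i _ y] in auto)
  qed
  have "c * (y - x) \<le> tau S y - tau S x"
    if i: "i < branches S" and x: "x \<in> piece S i" and y: "y \<in> piece S i" and xy: "x \<le> y" for i x y
  proof (cases "x = y")
    case False
    show ?thesis
    proof (rule tendsto_le[OF piece_within(1)[OF i y]])
      show "((\<lambda>u. tau S u - tau S x) \<longlongrightarrow> tau S y - tau S x) (at y within ips i)"
        using piece_within(2)[OF i y tau_cont[OF i]] by (intro tendsto_diff tendsto_const)
      show "((\<lambda>u. c * (u - x)) \<longlongrightarrow> c * (y - x)) (at y within ips i)"
        by (intro tendsto_mult tendsto_diff tendsto_const tendsto_ident_at)
      have "\<forall>\<^sub>F u in at y within ips i. x < u"
        using xy False by (intro order_tendstoD(1)[OF tendsto_ident_at]) auto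
      with eventually_ips show "\<forall>\<^sub>F u in at y within ips i. c * (u - x) \<le> tau S u - tau S x"
        by eventually_elim (use 1[OF i x] in auto)
    qed
  qed simp
  then show ?thesis using c(1) that by blast
qed

lemma cylinder_diameter:
  obtains \<theta> where "0 < \<theta>" "\<theta> < 1"
    "\<And>n u v. u \<in> {0..1} \<Longrightarrow> v \<in> {0..1} \<Longrightarrow> itin S n u = itin S n v \<Longrightarrow> \<bar>u - v\<bar> \<le> \<theta> ^ n"
proof -
  obtain c where c: "c > 1"
    "\<And>i x y. i < branches S \<Longrightarrow> x \<in> piece S i \<Longrightarrow> y \<in> piece S i \<Longrightarrow> x \<le> y \<Longrightarrow> c * (y - x) \<le> tau S y - tau S x"
    using tau_expand_piece by blast
  have "\<bar>u - v\<bar> \<le> (1 / c) ^ n" if "u \<in> {0..1}" "v \<in> {0..1}" "itin S n u = itin S n v" for n u v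
    using that
  proof (induction n arbitrary: u v)
    case 0
    then show ?case by auto
  next
    case (Suc n)
    have l: "letter S u = letter S v" "itin S n (tau S u) = itin S n (tau S v)"
      using Suc.prems(3) by (auto simp: itin_Suc)
    note i = letter(1)[OF Suc.prems(1)] and u = letter(2)[OF Suc.prems(1)] and v = letter(2)[OF Suc.prems(2), folded l(1)]
    have "c * \<bar>u - v\<bar> \<le> \<bar>tau S u - tau S v\<bar>"
      using c(2)[OF i u v] c(2)[OF i v u] by (cases "u \<le> v") auto
    also have "\<dots> \<le> (1 / c) ^ n" using Suc.IH[OF tau_range tau_range l(2)] Suc.prems(1,2) by blast
    finally show ?case using c(1) by (simp add: field_simps)
  qed
  then show ?thesis using that[of "1 / c"] c(1) by auto
qed

text \<open>The piece containing \<open>e\<close> is an interval with an interior point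
  \<open>p\<close>, so everything strictly between \<open>e\<close> and \<open>p\<close> is interior
  to it.\<close>

lemma endpoint_letter:
  assumes e: "e = 0 \<or> e = (1::real)"
  shows "\<forall>\<^sub>F u in at e within {0<..<1}. u \<in> ips (letter S e)"
proof -
  have e01: "e \<in> {0..1}" using e by auto
  note i = letter[OF e01]
  obtain p where p: "p \<in> ips (letter S e)" using ips_ne[OF i(1)] by blast
  have p01: "0 < p" "p < 1" using p ips_sub[OF i(1)] by auto
  have pp: "p \<in> piece S (letter S e)" using p interior_subset by blast
  have mem: "z \<in> piece S (letter S e)" if "min e p \<le> z" "z \<le> max e p" for z
    using piece_interval[OF i(1)] i(2) pp that unfolding is_interval_1 min_def max_def
    by (metis (full_types))
  have sub: "{min e p<..<max e p} \<subseteq> ips (letter S e)"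
    using mem by (intro interior_maximal) auto
  have "\<forall>\<^sub>F u in at e within {0<..<1}. u \<in> {min e p<..<max e p}"
  proof (cases "e = 0")
    case True
    have "\<forall>\<^sub>F u in at e within {0<..<1}. u < p"
      using True p01 by (intro order_tendstoD(2)[OF tendsto_ident_at]) auto
    moreover have "\<forall>\<^sub>F u in at e within {0<..<1}. u \<in> {0<..<1}" by (auto simp: eventually_at_filter)
    ultimately show ?thesis by eventually_elim (use True in auto)
  next
    case False
    then have e1: "e = 1" using e by auto
    have "\<forall>\<^sub>F u in at e within {0<..<1}. p < u"
      using e1 p01 by (intro order_tendstoD(1)[OF tendsto_ident_at]) auto
    moreover have "\<forall>\<^sub>F u in at e within {0<..<1}. u \<in> {0<..<1}" by (auto simp: eventually_at_filter)
    ultimately show ?thesis by eventually_elim (use e1 in auto)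
  qed
  then show ?thesis by eventually_elim (use sub in blast)
qed

text \<open>The branch at \<open>e\<close> is increasing and maps its interior onto the open unit
  interval, which leaves no gap between \<open>tau S e\<close> and \<open>e\<close>. With 0 and 1
  fixed, itineraries of a given length are constant near them.\<close>

lemma endpoint_tau:
  assumes e: "e = 0 \<or> e = (1::real)"
  shows "tau S e = e" "filterlim (tau S) (at e within {0<..<1}) (at e within {0<..<1})"
proof -
  have e01: "e \<in> {0..1}" using e by auto
  note i = letter[OF e01]
  obtain c where c: "c > 1"
    "\<And>i x y. i < branches S \<Longrightarrow> x \<in> piece S i \<Longrightarrow> y \<in> piece S i \<Longrightarrow> x \<le> y \<Longrightarrow> c * (y - x) \<le> tau S y - tau S x"
    using tau_expand_piece by blast
  have mono: "tau S x \<le> tau S y" if "x \<in> piece S (letter S e)" "y \<in> piece S (letter S e)" "x \<le> y" for x y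
  proof -
    have "0 \<le> c * (y - x)" using c(1) that by simp
    then show ?thesis using c(2)[OF i(1) that] by linarith
  qed
  have hit: "\<exists>p\<in>ips (letter S e). tau S p = r" if "0 < r" "r < 1" for r
  proof -
    have "r \<in> tau S ` ips (letter S e)" using tau_bij[OF i(1)] that by (auto simp: bij_betw_def)
    then show ?thesis by blast
  qed
  have sub: "p \<in> piece S (letter S e) \<and> 0 < p \<and> p < 1" if "p \<in> ips (letter S e)" for p
    using that interior_subset ips_sub[OF i(1)] by force
  show te: "tau S e = e"
  proof (rule ccontr)
    assume neg: "tau S e \<noteq> e"
    have t01: "0 \<le> tau S e" "tau S e \<le> 1" using tau_range[OF e01] by auto
    show False
    proof (cases "e = 0")
      case True
      \<comment> \<open>A preimage of a value strictly between \<open>e\<close> and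
        \<open>tau S e\<close> contradicts monotonicity.\<close>
      then obtain p where p: "p \<in> ips (letter S e)" "tau S p = tau S e / 2"
        using hit[of "tau S e / 2"] neg t01 by auto
      have "tau S e \<le> tau S p" using mono[OF i(2)] sub[OF p(1)] True by auto
      then show False using p(2) neg t01 True by auto
    next
      case False
      then have e1: "e = 1" using e by auto
      then obtain p where p: "p \<in> ips (letter S e)" "tau S p = (1 + tau S e) / 2"
        using hit[of "(1 + tau S e) / 2"] neg t01 by auto
      have "tau S p \<le> tau S e" using mono[OF _ i(2)] sub[OF p(1)] e1 by auto
      then show False using p(2) neg t01 e1 by auto
    qed
  qed
  have ev: "\<forall>\<^sub>F u in at e within {0<..<1}. tau S u \<in> {0<..<1} \<and> tau S u \<noteq> e"
    using endpoint_letter[OF e]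
  proof eventually_elim
    case (elim u)
    then have "tau S u \<in> {0<..<1}" using tau_bij[OF i(1)] by (auto simp: bij_betw_def)
    then show ?case using e by auto
  qed
  have "(tau S \<longlongrightarrow> e) (at e within ips (letter S e))"
    using piece_within(2)[OF i tau_cont[OF i(1)]] te by simp
  moreover have "at e within {0<..<1} \<le> at e within ips (letter S e)"
    using endpoint_letter[OF e] unfolding le_filter_def
    by (auto simp: eventually_at_filter elim: eventually_elim2)
  ultimately have "(tau S \<longlongrightarrow> e) (at e within {0<..<1})" by (rule tendsto_mono[rotated])
  then show "filterlim (tau S) (at e within {0<..<1}) (at e within {0<..<1})"
    using ev by (simp add: filterlim_at)
qed

lemma endpoint_itin:
  assumes e: "e = 0 \<or> e = (1::real)"
  shows "\<forall>\<^sub>F u in at e within {0<..<1}. itin S n u = itin S n e"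
proof (induction n)
  case (Suc n)
  have e01: "e \<in> {0..1}" using e by auto
  have "\<forall>\<^sub>F u in at e within {0<..<1}. itin S n (tau S u) = itin S n e"
    using Suc endpoint_tau(2)[OF e] by (auto simp: filterlim_iff)
  with endpoint_letter[OF e] show ?case
  proof eventually_elim
    case (elim u)
    have "letter S u = letter S e"
      using elim(1) interior_subset letter(1)[OF e01] by (intro letter_eq) auto
    then show ?case using elim(2) endpoint_tau(1)[OF e] by (simp add: itin_Suc)
  qed
qed simp

text \<open>\<open>rho_word\<close> applies the first letter of \<open>w\<close> innermost, so the
  forward orbit undoes the letters from the last one on.\<close>

lemma itin_rho_word:
  assumes "valid w" "u \<in> {0<..<1}"
  shows "itin S (length w + N) (rho_word S w u) = rev w @ itin S N u"
  using assms(1)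
proof (induction w rule: rev_induct)
  case (snoc i w)
  have "rho_word S (w @ [i]) u \<in> piece S i" using rho_word_snoc_interior(1)[OF snoc.prems assms(2)] interior_subset by blast
  then have "letter S (rho_word S (w @ [i]) u) = i" using snoc.prems by (intro letter_eq) auto
  then show ?case
    using snoc rho_word_snoc_interior(2)[OF snoc.prems assms(2)] by (simp add: itin_Suc del: rho_word_snoc)
qed simp

text \<open>In the interior the pulled back function depends on \<open>u\<close> only through its
  itinerary, which is eventually constant as \<open>u\<close> tends to 0 or 1. So the limit in
  \<open>pull\<close> exists and is the eventual value.\<close>

lemma pull_measure_cyl:
  assumes \<xi>: "\<xi> \<in> {0..1}" and x: "x \<in> {0..1}"
  shows "pull S \<xi> M (\<lambda>v. measure \<nu> (cyl_at S (M + N) v)) x = measure \<nu> (cyl S (rev (itin S M \<xi>) @ itin S N x))"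
proof -
  let ?f = "\<lambda>u. measure \<nu> (cyl_at S (M + N) (rho_word S (itin S M \<xi>) u))"
  have f: "?f u = measure \<nu> (cyl S (rev (itin S M \<xi>) @ itin S N u))" if "u \<in> {0<..<1}" for u
    using itin_rho_word[OF valid_itin[OF \<xi>, of M] that, of N] by simp
  show ?thesis
  proof (cases "x \<in> {0<..<1}")
    case True
    then show ?thesis using f[OF True] by (simp add: pull_def int_lim_def)
  next
    case False
    then have e: "x = 0 \<or> x = 1" using x by auto
    have in01: "\<forall>\<^sub>F u in at x within {0<..<1}. u \<in> {0<..<1}" by (auto simp: eventually_at_filter)
    have "\<forall>\<^sub>F u in at x within {0<..<1}. ?f u = measure \<nu> (cyl S (rev (itin S M \<xi>) @ itin S N x))"
      using endpoint_itin[OF e, of N] in01 by eventually_elim (simp add: f)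
    then have "Lim (at x within {0<..<1}) ?f = measure \<nu> (cyl S (rev (itin S M \<xi>) @ itin S N x))"
      using at_within_01_nontrivial[OF x] by (intro tendsto_Lim tendsto_eventually)
    then show ?thesis using False by (auto simp: pull_def int_lim_def)
  qed
qed

lemma rho_word_append: "rho_word S (w @ w') u = rho_word S w' (rho_word S w u)"
  by (simp add: rho_word_def)

text \<open>The limit point coded by \<open>s\<close> can only miss the itinerary \<open>s\<close> if it is mapped to an end point,
  in which case \<open>s\<close> is eventually constant.\<close>

lemma itinerary_exists:
  assumes s: "\<And>n. s n < branches S" and nb: "\<And>m t. s m \<noteq> t \<Longrightarrow> \<exists>j>m. s j \<noteq> t"
  shows "\<exists>\<xi>\<in>{0..1}. \<forall>n. itin S n \<xi> = map s [0..<n]"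
proof -
  \<comment> \<open>\<open>u j n\<close> realises \<open>n\<close> letters of \<open>s\<close> from
    position \<open>j\<close> on; the base point 1/2 stands for any interior point.\<close>
  define u where "u j n = rho_word S (rev (map s [j..<j + n])) (1/2)" for j n
  have val: "valid (rev (map s [j..<k]))" for j k using s by (auto simp: valid_def)
  have half: "(1/2::real) \<in> {0<..<1}" by simp
  have u01: "u j n \<in> {0<..<1}" for j n unfolding u_def by (rule rho_word_range[OF val half])
  have u_Suc: "u j (Suc n) = rho S (s j) (u (Suc j) n)" for j n
    by (simp add: u_def upt_conv_Cons rho_word_append del: upt_Suc) (simp add: rho_word_def)
  have u_itin: "itin S n (u j n) = map s [j..<j + n]" for j n
    using itin_rho_word[OF val half, of j "j + n" 0] by (simp add: u_def)
  obtain \<theta> where \<theta>: "0 < \<theta>" "\<theta> < 1"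
    "\<And>n u v. u \<in> {0..1} \<Longrightarrow> v \<in> {0..1} \<Longrightarrow> itin S n u = itin S n v \<Longrightarrow> \<bar>u - v\<bar> \<le> \<theta> ^ n"
    using cylinder_diameter by blast
  have in01: "u j n \<in> {0..1}" for j n using u01[of j n] by auto
  have "\<exists>l. u j \<longlonglongrightarrow> l" for j
  proof -
    have "Cauchy (u j)"
    proof (rule metric_CauchyI)
      fix e :: real assume "e > 0"
      then obtain M where M: "\<theta> ^ M < e" using real_arch_pow_inv[of e \<theta>] \<theta> by auto
      have "dist (u j m) (u j n) < e" if "m \<ge> M" "n \<ge> M" for m n
      proof -
        have "itin S M (u j k) = map s [j..<j + M]" if "k \<ge> M" for k
          using itin_take[OF that, of "u j k"] u_itin[of k j] that by (simp add: take_map take_upt)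
        then have "\<bar>u j m - u j n\<bar> \<le> \<theta> ^ M" using \<theta>(3)[OF in01 in01] that by auto
        then show ?thesis using M by (simp add: dist_real_def)
      qed
      then show "\<exists>M. \<forall>m\<ge>M. \<forall>n\<ge>M. dist (u j m) (u j n) < e" by blast
    qed
    then show ?thesis by (simp add: Cauchy_convergent_iff convergent_def)
  qed
  then obtain z where z: "\<And>j. u j \<longlonglongrightarrow> z j" by metis
  have z01: "z j \<in> {0..1}" for j
    using closed_sequentially[OF closed_atLeastAtMost in01 z] .
  have step: "z j = rho S (s j) (z (Suc j))" if "z (Suc j) \<in> {0<..<1}" for j
  proof -
    have "(\<lambda>n. rho S (s j) (u (Suc j) n) - rho S (s j) (z (Suc j))) \<longlonglongrightarrow> 0"
    proof (rule Lim_null_comparison)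
      show "\<forall>\<^sub>F n in sequentially. norm (rho S (s j) (u (Suc j) n) - rho S (s j) (z (Suc j))) \<le> \<bar>u (Suc j) n - z (Suc j)\<bar>"
        using rho_contract[OF s u01 that] by simp
      show "(\<lambda>n. \<bar>u (Suc j) n - z (Suc j)\<bar>) \<longlonglongrightarrow> 0"
        using tendsto_rabs_zero[OF LIM_zero[OF z]] .
    qed
    then have "(\<lambda>n. u j (Suc n)) \<longlonglongrightarrow> rho S (s j) (z (Suc j))" unfolding u_Suc by (rule LIM_zero_cancel)
    moreover have "(\<lambda>n. u j (Suc n)) \<longlonglongrightarrow> z j" using z by (rule LIMSEQ_Suc)
    ultimately show ?thesis by (rule LIMSEQ_unique[rotated])
  qed
  \<comment> \<open>An interior sequence tending to an end point eventually stays in the piece of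
    that end point, which forces the letter; its image tends to the same end point.\<close>
  have edge: "s k = letter S e \<and> z (Suc k) = e" if e: "e = 0 \<or> e = 1" "z k = e" for k e
  proof -
    have fl: "filterlim (\<lambda>n. u k (Suc n)) (at e within {0<..<1}) sequentially"
      using LIMSEQ_Suc[OF z[of k]] u01[of k] e unfolding filterlim_at
      by (auto intro!: always_eventually simp: less_imp_neq) (metis less_irrefl)+
    have e01: "e \<in> {0..1}" using e by auto
    have "\<forall>\<^sub>F n in sequentially. u k (Suc n) \<in> ips (letter S e)"
      using fl endpoint_letter[OF e(1)] by (auto simp: filterlim_iff)
    then obtain n where "u k (Suc n) \<in> ips (letter S e)" by (auto simp: eventually_sequentially)
    moreover have "u k (Suc n) \<in> ips (s k)" unfolding u_Suc by (rule rho_interior(1)[OF s u01])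
    ultimately have "s k = letter S e"
      using piece_disjoint[OF s letter(1)[OF e01]] interior_subset by blast
    moreover have "(\<lambda>n. tau S (u k (Suc n))) \<longlonglongrightarrow> e"
    proof -
      have "filterlim (\<lambda>n. tau S (u k (Suc n))) (at e within {0<..<1}) sequentially"
        by (rule filterlim_compose[OF endpoint_tau(2)[OF e(1)] fl])
      then show ?thesis by (simp add: filterlim_at)
    qed
    then have "u (Suc k) \<longlonglongrightarrow> e" unfolding u_Suc rho_interior(2)[OF s u01] .
    then have "z (Suc k) = e" by (rule LIMSEQ_unique[OF z])
    ultimately show ?thesis by simp
  qed
  show ?thesis
  proof (cases "\<exists>k. z k = 0 \<or> z k = 1")
    case True
    then obtain k e where k: "z k = e" "e = 0 \<or> e = 1" by auto
    have "z (k + j) = e" for j by (induction j) (use k edge in auto)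
    then have tail: "s (k + j) = letter S e" for j using edge[of e "k + j"] k by auto
    have all: "s m = letter S e" for m
    proof (rule ccontr)
      assume "s m \<noteq> letter S e"
      \<comment> \<open>Only finitely many letters differ from that of the tail; the last of them
        would violate \<open>nb\<close>.\<close>
      define A where "A = {m. s m \<noteq> letter S e}"
      have "A \<subseteq> {..<k}"
      proof
        fix j assume "j \<in> A"
        then show "j \<in> {..<k}" using tail[of "j - k"] by (cases "j < k") (auto simp: A_def)
      qed
      then have fin: "finite A" by (rule finite_subset) simp
      moreover have "A \<noteq> {}" using \<open>s m \<noteq> letter S e\<close> by (auto simp: A_def)
      ultimately have "Max A \<in> A" by (rule Max_in)
      then obtain j where "j > Max A" "j \<in> A" using nb[of "Max A" "letter S e"] by (auto simp: A_def)
      then show False using Max_ge[OF fin] by fastforce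
    qed
    have fix1: "(tau S ^^ n) e = e" for n by (induction n) (use endpoint_tau(1)[OF k(2)] in auto)
    have "itin S n e = map s [0..<n]" for n by (simp add: itin_def fix1 all)
    then show ?thesis using k(2) by (intro bexI[of _ e]) auto
  next
    case False
    have zi: "z j \<in> {0<..<1}" for j
      using False z01[of j] by (metis atLeastAtMost_iff greaterThanLessThan_iff order_le_less)
    have "(tau S ^^ n) (z 0) = z n" for n
    proof (induction n)
      case (Suc n)
      then show ?case using rho_interior(2)[OF s zi, of n "Suc n"] step[OF zi, of n] by simp
    qed simp
    moreover have "letter S (z n) = s n" for n
    proof (rule letter_eq[OF s])
      show "z n \<in> piece S (s n)"
        using rho_interior(1)[OF s zi, of n "Suc n"] step[OF zi, of n] interior_subset by auto
    qed
    ultimately have "itin S n (z 0) = map s [0..<n]" for n by (simp add: itin_def)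
    then show ?thesis using z01 by blast
  qed
qed


section \<open>Rectangles of cylinders as a generator of the Borel sets of the square\<close>

abbreviation square :: "(real \<times> real) measure" where
  "square \<equiv> restrict_space borel ({0..1} \<times> {0..1})"

text \<open>Both factors have the same rank: cylinders of ranks \<open>n \<le> m\<close> are nested
  or disjoint, so these rectangles are closed under intersection once the empty set is
  added.\<close>

definition rects :: "(real \<times> real) set set" where
  "rects = insert {} {cyl_at S n \<xi> \<times> cyl_at S n x | n \<xi> x. \<xi> \<in> {0..1} \<and> x \<in> {0..1}}"

lemma cyl_at_mem: "v \<in> cyl_at S n x \<longleftrightarrow> v \<in> {0..1} \<and> itin S n v = itin S n x"
  by (simp add: cyl_def)

lemma cyl_borel: "cyl S w \<in> sets borel01"
proof -
  have "itin S (length w) -` {w} \<inter> space borel01 \<in> sets borel01"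
    by (rule measurable_sets[OF itin_measurable]) simp
  moreover have "itin S (length w) -` {w} \<inter> space borel01 = cyl S w"
    by (auto simp: cyl_def space_restrict_space)
  ultimately show ?thesis by simp
qed

lemma rectsI: "\<xi> \<in> {0..1} \<Longrightarrow> x \<in> {0..1} \<Longrightarrow> cyl_at S n \<xi> \<times> cyl_at S n x \<in> rects"
  unfolding rects_def by blast

lemma rects_sub: "rects \<subseteq> Pow ({0..1} \<times> {0..1})"
  unfolding rects_def by (auto simp: cyl_def)

lemma rects_Int_stable: "Int_stable rects"
proof (rule Int_stableI)
  have *: "(cyl_at S n \<xi> \<times> cyl_at S n x) \<inter> (cyl_at S m \<xi>' \<times> cyl_at S m x') \<in> rects"
    if "n \<le> m" "\<xi>' \<in> {0..1}" "x' \<in> {0..1}" for n m \<xi> x \<xi>' x'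
  proof -
    have i: "cyl_at S n z \<inter> cyl_at S m z' = (if itin S n z' = itin S n z then cyl_at S m z' else {})" for z z'
    proof -
      have key: "itin S n x = itin S n z'" if "itin S m x = itin S m z'" for x
        using itin_take[OF \<open>n \<le> m\<close>, of x] itin_take[OF \<open>n \<le> m\<close>, of z'] that by simp
      show ?thesis by (intro set_eqI) (auto simp: cyl_at_mem dest: key)
    qed
    have "(cyl_at S n \<xi> \<times> cyl_at S n x) \<inter> (cyl_at S m \<xi>' \<times> cyl_at S m x') =
       (cyl_at S n \<xi> \<inter> cyl_at S m \<xi>') \<times> (cyl_at S n x \<inter> cyl_at S m x')" by auto
    then show ?thesis using that unfolding i by (auto simp: rects_def)
  qed
  fix a b assume a: "a \<in> rects" and b: "b \<in> rects"
  show "a \<inter> b \<in> rects"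
  proof (cases "a = {} \<or> b = {}")
    case True then show ?thesis by (auto simp: rects_def)
  next
    case False
    obtain n \<xi> x where 1: "a = cyl_at S n \<xi> \<times> cyl_at S n x" "\<xi> \<in> {0..1}" "x \<in> {0..1}"
      using a False unfolding rects_def by blast
    obtain m \<xi>' x' where 2: "b = cyl_at S m \<xi>' \<times> cyl_at S m x'" "\<xi>' \<in> {0..1}" "x' \<in> {0..1}"
      using b False unfolding rects_def by blast
    show ?thesis
    proof (cases "n \<le> m")
      case True then show ?thesis using *[OF True 2(2,3), of \<xi> x] 1 2 by simp
    next
      case False
      then have "m \<le> n" by simp
      from *[OF this 1(2,3), of \<xi>' x'] show ?thesis using 1 2 by (simp add: Int_commute)
    qed
  qed
qed

lemma rects_countable: "countable rects"
proof -
  have "rects \<subseteq> insert {} ((\<lambda>(w, w'). cyl S w \<times> cyl S w') ` UNIV)"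
    unfolding rects_def by (auto simp: image_iff)
  then show ?thesis by (rule countable_subset) auto
qed

lemma cyl_rect_sets: "cyl S w \<times> cyl S w' \<in> sets square"
proof -
  have "cyl S w \<times> cyl S w' \<in> sets (borel :: (real \<times> real) measure)"
  proof -
    have "cyl S w \<in> sets borel" "cyl S w' \<in> sets borel"
      using cyl_borel by (auto simp: sets_restrict_space_iff)
    then show ?thesis by (simp add: borel_prod[symmetric])
  qed
  moreover have "cyl S w \<times> cyl S w' \<subseteq> {0..1} \<times> {0..1}" by (auto simp: cyl_def)
  ultimately show ?thesis by (subst sets_restrict_space_iff) (auto simp: borel_prod[symmetric])
qed

text \<open>Cylinders shrink geometrically, so each relatively open set is the union of the
  rectangles inside it, and there are only countably many rectangles.\<close>

lemma rects_generate: "sets square = sigma_sets ({0..1} \<times> {0..1}) rects"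
proof
  let ?\<Omega> = "{0..1} \<times> {0..1} :: (real \<times> real) set"
  obtain \<theta> where \<theta>: "0 < \<theta>" "\<theta> < 1"
    "\<And>n u v. u \<in> {0..1} \<Longrightarrow> v \<in> {0..1} \<Longrightarrow> itin S n u = itin S n v \<Longrightarrow> \<bar>u - v\<bar> \<le> \<theta> ^ n"
    using cylinder_diameter by blast
  have "(\<lambda>z. z) \<in> borel_measurable (sigma ?\<Omega> rects)"
  proof (rule borel_measurableI)
    fix U :: "(real \<times> real) set" assume U: "open U"
    have "U \<inter> ?\<Omega> = \<Union>{R \<in> rects. R \<subseteq> U}"
    proof
      show "U \<inter> ?\<Omega> \<subseteq> \<Union>{R \<in> rects. R \<subseteq> U}"
      proof
        fix z assume z: "z \<in> U \<inter> ?\<Omega>"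
        obtain r where r: "r > 0" "ball z r \<subseteq> U" using U z by (auto simp: open_contains_ball)
        obtain n where n: "\<theta> ^ n < r / 2" using real_arch_pow_inv[of "r/2" \<theta>] r(1) \<theta> by auto
        have "cyl_at S n (fst z) \<times> cyl_at S n (snd z) \<subseteq> U"
        proof
          fix p assume p: "p \<in> cyl_at S n (fst z) \<times> cyl_at S n (snd z)"
          have "\<bar>fst z - fst p\<bar> \<le> \<theta> ^ n" "\<bar>snd z - snd p\<bar> \<le> \<theta> ^ n"
            using p z by (auto simp: cyl_at_mem mem_Times_iff simp del: atLeastAtMost_iff intro!: \<theta>(3))
          moreover have "dist z p \<le> \<bar>fst z - fst p\<bar> + \<bar>snd z - snd p\<bar>"
            by (simp add: dist_prod_def dist_real_def sqrt_sum_squares_le_sum_abs)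
          ultimately have "dist z p < r" using n by linarith
          then show "p \<in> U" using r(2) by auto
        qed
        moreover have "z \<in> cyl_at S n (fst z) \<times> cyl_at S n (snd z)"
          using z by (auto simp: cyl_at_mem mem_Times_iff)
        moreover have "cyl_at S n (fst z) \<times> cyl_at S n (snd z) \<in> rects"
          using z by (intro rectsI) auto
        ultimately show "z \<in> \<Union>{R \<in> rects. R \<subseteq> U}" by blast
      qed
    qed (use rects_sub in blast)
    moreover have "\<Union>{R \<in> rects. R \<subseteq> U} \<in> sets (sigma ?\<Omega> rects)"
      using rects_sub by (intro sets.countable_Union countable_subset[OF _ rects_countable]) auto
    ultimately show "(\<lambda>z. z) -` U \<inter> space (sigma ?\<Omega> rects) \<in> sets (sigma ?\<Omega> rects)"
      using rects_sub by (simp add: space_measure_of)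
  qed
  then have id: "(\<lambda>z. z) \<in> sigma ?\<Omega> rects \<rightarrow>\<^sub>M square"
    using rects_sub by (intro measurable_restrict_space2) (auto simp: space_measure_of)
  show "sets square \<subseteq> sigma_sets ?\<Omega> rects"
  proof
    fix A assume A: "A \<in> sets square"
    then have "A \<subseteq> ?\<Omega>" using sets.sets_into_space[OF A] by (simp add: space_restrict_space)
    then have "(\<lambda>z. z) -` A \<inter> space (sigma ?\<Omega> rects) = A" using rects_sub by (auto simp: space_measure_of)
    then show "A \<in> sigma_sets ?\<Omega> rects" using measurable_sets[OF id A] rects_sub by (simp add: sets_measure_of)
  qed
  have "rects \<subseteq> sets square" unfolding rects_def using cyl_rect_sets by auto
  then show "sigma_sets ?\<Omega> rects \<subseteq> sets square"
    using sets.sigma_sets_subset[of rects square] by (simp add: space_restrict_space)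
qed

lemma square_measure_unique:
  assumes E: "prob_space E" "prob_space E'" "sets E = sets square" "sets E' = sets square"
    and eq: "\<And>n \<xi> x. \<xi> \<in> {0..1} \<Longrightarrow> x \<in> {0..1} \<Longrightarrow>
        measure E (cyl_at S n \<xi> \<times> cyl_at S n x) = measure E' (cyl_at S n \<xi> \<times> cyl_at S n x)"
  shows "E = E'"
proof -
  interpret E: prob_space E by fact
  interpret E': prob_space E' by fact
  have "{0..1} \<times> {0..1} \<in> rects"
  proof -
    have "cyl S [] = {0..1}" by (auto simp: cyl_def)
    then show ?thesis using rectsI[of 0 0 0] by simp
  qed
  then show ?thesis
    using E(3,4) rects_generate eq
    by (intro measure_eqI_generator_eq[OF rects_Int_stable rects_sub, of E E' "\<lambda>_. {0..1} \<times> {0..1}"])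
      (auto simp: rects_def E.emeasure_eq_measure E'.emeasure_eq_measure)
qed

end

section \<open>The natural extension\<close>

text \<open>Kolmogorov's theorem yields sequences of arbitrary reals; retracting the coordinates to
  the unit interval makes the coding total and changes nothing on orbits.\<close>

definition clip :: "real \<Rightarrow> real" where "clip y = max 0 (min 1 y)"

lemma clip_range: "clip y \<in> {0..1}" and clip_id: "y \<in> {0..1} \<Longrightarrow> clip y = y"
  by (auto simp: clip_def)

lemma clip_measurable[measurable]: "clip \<in> borel \<rightarrow>\<^sub>M borel01"
  unfolding clip_def[abs_def] by (intro measurable_restrict_space2) auto

lemma map_upt_measurable:
  fixes g :: "nat \<Rightarrow> 'a \<Rightarrow> nat"
  assumes "\<And>j. j < m \<Longrightarrow> g j \<in> M \<rightarrow>\<^sub>M count_space UNIV"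
  shows "(\<lambda>x. map (\<lambda>j. g j x) [0..<m]) \<in> M \<rightarrow>\<^sub>M count_space UNIV"
  using assms
proof (induction m)
  case (Suc m)
  have 1: "(\<lambda>x. map (\<lambda>j. g j x) [0..<m]) \<in> M \<rightarrow>\<^sub>M count_space UNIV" using Suc by auto
  have "(\<lambda>x. map (\<lambda>j. g j x) [0..<m] @ [i]) \<in> M \<rightarrow>\<^sub>M count_space UNIV" for i
    using measurable_compose[OF 1, of "\<lambda>w. w @ [i]"] by simp
  then have "(\<lambda>x. map (\<lambda>j. g j x) [0..<m] @ [g m x]) \<in> M \<rightarrow>\<^sub>M count_space UNIV"
    by (rule measurable_compose_countable) (use Suc in auto)
  then show ?case by simp
qed simp

locale invariant_weierstrass = weierstrass S + prob_space \<nu> for S :: wsystem and \<nu> :: "real measure" +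
  assumes sets_nu[measurable_cong]: "sets \<nu> = sets borel01" and inv: "distr \<nu> \<nu> (tau S) = \<nu>"
begin

lemma space_nu: "space \<nu> = {0..1}"
  using sets_eq_imp_space_eq[OF sets_nu] by (simp add: space_restrict_space)

lemma tau_nu: "tau S ^^ n \<in> \<nu> \<rightarrow>\<^sub>M \<nu>"
  using funpow_tau_measurable[of n] by (simp add: measurable_cong_sets[OF sets_nu sets_nu])

lemma tau_borel: "tau S ^^ n \<in> borel_measurable \<nu>"
  using tau_nu[of n] measurable_cong_sets[OF refl sets_nu, of \<nu>] by (simp add: measurable_restrict_space2_iff)

lemma distr_funpow: "distr \<nu> \<nu> (tau S ^^ n) = \<nu>"
proof (induction n)
  case 0
  show ?case by (simp add: id_def)
next
  case (Suc n)
  have "tau S \<in> \<nu> \<rightarrow>\<^sub>M \<nu>" using tau_nu[of 1] by simp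
  from distr_distr[OF this tau_nu[of n]] have "distr \<nu> \<nu> (tau S \<circ> tau S ^^ n) = \<nu>"
    by (simp only: Suc inv)
  then show ?case by (simp only: funpow.simps)
qed

text \<open>Time is counted backwards: \<open>x\<close> is the state at time \<open>-m\<close> and
  coordinate \<open>j\<close> the state at time \<open>-j\<close>.\<close>

definition past :: "nat \<Rightarrow> nat set \<Rightarrow> real \<Rightarrow> nat \<Rightarrow> real" where
  "past m J x = (\<lambda>j\<in>J. (tau S ^^ (m - j)) x)"

lemma past_measurable: "past m J \<in> \<nu> \<rightarrow>\<^sub>M PiM J (\<lambda>_. borel)"
  unfolding past_def[abs_def] using tau_borel by (intro measurable_restrict)

definition proc :: "nat set \<Rightarrow> (nat \<Rightarrow> real) measure" where
  "proc J = distr \<nu> (PiM J (\<lambda>_. borel)) (past (Max J) J)"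

text \<open>By invariance an orbit may be started further in the past without changing the law of
  its later states.\<close>

lemma proc_eq:
  assumes J: "finite J" "\<And>j. j \<in> J \<Longrightarrow> j \<le> m"
  shows "proc J = distr \<nu> (PiM J (\<lambda>_. borel)) (past m J)"
proof (cases "J = {}")
  case False
  define k where "k = m - Max J"
  have "Max J \<in> J" using J False by simp
  then have "m - j = (Max J - j) + k" if "j \<in> J" for j
    using that Max_ge[OF J(1) that] J(2)[of "Max J"] by (simp add: k_def)
  then have eq: "past m J = past (Max J) J \<circ> (tau S ^^ k)"
    by (auto simp: past_def fun_eq_iff funpow_add)
  have "distr \<nu> (PiM J (\<lambda>_. borel)) (past m J) = distr (distr \<nu> \<nu> (tau S ^^ k)) (PiM J (\<lambda>_. borel)) (past (Max J) J)"
    unfolding eq by (rule distr_distr[OF past_measurable tau_nu, symmetric])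
  then show ?thesis by (simp add: distr_funpow proc_def)
qed (simp add: proc_def past_def[abs_def] restrict_def)

text \<open>Consistency of the marginals: restriction to \<open>J\<close> keeps the starting time
  \<open>Max H\<close>, and the law does not depend on the starting time.\<close>

sublocale process: polish_projective UNIV proc
proof (rule polish_projective.intro, rule projective_family.intro)
  fix J H :: "nat set" assume JH: "J \<subseteq> H" "finite H"
  have "distr (proc H) (PiM J (\<lambda>_. borel)) (\<lambda>f. restrict f J) =
      distr \<nu> (PiM J (\<lambda>_. borel)) ((\<lambda>f. restrict f J) \<circ> past (Max H) H)"
    unfolding proc_def by (rule distr_distr[OF measurable_restrict_subset[OF JH(1)] past_measurable])
  also have "(\<lambda>f. restrict f J) \<circ> past (Max H) H = past (Max H) J"
    using JH by (auto simp: past_def fun_eq_iff restrict_def)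
  also have "distr \<nu> (PiM J (\<lambda>_. borel)) (past (Max H) J) = proc J"
    using JH by (intro proc_eq[symmetric]) (auto intro: finite_subset Max_ge)
  finally show "proc J = distr (proc H) (PiM J (\<lambda>_. borel)) (\<lambda>f. restrict f J)" by (rule sym)
next
  fix J :: "nat set"
  show "prob_space (proc J)" unfolding proc_def by (rule prob_space_distr[OF past_measurable])
qed

abbreviation path :: "(nat \<Rightarrow> real) measure" where "path \<equiv> process.lim"

lemma path_event:
  assumes "A \<in> sets (PiM {..m} (\<lambda>_. borel))"
  shows "measure path {\<omega> \<in> space path. restrict \<omega> {..m} \<in> A} = measure \<nu> {x \<in> space \<nu>. past m {..m} x \<in> A}"
proof -
  have "measure path {\<omega> \<in> space path. restrict \<omega> {..m} \<in> A} = measure path (prod_emb UNIV (\<lambda>_. borel) {..m} A)"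
    by (intro arg_cong[where f = "measure path"]) (auto simp: prod_emb_def space_PiM)
  also have "\<dots> = measure (proc {..m}) A"
    using assms by (intro process.measure_lim_emb) auto
  also have "\<dots> = measure \<nu> (past m {..m} -` A \<inter> space \<nu>)"
    by (subst proc_eq[of _ m]) (auto intro!: measure_distr[OF past_measurable] assms)
  finally show ?thesis by (simp add: vimage_def Int_def conj_commute)
qed

definition present :: "(nat \<Rightarrow> real) \<Rightarrow> real" where "present \<omega> = clip (\<omega> 0)"
text \<open>Coordinate 0 is the present; the letters of the past begin with coordinate 1, hence the
  \<open>Suc\<close>.\<close>

definition code :: "(nat \<Rightarrow> real) \<Rightarrow> nat \<Rightarrow> nat" where "code \<omega> n = letter S (clip (\<omega> (Suc n)))"

lemma code_range: "code \<omega> n < branches S"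
  unfolding code_def by (rule letter(1)[OF clip_range])

lemma coord_measurable: "(\<lambda>\<omega>. \<omega> n) \<in> borel_measurable path"
  using measurable_component_singleton[of n UNIV "\<lambda>_. borel :: real measure"]
  by (simp add: measurable_cong_sets[OF process.sets_lim refl])

lemma present_measurable[measurable]: "present \<in> path \<rightarrow>\<^sub>M borel01"
  unfolding present_def[abs_def] by (rule measurable_compose[OF coord_measurable clip_measurable])

lemma code_measurable[measurable]: "(\<lambda>\<omega>. code \<omega> n) \<in> path \<rightarrow>\<^sub>M count_space UNIV"
  unfolding code_def
  by (rule measurable_compose[OF measurable_compose[OF coord_measurable clip_measurable] letter_measurable])

lemma code_word_measurable[measurable]: "(\<lambda>\<omega>. map (code \<omega>) [0..<m]) \<in> path \<rightarrow>\<^sub>M count_space UNIV"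
  by (rule map_upt_measurable[OF code_measurable])

text \<open>Seen from time \<open>-m\<close>, the letters at times \<open>-1\<close> down to
  \<open>-m\<close> are the first \<open>m\<close> letters of the orbit in reverse order.\<close>

lemma path_code_event:
  assumes B: "B \<in> sets borel01"
  shows "measure path {\<omega> \<in> space path. map (code \<omega>) [0..<m] \<in> Q \<and> present \<omega> \<in> B} =
    measure \<nu> {x \<in> space \<nu>. rev (itin S m x) \<in> Q \<and> (tau S ^^ m) x \<in> B}"
proof -
  let ?M = "PiM {..m} (\<lambda>_. borel :: real measure)"
  define A where "A = {f \<in> space ?M. map (\<lambda>j. letter S (clip (f (Suc j)))) [0..<m] \<in> Q \<and> clip (f 0) \<in> B}"
  have c: "(\<lambda>f. f j) \<in> borel_measurable ?M" if "j \<le> m" for j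
    using that by (intro measurable_component_singleton) auto
  have 1: "(\<lambda>f. map (\<lambda>j. letter S (clip (f (Suc j)))) [0..<m]) \<in> ?M \<rightarrow>\<^sub>M count_space UNIV"
    by (intro map_upt_measurable measurable_compose[OF measurable_compose[OF c clip_measurable] letter_measurable]) simp
  have 2: "(\<lambda>f. clip (f 0)) \<in> ?M \<rightarrow>\<^sub>M borel01"
    by (rule measurable_compose[OF c clip_measurable]) simp
  have "A = (\<lambda>f. map (\<lambda>j. letter S (clip (f (Suc j)))) [0..<m]) -` Q \<inter> space ?M \<inter> ((\<lambda>f. clip (f 0)) -` B \<inter> space ?M)"
    unfolding A_def by blast
  also have "\<dots> \<in> sets ?M"
    by (intro sets.Int measurable_sets[OF 1] measurable_sets[OF 2] B) simp
  finally have A: "A \<in> sets ?M" .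
  have "{\<omega> \<in> space path. map (code \<omega>) [0..<m] \<in> Q \<and> present \<omega> \<in> B} = {\<omega> \<in> space path. restrict \<omega> {..m} \<in> A}"
  proof -
    have "map (\<lambda>j. letter S (clip (restrict \<omega> {..m} (Suc j)))) [0..<m] = map (code \<omega>) [0..<m]" for \<omega>
      by (auto simp: code_def)
    moreover have "restrict \<omega> {..m} \<in> space ?M" for \<omega> by (auto simp: space_PiM)
    moreover have "restrict \<omega> {..m} 0 = \<omega> 0" for \<omega> :: "nat \<Rightarrow> real" by simp
    ultimately show ?thesis unfolding A_def mem_Collect_eq present_def by (simp only: simp_thms)
  qed
  moreover have "{x \<in> space \<nu>. past m {..m} x \<in> A} = {x \<in> space \<nu>. rev (itin S m x) \<in> Q \<and> (tau S ^^ m) x \<in> B}"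
  proof -
    have cl: "clip ((tau S ^^ j) x) = (tau S ^^ j) x" if "x \<in> {0..1}" for j x
      using funpow_tau_range[OF that] by (rule clip_id)
    have "map (\<lambda>j. letter S (clip (past m {..m} x (Suc j)))) [0..<m] = rev (itin S m x)" if "x \<in> {0..1}" for x
      by (rule nth_equalityI) (auto simp: past_def itin_def rev_nth cl[OF that] Suc_le_eq)
    moreover have "past m {..m} x \<in> space ?M" for x by (auto simp: space_PiM past_def)
    moreover have "clip (past m {..m} x 0) = (tau S ^^ m) x" if "x \<in> {0..1}" for x
      by (simp add: past_def cl[OF that])
    ultimately show ?thesis by (auto simp: A_def space_nu simp del: atLeastAtMost_iff)
  qed
  ultimately show ?thesis using path_event[OF A] by simp
qed

text \<open>By stationarity the position of the last letter different from \<open>t\<close> would be uniformly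
  distributed, so it does not exist.\<close>

lemma AE_not_eventually_constant: "AE \<omega> in path. \<forall>m t. code \<omega> m \<noteq> t \<longrightarrow> (\<exists>j>m. code \<omega> j \<noteq> t)"
proof -
  have "AE \<omega> in path. code \<omega> m \<noteq> t \<longrightarrow> (\<exists>j>m. code \<omega> j \<noteq> t)" for m t
  proof -
    define Bad where "Bad = {\<omega> \<in> space path. code \<omega> m \<noteq> t \<and> (\<forall>j>m. code \<omega> j = t)}"
    \<comment> \<open>Points whose first letter different from \<open>t\<close> occurs at time
      \<open>k\<close>. These sets are disjoint, so their measures tend to 0, while stationarity
      bounds the measure of \<open>Bad\<close> by each of them.\<close>
    define D where "D k = {x \<in> space \<nu>. letter S ((tau S ^^ k) x) \<noteq> t \<and> (\<forall>i<k. letter S ((tau S ^^ i) x) = t)}" for k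
    have lt[measurable]: "(\<lambda>x. letter S ((tau S ^^ k) x)) \<in> \<nu> \<rightarrow>\<^sub>M count_space UNIV" for k
      using measurable_compose[OF funpow_tau_measurable letter_measurable]
      by (simp add: measurable_cong_sets[OF sets_nu refl])
    have D[measurable]: "D k \<in> sets \<nu>" for k unfolding D_def by measurable
    have Bad_m: "Bad \<in> sets path" unfolding Bad_def by measurable
    have "disjoint_family D"
      unfolding disjoint_family_on_def D_def by (auto simp: neq_iff)
    then have "(\<lambda>k. measure \<nu> (D k)) sums measure \<nu> (\<Union>k. D k)"
      by (intro finite_measure_UNION) auto
    then have lim: "(\<lambda>k. measure \<nu> (D k)) \<longlonglongrightarrow> 0" by (rule summable_LIMSEQ_zero[OF sums_summable])
    have "measure path Bad \<le> measure \<nu> (D k)" for k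
    proof -
      \<comment> \<open>Only positions up to \<open>m + k\<close> are inspected; position
        \<open>m + Suc i\<close> of the past is time \<open>k - Suc i\<close> of the orbit.\<close>
      define Q where "Q = {w :: nat list. w ! m \<noteq> t \<and> (\<forall>i<k. w ! (m + Suc i) = t)}"
      have "measure path Bad \<le> measure path {\<omega> \<in> space path. map (code \<omega>) [0..<m + Suc k] \<in> Q \<and> present \<omega> \<in> {0..1}}"
      proof (rule process.P.finite_measure_mono)
        show "Bad \<subseteq> {\<omega> \<in> space path. map (code \<omega>) [0..<m + Suc k] \<in> Q \<and> present \<omega> \<in> {0..1}}"
          using clip_range by (auto simp: Bad_def Q_def present_def nth_append simp del: upt_Suc atLeastAtMost_iff)
        have "{\<omega> \<in> space path. map (code \<omega>) [0..<m + Suc k] \<in> Q \<and> present \<omega> \<in> {0..1}} =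
          (\<lambda>\<omega>. map (code \<omega>) [0..<m + Suc k]) -` Q \<inter> space path"
          using clip_range by (auto simp: present_def simp del: atLeastAtMost_iff upt_Suc)
        also have "\<dots> \<in> sets path" by (rule measurable_sets[OF code_word_measurable]) simp
        finally show "{\<omega> \<in> space path. map (code \<omega>) [0..<m + Suc k] \<in> Q \<and> present \<omega> \<in> {0..1}} \<in> sets path" .
      qed
      also have "\<dots> = measure \<nu> {x \<in> space \<nu>. rev (itin S (m + Suc k) x) \<in> Q \<and> (tau S ^^ (m + Suc k)) x \<in> {0..1}}"
        by (rule path_code_event) (use sets.top[of borel01] in \<open>simp add: space_restrict_space\<close>)
      also have "{x \<in> space \<nu>. rev (itin S (m + Suc k) x) \<in> Q \<and> (tau S ^^ (m + Suc k)) x \<in> {0..1}} \<subseteq> D k"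
      proof
        fix x assume x: "x \<in> {x \<in> space \<nu>. rev (itin S (m + Suc k) x) \<in> Q \<and> (tau S ^^ (m + Suc k)) x \<in> {0..1}}"
        have nth: "rev (itin S (m + Suc k) x) ! (m + i) = letter S ((tau S ^^ (k - i)) x)" if "i \<le> k" for i
          using that by (simp add: rev_nth itin_def del: upt_Suc)
        have "letter S ((tau S ^^ k) x) \<noteq> t" using x nth[of 0] by (auto simp: Q_def)
        moreover have "letter S ((tau S ^^ i) x) = t" if "i < k" for i
        proof -
          have "rev (itin S (m + Suc k) x) ! (m + Suc (k - Suc i)) = t"
          proof -
            have "\<forall>i<k. rev (itin S (m + Suc k) x) ! (m + Suc i) = t" using x unfolding Q_def by blast
            then show ?thesis by (rule allE[of _ "k - Suc i"]) (use that in auto)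
          qed
          then show ?thesis using nth[of "k - i"] that by (simp add: Suc_diff_Suc)
        qed
        ultimately show "x \<in> D k" using x by (auto simp: D_def)
      qed
      then have "measure \<nu> {x \<in> space \<nu>. rev (itin S (m + Suc k) x) \<in> Q \<and> (tau S ^^ (m + Suc k)) x \<in> {0..1}} \<le> measure \<nu> (D k)"
        by (intro finite_measure_mono) auto
      finally show ?thesis .
    qed
    then have "measure path Bad \<le> 0" by (intro LIMSEQ_le_const[OF lim]) auto
    then have "Bad \<in> null_sets path"
      using Bad_m measure_nonneg[of path Bad] by (intro null_setsI) (auto simp: process.P.emeasure_eq_measure)
    from AE_not_in[OF this] AE_space show ?thesis by eventually_elim (auto simp: Bad_def)
  qed
  then show ?thesis by (simp add: AE_all_countable)
qed

text \<open>A limit of functions of finitely many letters, so that measurability is at hand.\<close>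

definition past_point :: "(nat \<Rightarrow> real) \<Rightarrow> real" where
  "past_point \<omega> = clip (Topological_Spaces.lim (\<lambda>n. rho_word S (rev (map (code \<omega>) [0..<n])) (1/2)))"

lemma past_point_measurable[measurable]: "past_point \<in> path \<rightarrow>\<^sub>M borel01"
proof -
  have "(\<lambda>\<omega>. rho_word S (rev (map (code \<omega>) [0..<n])) (1/2)) \<in> borel_measurable path" for n
    by (rule measurable_compose[OF code_word_measurable, of "\<lambda>w. rho_word S (rev w) (1/2)"]) simp
  then have "(\<lambda>\<omega>. Topological_Spaces.lim (\<lambda>n. rho_word S (rev (map (code \<omega>) [0..<n])) (1/2))) \<in> borel_measurable path"
    by (rule borel_measurable_lim_metric)
  from measurable_compose[OF this clip_measurable] show ?thesis by (simp add: past_point_def[abs_def])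
qed

text \<open>Almost every code is the itinerary of a point; the approximants share its first
  \<open>n\<close> letters and therefore converge to it.\<close>

lemma AE_past_point: "AE \<omega> in path. \<forall>n. itin S n (past_point \<omega>) = map (code \<omega>) [0..<n]"
  using AE_not_eventually_constant
proof eventually_elim
  case (elim \<omega>)
  obtain \<xi> where \<xi>: "\<xi> \<in> {0..1}" "\<And>n. itin S n \<xi> = map (code \<omega>) [0..<n]"
    using itinerary_exists[of "code \<omega>"] code_range elim by blast
  obtain \<theta> where \<theta>: "0 < \<theta>" "\<theta> < 1"
    "\<And>n u v. u \<in> {0..1} \<Longrightarrow> v \<in> {0..1} \<Longrightarrow> itin S n u = itin S n v \<Longrightarrow> \<bar>u - v\<bar> \<le> \<theta> ^ n"
    using cylinder_diameter by blast
  let ?u = "\<lambda>n. rho_word S (rev (map (code \<omega>) [0..<n])) (1/2)"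
  have le: "\<bar>?u n - \<xi>\<bar> \<le> \<theta> ^ n" for n
  proof (rule \<theta>(3)[OF _ \<xi>(1)])
    have v: "valid (rev (map (code \<omega>) [0..<n]))" using code_range by (auto simp: valid_def)
    have half: "(1/2::real) \<in> {0<..<1}" by simp
    show "?u n \<in> {0..1}" using rho_word_range[OF v half] by auto
    show "itin S n (?u n) = itin S n \<xi>" using itin_rho_word[OF v half, of 0] \<xi>(2) by simp
  qed
  have "(\<lambda>n. \<theta> ^ n) \<longlonglongrightarrow> 0" by (rule LIMSEQ_realpow_zero) (use \<theta> in auto)
  moreover have "\<forall>\<^sub>F n in sequentially. norm (?u n - \<xi>) \<le> \<theta> ^ n" using le by simp
  ultimately have "(\<lambda>n. ?u n - \<xi>) \<longlonglongrightarrow> 0" by (rule Lim_null_comparison[rotated])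
  then have "?u \<longlonglongrightarrow> \<xi>" by (rule LIM_zero_cancel)
  then have "past_point \<omega> = \<xi>" using clip_id[OF \<xi>(1)] by (simp add: past_point_def limI)
  then show ?case using \<xi>(2) by simp
qed

definition ext :: "(real \<times> real) measure" where
  "ext = distr path square (\<lambda>\<omega>. (past_point \<omega>, present \<omega>))"

lemma ext_pair_measurable: "(\<lambda>\<omega>. (past_point \<omega>, present \<omega>)) \<in> path \<rightarrow>\<^sub>M square"
proof (rule measurable_restrict_space2)
  have "past_point \<in> borel_measurable path" "present \<in> borel_measurable path"
    using past_point_measurable present_measurable by (auto simp: measurable_restrict_space2_iff)
  then show "(\<lambda>\<omega>. (past_point \<omega>, present \<omega>)) \<in> borel_measurable path" by (rule borel_measurable_Pair)
  show "(\<lambda>\<omega>. (past_point \<omega>, present \<omega>)) \<in> space path \<rightarrow> {0..1} \<times> {0..1}"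
    using clip_range by (auto simp: past_point_def present_def simp del: atLeastAtMost_iff)
qed

lemma prob_space_ext: "prob_space ext"
  unfolding ext_def by (rule process.P.prob_space_distr[OF ext_pair_measurable])

lemma itin_add: "itin S (m + n) x = itin S m x @ itin S n ((tau S ^^ m) x)"
proof (induction m arbitrary: x)
  case (Suc m)
  then show ?case by (simp add: itin_Suc funpow_swap1)
qed simp

text \<open>Almost surely the past point lies in a cylinder exactly when the code starts with its
  word. What remains is an event in finitely many coordinates, read off from the orbit started at
  time \<open>-M\<close>.\<close>

lemma ext_rect:
  assumes \<xi>: "\<xi> \<in> {0..1}" and x: "x \<in> {0..1}"
  shows "measure ext (cyl_at S M \<xi> \<times> cyl_at S N x) = measure \<nu> (cyl S (rev (itin S M \<xi>) @ itin S N x))"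
proof -
  have "measure ext (cyl_at S M \<xi> \<times> cyl_at S N x) =
      measure path ((\<lambda>\<omega>. (past_point \<omega>, present \<omega>)) -` (cyl_at S M \<xi> \<times> cyl_at S N x) \<inter> space path)"
    unfolding ext_def by (rule measure_distr[OF ext_pair_measurable cyl_rect_sets])
  also have "\<dots> = measure path {\<omega> \<in> space path. map (code \<omega>) [0..<M] \<in> {itin S M \<xi>} \<and> present \<omega> \<in> cyl_at S N x}"
  proof (rule process.P.finite_measure_eq_AE)
    show "AE \<omega> in path. \<omega> \<in> (\<lambda>\<omega>. (past_point \<omega>, present \<omega>)) -` (cyl_at S M \<xi> \<times> cyl_at S N x) \<inter> space path \<longleftrightarrow>
        \<omega> \<in> {\<omega> \<in> space path. map (code \<omega>) [0..<M] \<in> {itin S M \<xi>} \<and> present \<omega> \<in> cyl_at S N x}"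
      using AE_past_point
    proof eventually_elim
      case (elim \<omega>)
      have "past_point \<omega> \<in> {0..1}" unfolding past_point_def by (rule clip_range)
      then have "past_point \<omega> \<in> cyl_at S M \<xi> \<longleftrightarrow> map (code \<omega>) [0..<M] = itin S M \<xi>"
        using elim by (simp add: cyl_at_mem)
      then show ?case by auto
    qed
    show "(\<lambda>\<omega>. (past_point \<omega>, present \<omega>)) -` (cyl_at S M \<xi> \<times> cyl_at S N x) \<inter> space path \<in> sets path"
      by (rule measurable_sets[OF ext_pair_measurable cyl_rect_sets])
    have "{\<omega> \<in> space path. map (code \<omega>) [0..<M] \<in> {itin S M \<xi>} \<and> present \<omega> \<in> cyl_at S N x} =
       ((\<lambda>\<omega>. map (code \<omega>) [0..<M]) -` {itin S M \<xi>} \<inter> space path) \<inter> (present -` cyl_at S N x \<inter> space path)"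
      by blast
    also have "\<dots> \<in> sets path"
      by (intro sets.Int measurable_sets[OF code_word_measurable] measurable_sets[OF present_measurable cyl_borel]) simp
    finally show "{\<omega> \<in> space path. map (code \<omega>) [0..<M] \<in> {itin S M \<xi>} \<and> present \<omega> \<in> cyl_at S N x} \<in> sets path" .
  qed
  also have "\<dots> = measure \<nu> {v \<in> space \<nu>. rev (itin S M v) \<in> {itin S M \<xi>} \<and> (tau S ^^ M) v \<in> cyl_at S N x}"
    by (rule path_code_event[OF cyl_borel])
  also have "{v \<in> space \<nu>. rev (itin S M v) \<in> {itin S M \<xi>} \<and> (tau S ^^ M) v \<in> cyl_at S N x} =
      cyl S (rev (itin S M \<xi>) @ itin S N x)"
    using funpow_tau_range
    by (auto simp: space_nu cyl_def itin_add rev_swap simp del: atLeastAtMost_iff)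
  finally show ?thesis .
qed

text \<open>\<open>nu_ext\<close> is a definite description: \<open>ext\<close> witnesses existence,
  and rectangles of equal ranks already give uniqueness.\<close>

lemma nu_ext_eq: "nu_ext S \<nu> = ext"
  unfolding nu_ext_def
proof (rule the_equality)
  show "prob_space ext \<and> sets ext = sets square \<and> (\<forall>M N. \<forall>\<xi>\<in>{0..1}. \<forall>x\<in>{0..1}.
      measure ext (cyl_at S M \<xi> \<times> cyl_at S N x) = pull S \<xi> M (\<lambda>v. measure \<nu> (cyl_at S (M + N) v)) x)"
    using prob_space_ext ext_rect pull_measure_cyl by (auto simp: ext_def simp del: atLeastAtMost_iff)
  fix E assume E: "prob_space E \<and> sets E = sets square \<and> (\<forall>M N. \<forall>\<xi>\<in>{0..1}. \<forall>x\<in>{0..1}.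
      measure E (cyl_at S M \<xi> \<times> cyl_at S N x) = pull S \<xi> M (\<lambda>v. measure \<nu> (cyl_at S (M + N) v)) x)"
  show "E = ext"
  proof (rule square_measure_unique)
    fix n \<xi> x assume "\<xi> \<in> {0..1::real}" "x \<in> {0..1::real}"
    then show "measure E (cyl_at S n \<xi> \<times> cyl_at S n x) = measure ext (cyl_at S n \<xi> \<times> cyl_at S n x)"
      using E ext_rect pull_measure_cyl by metis
  qed (use E prob_space_ext in \<open>auto simp: ext_def\<close>)
qed

lemma prob_space_nu_minus: "prob_space (nu_minus S \<nu>)"
proof -
  have "fst \<in> ext \<rightarrow>\<^sub>M borel01"
  proof -
    have "fst \<in> borel_measurable square" using measurable_restrict_space1[of fst "borel :: (real \<times> real) measure" borel] by (simp add: borel_prod[symmetric])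
    then have "fst \<in> square \<rightarrow>\<^sub>M borel01" by (intro measurable_restrict_space2) (auto simp: space_restrict_space)
    then show ?thesis by (simp add: ext_def)
  qed
  then show ?thesis unfolding nu_minus_def nu_ext_eq by (rule prob_space.prob_space_distr[OF prob_space_ext])
qed


section \<open>Regularity of the projections along the fibres\<close>

lemma q_eq:
  assumes \<xi>: "\<xi> \<in> {0..1}" and x: "x \<in> {0..1}"
    and cont: "continuous_on {0..1} (fibre_a \<xi>)" "continuous_on {0..1} (fibre_b \<xi>)"
    and X3: "\<And>x y. x \<in> {0..1} \<Longrightarrow> X3 S \<xi> x y = - (fibre_a \<xi> x * y + fibre_b \<xi> x)"
  shows "q S \<xi> x = ode_E (fibre_a \<xi>) x * W S x + ode_B (fibre_a \<xi>) (fibre_b \<xi>) x"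
proof -
  have "ell_ss S \<xi> x (W S x) = (\<lambda>v\<in>{0..1}. (ode_E (fibre_a \<xi>) x * W S x + ode_B (fibre_a \<xi>) (fibre_b \<xi>) x
      - ode_B (fibre_a \<xi>) (fibre_b \<xi>) v) / ode_E (fibre_a \<xi>) v)"
    unfolding ell_ss_def linear_ode_unique[OF cont x, symmetric]
    \<comment> \<open>The two descriptions agree since the equation is tested on the unit interval
      only, where \<open>X3\<close> is affine.\<close>
    by (intro arg_cong[where f = The] ext conj_cong refl ball_cong) (simp add: X3 del: atLeastAtMost_iff)
  then show ?thesis by (simp add: q_def pi_ss_def)
qed

text \<open>Supplies the data of \<open>transversal_family\<close>: the coefficients share
  \<open>\<alpha>\<close> and \<open>M\<close>, and \<open>W\<close> is bounded, so one
  \<open>L\<close> works for all parameters.\<close>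

lemma fibre_projection_regular:
  "\<exists>\<alpha> L. 0 < \<alpha> \<and> 1 \<le> L \<and>
    (\<lambda>z. q S (fst z) (snd z)) \<in> borel_measurable (borel01 \<Otimes>\<^sub>M borel01) \<and>
    (\<lambda>z. Theta S (fst z) (snd z)) \<in> borel_measurable (borel01 \<Otimes>\<^sub>M borel01) \<and>
    (\<forall>\<xi>\<in>{0..1}. \<forall>x\<in>{0..1}. \<bar>Theta S \<xi> x\<bar> \<le> L \<and> \<bar>q S \<xi> x\<bar> \<le> L \<and> (\<forall>y\<in>{0..1}.
      \<bar>q S \<xi> x - q S \<xi> y\<bar> \<le> L * dist (x, W S x) (y, W S y) \<and>
      \<bar>W S y - W S x - Theta S \<xi> x * (y - x)\<bar> \<le> L * (\<bar>q S \<xi> x - q S \<xi> y\<bar> + \<bar>y - x\<bar> powr (1 + \<alpha>))))"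
proof -
  obtain \<alpha> M \<theta> D where c: "0 < \<alpha>" "\<alpha> \<le> 1" "0 < \<theta>" "\<theta> < 1"
    and fib: "\<forall>\<xi>\<in>{0..1}. holder01 \<alpha> M (fibre_a \<xi>) \<and> holder01 \<alpha> M (fibre_b \<xi>) \<and>
     (\<forall>x\<in>{0..1}. \<forall>y. X3 S \<xi> x y = - (fibre_a \<xi> x * y + fibre_b \<xi> x)) \<and>
     (\<forall>\<xi>'\<in>{0..1}. \<forall>n. itin S n \<xi> = itin S n \<xi>' \<longrightarrow> (\<forall>x\<in>{0..1}.
        \<bar>fibre_a \<xi> x - fibre_a \<xi>' x\<bar> \<le> D * \<theta> ^ n \<and> \<bar>fibre_b \<xi> x - fibre_b \<xi>' x\<bar> \<le> D * \<theta> ^ n))"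
    using fibre_coefficients by blast
  have hol: "holder01 \<alpha> M (fibre_a \<xi>)" "holder01 \<alpha> M (fibre_b \<xi>)" if "\<xi> \<in> {0..1}" for \<xi>
    using fib that by blast+
  have X3: "X3 S \<xi> x y = - (fibre_a \<xi> x * y + fibre_b \<xi> x)" if "\<xi> \<in> {0..1}" "x \<in> {0..1}" for \<xi> x y
    using fib that by blast
  have close: "\<bar>fibre_a \<xi> x - fibre_a \<xi>' x\<bar> \<le> D * \<theta> ^ n" "\<bar>fibre_b \<xi> x - fibre_b \<xi>' x\<bar> \<le> D * \<theta> ^ n"
    if "\<xi> \<in> {0..1}" "\<xi>' \<in> {0..1}" "itin S n \<xi> = itin S n \<xi>'" "x \<in> {0..1}" for \<xi> \<xi>' n x
    using fib that by blast+
  have cont: "continuous_on {0..1} (fibre_a \<xi>)" "continuous_on {0..1} (fibre_b \<xi>)" if "\<xi> \<in> {0..1}" for \<xi>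
    using hol[OF that] c(1) by (auto intro: holder01_continuous)
  have M: "0 \<le> M" using hol(1)[of 0] by (auto intro: holder01_nonneg)
  obtain R where R: "0 \<le> R" "\<forall>x\<in>{0..1}. \<bar>W S x\<bar> \<le> R" using W_bounded by blast
  have q: "q S \<xi> x = ode_E (fibre_a \<xi>) x * W S x + ode_B (fibre_a \<xi>) (fibre_b \<xi>) x"
    if "\<xi> \<in> {0..1}" "x \<in> {0..1}" for \<xi> x
    by (rule q_eq[OF that cont[OF that(1)] X3[OF that(1)]])
  have T: "Theta S \<xi> x = - (fibre_a \<xi> x * W S x + fibre_b \<xi> x)" if "\<xi> \<in> {0..1}" "x \<in> {0..1}" for \<xi> x
    using X3[OF that] by (simp add: Theta_def)
  have cm: "f \<in> borel_measurable borel01" if "continuous_on {0..1} f" for f :: "real \<Rightarrow> real"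
    using that by (rule borel_measurable_continuous_on_restrict)
  have sp: "space borel01 = {0..1}" by (simp add: space_restrict_space)
  have qm: "(\<lambda>z. q S (fst z) (snd z)) \<in> borel_measurable (borel01 \<Otimes>\<^sub>M borel01)"
  proof (rule joint_measurable[OF _ _ c(3,4)])
    fix \<xi> :: real assume \<xi>: "\<xi> \<in> {0..1}"
    have "(\<lambda>x. ode_E (fibre_a \<xi>) x * W S x + ode_B (fibre_a \<xi>) (fibre_b \<xi>) x) \<in> borel_measurable borel01"
      using cm[OF ode_E_cont[OF cont(1)[OF \<xi>]]] cm[OF DERIV_continuous_on[OF ode_B_deriv[OF cont[OF \<xi>]]]]
      by measurable
    then show "q S \<xi> \<in> borel_measurable borel01"
      by (subst measurable_cong[of _ _ "\<lambda>x. ode_E (fibre_a \<xi>) x * W S x + ode_B (fibre_a \<xi>) (fibre_b \<xi>) x"])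
        (use q[OF \<xi>] in \<open>auto simp: sp\<close>)
    fix \<xi>' x :: real and n assume h: "\<xi>' \<in> {0..1}" "itin S n \<xi> = itin S n \<xi>'" "x \<in> {0..1}"
    note dep = ode_dependence[OF hol(1)[OF \<xi>] hol(1)[OF h(1)] hol(2)[OF \<xi>] hol(2)[OF h(1)] c(1,2) close[OF \<xi> h(1,2)] h(3)]
    have "q S \<xi> x - q S \<xi>' x = (ode_E (fibre_a \<xi>) x - ode_E (fibre_a \<xi>') x) * W S x +
        (ode_B (fibre_a \<xi>) (fibre_b \<xi>) x - ode_B (fibre_a \<xi>') (fibre_b \<xi>') x)"
      using q[OF \<xi> h(3)] q[OF h(1,3)] by (simp add: algebra_simps)
    also have "\<bar>\<dots>\<bar> \<le> (exp M * (D * \<theta> ^ n)) * R + (1 + M) * exp M * (D * \<theta> ^ n)"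
    proof (rule order_trans[OF abs_triangle_ineq], rule add_mono)
      show "\<bar>(ode_E (fibre_a \<xi>) x - ode_E (fibre_a \<xi>') x) * W S x\<bar> \<le> (exp M * (D * \<theta> ^ n)) * R"
        unfolding abs_mult using dep(1) R h(3) by (intro mult_mono) (auto intro: order_trans[OF abs_ge_zero])
    qed (rule dep(2))
    also have "\<dots> = ((exp M * R + (1 + M) * exp M) * D) * \<theta> ^ n" by (simp add: algebra_simps)
    finally show "\<bar>q S \<xi> x - q S \<xi>' x\<bar> \<le> ((exp M * R + (1 + M) * exp M) * D) * \<theta> ^ n" .
  qed
  have Tm: "(\<lambda>z. Theta S (fst z) (snd z)) \<in> borel_measurable (borel01 \<Otimes>\<^sub>M borel01)"
  proof (rule joint_measurable[OF _ _ c(3,4)])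
    fix \<xi> :: real assume \<xi>: "\<xi> \<in> {0..1}"
    have "(\<lambda>x. - (fibre_a \<xi> x * W S x + fibre_b \<xi> x)) \<in> borel_measurable borel01"
      using cm[OF cont(1)[OF \<xi>]] cm[OF cont(2)[OF \<xi>]] by measurable
    then show "Theta S \<xi> \<in> borel_measurable borel01"
      by (subst measurable_cong[of _ _ "\<lambda>x. - (fibre_a \<xi> x * W S x + fibre_b \<xi> x)"])
        (use T[OF \<xi>] in \<open>auto simp: sp\<close>)
    fix \<xi>' x :: real and n assume h: "\<xi>' \<in> {0..1}" "itin S n \<xi> = itin S n \<xi>'" "x \<in> {0..1}"
    have "Theta S \<xi> x - Theta S \<xi>' x = - (fibre_a \<xi> x - fibre_a \<xi>' x) * W S x + - (fibre_b \<xi> x - fibre_b \<xi>' x)"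
      using T[OF \<xi> h(3)] T[OF h(1,3)] by (simp add: algebra_simps)
    also have "\<bar>\<dots>\<bar> \<le> (D * \<theta> ^ n) * R + D * \<theta> ^ n"
    proof (rule order_trans[OF abs_triangle_ineq], rule add_mono)
      show "\<bar>- (fibre_a \<xi> x - fibre_a \<xi>' x) * W S x\<bar> \<le> (D * \<theta> ^ n) * R"
        unfolding abs_mult using close(1)[OF \<xi> h] R h(3)
        by (intro mult_mono) (auto intro: order_trans[OF abs_ge_zero])
    qed (use close(2)[OF \<xi> h] in simp)
    also have "\<dots> = (D * R + D) * \<theta> ^ n" by (simp add: algebra_simps)
    finally show "\<bar>Theta S \<xi> x - Theta S \<xi>' x\<bar> \<le> (D * R + D) * \<theta> ^ n" .
  qed
  obtain L where L: "1 \<le> L" "\<And>a b w x. holder01 \<alpha> M a \<Longrightarrow> holder01 \<alpha> M b \<Longrightarrow> \<forall>x\<in>{0..1}. \<bar>w x\<bar> \<le> R \<Longrightarrow>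
    x\<in>{0..1} \<Longrightarrow> \<bar>a x * w x + b x\<bar> \<le> L \<and> \<bar>ode_E a x * w x + ode_B a b x\<bar> \<le> L \<and> (\<forall>y\<in>{0..1}.
      \<bar>(ode_E a x * w x + ode_B a b x) - (ode_E a y * w y + ode_B a b y)\<bar> \<le> L * dist (x, w x) (y, w y) \<and>
      \<bar>w y - w x - (- (a x * w x + b x)) * (y - x)\<bar> \<le>
        L * (\<bar>(ode_E a x * w x + ode_B a b x) - (ode_E a y * w y + ode_B a b y)\<bar> + \<bar>y - x\<bar> powr (1 + \<alpha>)))"
    using fibre_projection_bounds[OF c(1,2) M R(1)] by metis
  have "\<bar>Theta S \<xi> x\<bar> \<le> L \<and> \<bar>q S \<xi> x\<bar> \<le> L \<and> (\<forall>y\<in>{0..1}.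
      \<bar>q S \<xi> x - q S \<xi> y\<bar> \<le> L * dist (x, W S x) (y, W S y) \<and>
      \<bar>W S y - W S x - Theta S \<xi> x * (y - x)\<bar> \<le> L * (\<bar>q S \<xi> x - q S \<xi> y\<bar> + \<bar>y - x\<bar> powr (1 + \<alpha>)))"
    if "\<xi> \<in> {0..1}" "x \<in> {0..1}" for \<xi> x
    using L(2)[OF hol(1)[OF that(1)] hol(2)[OF that(1)] R(2) that(2)] q[OF that(1)] T[OF that] that(2)
    by (simp only: abs_minus_cancel) simp
  then show ?thesis using c(1) L(1) qm Tm by blast
qed

end

theorem lemma4p1:
  fixes S :: wsystem and \<nu> :: "real measure" and \<mu> :: "(real \<times> real) measure"
    and \<gamma>\<^sub>1 \<gamma>\<^sub>2 :: real
  assumes "weierstrass_system S"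
    and "prob_space \<nu>" and "sets \<nu> = sets borel01"
    and "distr \<nu> \<nu> (tau S) = \<nu>"
    and "\<mu> = graph_measure S \<nu>"
    and "AE (\<xi>, x) in nu_minus S \<nu> \<Otimes>\<^sub>M \<nu>.
           exact_dimensional (nu_cond S \<nu> \<xi> (q S \<xi> x)) \<and>
           dim_H (nu_cond S \<nu> \<xi> (q S \<xi> x)) = \<gamma>\<^sub>1 \<and>
           exact_dimensional (distr \<nu> borel (q S \<xi>)) \<and>
           dim_H (distr \<nu> borel (q S \<xi>)) = \<gamma>\<^sub>2"
    and "exact_dimensional \<mu>" and "dim_H \<mu> = \<gamma>\<^sub>1 + \<gamma>\<^sub>2"
    and "AE x in \<nu>. exact_dimensional (distr (nu_minus S \<nu>) borel (\<lambda>\<xi>. Theta S \<xi> x)) \<and>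
           dim_H (distr (nu_minus S \<nu>) borel (\<lambda>\<xi>. Theta S \<xi> x)) = 1"
  shows "(dim_H \<mu> \<ge> 1 \<longrightarrow> \<gamma>\<^sub>2 = 1) \<and> (dim_H \<mu> < 1 \<longrightarrow> \<gamma>\<^sub>1 = 0)"
proof -
  interpret invariant_weierstrass S \<nu>
    using assms(1-4) by (simp add: invariant_weierstrass_def weierstrass_def invariant_weierstrass_axioms_def)
  interpret P: prob_space "nu_minus S \<nu>" by (rule prob_space_nu_minus)
  have sets_P: "sets (nu_minus S \<nu>) = sets borel01" by (simp add: nu_minus_def)
  then have space_P: "space (nu_minus S \<nu>) = {0..1}"
    using sets_eq_imp_space_eq[OF sets_P] by (simp add: space_restrict_space)
  have pair: "sets (nu_minus S \<nu> \<Otimes>\<^sub>M \<nu>) = sets (borel01 \<Otimes>\<^sub>M borel01)"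
    by (rule sets_pair_measure_cong[OF sets_P sets_nu])
  obtain \<alpha> L where fib: "0 < \<alpha>" "1 \<le> L"
    "(\<lambda>z. q S (fst z) (snd z)) \<in> borel_measurable (borel01 \<Otimes>\<^sub>M borel01)"
    "(\<lambda>z. Theta S (fst z) (snd z)) \<in> borel_measurable (borel01 \<Otimes>\<^sub>M borel01)"
    "\<And>\<xi> x. \<xi> \<in> {0..1} \<Longrightarrow> x \<in> {0..1} \<Longrightarrow> \<bar>Theta S \<xi> x\<bar> \<le> L \<and> \<bar>q S \<xi> x\<bar> \<le> L \<and> (\<forall>y\<in>{0..1}.
      \<bar>q S \<xi> x - q S \<xi> y\<bar> \<le> L * dist (x, W S x) (y, W S y) \<and>
      \<bar>W S y - W S x - Theta S \<xi> x * (y - x)\<bar> \<le> L * (\<bar>q S \<xi> x - q S \<xi> y\<bar> + \<bar>y - x\<bar> powr (1 + \<alpha>)))"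
    using fibre_projection_regular by blast
  interpret T: transversal_family "nu_minus S \<nu>" \<nu> "W S" "q S" "Theta S" L \<alpha>
  proof
    show "(\<lambda>x. x) \<in> borel_measurable \<nu>" using tau_borel[of 0] by (simp add: id_def)
    show "W S \<in> borel_measurable \<nu>" by measurable
    show "(\<lambda>z. q S (fst z) (snd z)) \<in> borel_measurable (nu_minus S \<nu> \<Otimes>\<^sub>M \<nu>)"
      "(\<lambda>z. Theta S (fst z) (snd z)) \<in> borel_measurable (nu_minus S \<nu> \<Otimes>\<^sub>M \<nu>)"
      using fib(3,4) by (simp_all add: measurable_cong_sets[OF pair refl])
  qed (use fib in \<open>auto simp: space_P space_nu simp del: atLeastAtMost_iff\<close>)
  have \<mu>: "\<mu> = distr \<nu> borel T.e"
    by (simp add: assms(5) graph_measure_def T.e_def[abs_def])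
  have dimE: "has_exact_dim (distr \<nu> borel T.e) (\<gamma>\<^sub>1 + \<gamma>\<^sub>2)"
    using has_exact_dim_dim_H[of \<mu>] assms(7,8) prob_space_distr[OF T.e] by (simp add: \<mu>)
  have "AE \<xi> in nu_minus S \<nu>. AE x in \<nu>. exact_dimensional (distr \<nu> borel (q S \<xi>)) \<and> dim_H (distr \<nu> borel (q S \<xi>)) = \<gamma>\<^sub>2"
    using T.PN.AE_pair[OF assms(6)] by (rule AE_mp) (auto intro!: AE_I2 elim: AE_mp)
  then have dimQ: "AE \<xi> in nu_minus S \<nu>. has_exact_dim (distr \<nu> borel (q S \<xi>)) \<gamma>\<^sub>2"
    using AE_space
  proof eventually_elim
    case (elim \<xi>)
    \<comment> \<open>The statement does not involve \<open>x\<close>, and under a probability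
      measure it holds almost everywhere only if it holds.\<close>
    then have "exact_dimensional (distr \<nu> borel (q S \<xi>))" "dim_H (distr \<nu> borel (q S \<xi>)) = \<gamma>\<^sub>2" by simp_all
    then show ?case using has_exact_dim_dim_H[OF prob_space_distr[OF T.q_section[OF elim(2)]]] by simp
  qed
  have dimT: "AE x in \<nu>. has_exact_dim (distr (nu_minus S \<nu>) borel (\<lambda>\<xi>. Theta S \<xi> x)) 1"
    using assms(9) AE_space
  proof eventually_elim
    case (elim x)
    then show ?case
      using has_exact_dim_dim_H[OF P.prob_space_distr[OF T.\<Theta>_section[OF elim(2)]]] by simp
  qed
  have "AE \<xi> in nu_minus S \<nu>. \<xi> \<in> space (nu_minus S \<nu>) \<and> has_exact_dim (distr \<nu> borel (q S \<xi>)) \<gamma>\<^sub>2"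
    using AE_space dimQ by eventually_elim simp
  then obtain \<xi> where \<xi>: "\<xi> \<in> space (nu_minus S \<nu>)" "has_exact_dim (distr \<nu> borel (q S \<xi>)) \<gamma>\<^sub>2"
    using eventually_happens'[OF P.ae_filter_bot] by blast
  have "\<gamma>\<^sub>2 \<le> 1"
    by (rule bounded_real_dim_le_1[OF prob_space_axioms T.q_section[OF \<xi>(1)] _ \<xi>(2), of L])
      (use fib(5) \<xi>(1) in \<open>auto simp: space_P space_nu simp del: atLeastAtMost_iff\<close>)
  moreover have "\<gamma>\<^sub>2 \<le> \<gamma>\<^sub>1 + \<gamma>\<^sub>2"
    by (rule lipschitz_image_dim_le[OF prob_space_axioms T.e T.q_section[OF \<xi>(1)] _ dimE \<xi>(2), of L])
      (use T.lip[OF \<xi>(1)] in \<open>simp add: T.e_def dist_real_def\<close>)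
  moreover have "1 \<le> \<gamma>\<^sub>2" if "\<gamma>\<^sub>2 < \<gamma>\<^sub>1 + \<gamma>\<^sub>2"
    by (rule T.projection_dim_ge_1[OF dimE dimQ dimT that])
  \<comment> \<open>Either \<open>\<gamma>\<^sub>1 = 0\<close>, and \<open>\<gamma>\<^sub>2\<close>
    is the dimension of \<open>\<mu>\<close> and at most 1, or \<open>\<gamma>\<^sub>1 > 0\<close>,
    and then \<open>\<gamma>\<^sub>2 = 1\<close> and \<open>\<mu>\<close> has dimension greater than
    1.\<close>
  ultimately show ?thesis using assms(8) by linarith
qed

end
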